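(* Let $n\ge1$, $k\ge2$, $d\ge2$ be integers and let $\ell=\binom{k+d}{k}$. A generic polynomial rectangular $k$-parameter eigenvalue problem of degree $d$ with coefficient matrices of size $(n+k-1)\times n$ has exactly $d^k\binom{n+k-1}{k}$ eigenvalues, which are all finite. That is, there exists a generic set $\Omega\subset(\mathbb{C}^{(n+k-1)\times n})^\ell$ such that for every $(A_{\boldsymbol\omega})_{|\boldsymbol\omega|\le d}\in\Omega$ the set of points $[\lambda_0:\lambda_1:\cdots:\lambda_k]\in\mathbb{P}^k(\mathbb{C})$ with $$\operatorname{rank}\Big(\sum_{|\boldsymbol\omega|\le d}\lambda_0^{\,d-|\boldsymbol\omega|}\lambda_1^{\omega_1}\cdots\lambda_k^{\omega_k}A_{\boldsymbol\omega}\Big)<n$$ has exactly $d^k\binom{n+k-1}{k}$ elements, and all of them satisfy $\lambda_0\neq0$; consequently there are exactly $d^k\binom{n+k-1}{k}$ points $\boldsymbol\lambda\in\mathbb{C}^k$ with $\operatorname{rank}(M(\boldsymbol\lambda))<n$, where $M(\boldsymbol\lambda)=\sum_{|\boldsymbol\omega|\le d}\boldsymbol\lambda^{\boldsymbol\omega}A_{\boldsymbol\omega}$.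
   Context: For a multi-index $\boldsymbol\omega=(\omega_1,\dots,\omega_k)$ of nonnegative integers, $|\boldsymbol\omega|=\omega_1+\cdots+\omega_k$ and $\boldsymbol\lambda^{\boldsymbol\omega}=\lambda_1^{\omega_1}\cdots\lambda_k^{\omega_k}$. There are $\ell=\binom{k+d}{k}$ multi-indices with $|\boldsymbol\omega|\le d$. A polynomial rectangular $k$-parameter eigenvalue problem of degree $d$ is the problem $M(\boldsymbol\lambda)\mathbf{x}=\big(\sum_{|\boldsymbol\omega|\le d}\boldsymbol\lambda^{\boldsymbol\omega}A_{\boldsymbol\omega}\big)\mathbf{x}=\mathbf{0}$ with $A_{\boldsymbol\omega}\in\mathbb{C}^{(n+k-1)\times n}$ and $\mathbf{x}\in\mathbb{C}^n$ nonzero. A (finite) eigenvalue is a point $\boldsymbol\lambda\in\mathbb{C}^k$ with $\operatorname{rank}(M(\boldsymbol\lambda))<n$. Infinite eigenvalues are the points of $\mathbb{P}^k(\mathbb{C})$ with $\lambda_0=0$ at which the homogenization $\sum_{|\boldsymbol\omega|\le d}\lambda_0^{d-|\boldsymbol\omega|}\boldsymbol\lambda^{\boldsymbol\omega}A_{\boldsymbol\omega}$ has rank less than $n$; points with $\lambda_0\ne0$ are identified with $\mathbb{C}^k$ by normalizing $\lambda_0=1$. A set $\mathcal{S}\subseteq\mathbb{C}^r$ is an algebraic variety if it is the set of common zeros of finitely many complex polynomials in $r$ variables, and it is proper if $\mathcal{S}\neq\mathbb{C}^r$. A set $\Omega\subset\mathbb{C}^r$ is generic if its complement is contained in a proper algebraic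 variety. Tuples of matrices are identified with points of $\mathbb{C}^r$ via their entries. *)

theory Defs
  imports Jordan_Normal_Form.DL_Rank "HOL-Library.Poly_Mapping" "HOL-Library.FuncSet" Complex_Main
begin

text \<open>Coordinate spaces: a finite index set \<open>I\<close> stands for \<open>\<complex>\<^sup>r\<close> with \<open>r = card I\<close>.
  Extensional functions are used so that every point has a unique representative.\<close>

definition cspace :: "'v set \<Rightarrow> ('v \<Rightarrow> complex) set"
  where "cspace I = I \<rightarrow>\<^sub>E UNIV"

text \<open>A polynomial with complex coefficients maps monomials (finitely supported exponent
  functions) to coefficients.\<close>

type_synonym 'v cpoly = "('v \<Rightarrow>\<^sub>0 nat) \<Rightarrow>\<^sub>0 complex"

definition poly_vars :: "'v cpoly \<Rightarrow> 'v set"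
  where "poly_vars p = (\<Union>m\<in>Poly_Mapping.keys p. Poly_Mapping.keys m)"

definition poly_eval :: "'v cpoly \<Rightarrow> ('v \<Rightarrow> complex) \<Rightarrow> complex"
  where "poly_eval p x =
    (\<Sum>m\<in>Poly_Mapping.keys p. Poly_Mapping.lookup p m *
      (\<Prod>v\<in>Poly_Mapping.keys m. x v ^ Poly_Mapping.lookup m v))"

definition algebraic_variety :: "'v set \<Rightarrow> ('v \<Rightarrow> complex) set \<Rightarrow> bool"
  where "algebraic_variety I S \<longleftrightarrow>
    (\<exists>P. finite P \<and> (\<forall>p\<in>P. poly_vars p \<subseteq> I) \<and>
      S = {x \<in> cspace I. \<forall>p\<in>P. poly_eval p x = 0})"

definition proper_variety :: "'v set \<Rightarrow> ('v \<Rightarrow> complex) set \<Rightarrow> bool"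
  where "proper_variety I S \<longleftrightarrow> algebraic_variety I S \<and> S \<noteq> cspace I"

definition generic :: "'v set \<Rightarrow> ('v \<Rightarrow> complex) set \<Rightarrow> bool"
  where "generic I \<Omega> \<longleftrightarrow>
    \<Omega> \<subseteq> cspace I \<and> (\<exists>S. proper_variety I S \<and> cspace I - \<Omega> \<subseteq> S)"

text \<open>A multi-index \<open>(\<omega>\<^sub>1, \<dots>, \<omega>\<^sub>k)\<close> is a finitely supported function vanishing outside \<open>{1..k}\<close>.\<close>

type_synonym multi_index = "nat \<Rightarrow>\<^sub>0 nat"

definition mi_size :: "nat \<Rightarrow> multi_index \<Rightarrow> nat"
  where "mi_size k \<omega> = (\<Sum>i=1..k. Poly_Mapping.lookup \<omega> i)"

definition multi_indices :: "nat \<Rightarrow> nat \<Rightarrow> multi_index set"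
  where "multi_indices k d = {\<omega>. Poly_Mapping.keys \<omega> \<subseteq> {1..k} \<and> mi_size k \<omega> \<le> d}"

lemma card_multi_indices: "card (multi_indices k d) = (k + d) choose k"
proof -
  define f where "f = (\<lambda>\<omega>. (d - mi_size k \<omega>) # map (Poly_Mapping.lookup \<omega>) [1..<Suc k])"
  let ?L = "{l :: nat list. length l = Suc k \<and> sum_list l = d}"
  have size: "sum_list (map (Poly_Mapping.lookup \<omega>) [1..<Suc k]) = mi_size k \<omega>" for \<omega>
    by (simp only: interv_sum_list_conv_sum_set_nat mi_size_def atLeastLessThanSuc_atLeastAtMost set_upt)
  have "bij_betw f (multi_indices k d) ?L"
    unfolding bij_betw_def
  proof
    show "inj_on f (multi_indices k d)"
    proof (rule inj_onI)
      fix a b assume a: "a \<in> multi_indices k d" and b: "b \<in> multi_indices k d" and "f a = f b"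
      then have "Poly_Mapping.lookup a i = Poly_Mapping.lookup b i" if "i \<in> {1..k}" for i
        using that by (auto simp: f_def simp del: upt_Suc)
      moreover have "Poly_Mapping.lookup a i = Poly_Mapping.lookup b i" if "i \<notin> {1..k}" for i
      proof -
        have "i \<notin> Poly_Mapping.keys a" "i \<notin> Poly_Mapping.keys b"
          using a b that by (auto simp: multi_indices_def simp del: atLeastAtMost_iff)
        then show ?thesis by (simp add: in_keys_iff)
      qed
      ultimately show "a = b" by (intro poly_mapping_eqI) blast
    qed
    show "f ` multi_indices k d = ?L"
    proof (intro subset_antisym subsetI)
      fix l assume "l \<in> f ` multi_indices k d"
      then obtain \<omega> where \<omega>: "\<omega> \<in> multi_indices k d" and l: "l = f \<omega>" by blast
      have "sum_list l = d - mi_size k \<omega> + mi_size k \<omega>"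
        unfolding l f_def by (simp only: sum_list.Cons size)
      then show "l \<in> ?L" using \<omega> by (simp add: l f_def multi_indices_def)
    next
      fix l assume "l \<in> ?L"
      then obtain a m where l: "l = a # m" and m: "length m = k" and s: "a + sum_list m = d"
        by (cases l) auto
      define \<omega> :: multi_index
        where "\<omega> = Abs_poly_mapping (\<lambda>i. if i \<in> {1..k} then m ! (i - 1) else 0)"
      have "finite {i. (if i \<in> {1..k} then m ! (i - 1) else 0) \<noteq> 0}"
        by (rule finite_subset[of _ "{1..k}"]) auto
      then have lk: "Poly_Mapping.lookup \<omega> i = (if i \<in> {1..k} then m ! (i - 1) else 0)" for i
        by (simp add: \<omega>_def lookup_Abs_poly_mapping)
      have map: "map (Poly_Mapping.lookup \<omega>) [1..<Suc k] = m"
        by (rule nth_equalityI) (auto simp: m lk simp del: upt_Suc)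
      then have "mi_size k \<omega> = sum_list m" using size by metis
      moreover have "Poly_Mapping.keys \<omega> \<subseteq> {1..k}" by (auto simp: in_keys_iff lk split: if_splits)
      ultimately have "\<omega> \<in> multi_indices k d" "f \<omega> = l"
        using s map by (auto simp: multi_indices_def f_def l simp del: upt_Suc)
      then show "l \<in> f ` multi_indices k d" by blast
    qed
  qed
  then have "card (multi_indices k d) = card ?L" by (rule bij_betw_same_card)
  also have "\<dots> = (d + Suc k - 1) choose d" by (rule card_length_sum_list)
  also have "\<dots> = (k + d) choose k" using binomial_symmetric[of d "k + d"] by (simp add: add.commute)
  finally show ?thesis .
qed

definition mi_power :: "nat \<Rightarrow> (nat \<Rightarrow> complex) \<Rightarrow> multi_index \<Rightarrow> complex"
  where "mi_power k x \<omega> = (\<Prod>i=1..k. x i ^ Poly_Mapping.lookup \<omega> i)"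

definition matrix_tuples :: "nat \<Rightarrow> nat \<Rightarrow> nat \<Rightarrow> (multi_index \<Rightarrow> complex mat) set"
  where "matrix_tuples n k d = multi_indices k d \<rightarrow>\<^sub>E carrier_mat (n + k - 1) n"

definition entry_indices :: "nat \<Rightarrow> nat \<Rightarrow> nat \<Rightarrow> (multi_index \<times> nat \<times> nat) set"
  where "entry_indices n k d = multi_indices k d \<times> {..<n + k - 1} \<times> {..<n}"

definition entries ::
  "nat \<Rightarrow> nat \<Rightarrow> nat \<Rightarrow> (multi_index \<Rightarrow> complex mat) \<Rightarrow> multi_index \<times> nat \<times> nat \<Rightarrow> complex"
  where "entries n k d A = (\<lambda>(\<omega>, i, j) \<in> entry_indices n k d. A \<omega> $$ (i, j))"

lemma bij_betw_entries:
  "bij_betw (entries n k d) (matrix_tuples n k d) (cspace (entry_indices n k d))"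
proof (rule bij_betw_byWitness)
  let ?g = "\<lambda>x. \<lambda>\<omega>\<in>multi_indices k d. mat (n + k - 1) n (\<lambda>(i, j). x (\<omega>, i, j))"
  show "\<forall>A\<in>matrix_tuples n k d. ?g (entries n k d A) = A"
  proof
    fix A assume A: "A \<in> matrix_tuples n k d"
    show "?g (entries n k d A) = A"
    proof (rule ext)
      fix \<omega>
      show "?g (entries n k d A) \<omega> = A \<omega>"
      proof (cases "\<omega> \<in> multi_indices k d")
        case True
        then have "A \<omega> \<in> carrier_mat (n + k - 1) n" using A by (auto simp: matrix_tuples_def)
        then have "mat (n + k - 1) n (\<lambda>(i, j). entries n k d A (\<omega>, i, j)) = A \<omega>"
          using True by (intro eq_matI) (simp_all add: entries_def entry_indices_def)
        then show ?thesis using True by simp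
      next
        case False
        then have "A \<omega> = undefined" using PiE_arb[OF A[unfolded matrix_tuples_def]] by blast
        then show ?thesis using False by simp
      qed
    qed
  qed
  show "\<forall>x\<in>cspace (entry_indices n k d). entries n k d (?g x) = x"
  proof
    fix x assume x: "x \<in> cspace (entry_indices n k d)"
    have undef: "x v = undefined" if "v \<notin> entry_indices n k d" for v
      using PiE_arb[OF x[unfolded cspace_def] that] .
    have eq: "entries n k d (?g x) v = x v" if "v \<in> entry_indices n k d" for v
      using that by (auto simp: entries_def entry_indices_def)
    show "entries n k d (?g x) = x"
    proof (rule ext)
      fix v
      show "entries n k d (?g x) v = x v"
      proof (cases "v \<in> entry_indices n k d")
        case True
        then show ?thesis by (rule eq)
      next
        case False
        then have "entries n k d (?g x) v = undefined"
          unfolding entries_def restrict_def by (rule if_not_P)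
        then show ?thesis using undef[OF False] by (rule trans[OF _ sym])
      qed
    qed
  qed
  show "entries n k d ` matrix_tuples n k d \<subseteq> cspace (entry_indices n k d)"
    by (auto simp: entries_def cspace_def)
  show "?g ` cspace (entry_indices n k d) \<subseteq> matrix_tuples n k d"
    by (auto simp: matrix_tuples_def)
qed

definition generic_tuples :: "nat \<Rightarrow> nat \<Rightarrow> nat \<Rightarrow> (multi_index \<Rightarrow> complex mat) set \<Rightarrow> bool"
  where "generic_tuples n k d \<Omega> \<longleftrightarrow>
    \<Omega> \<subseteq> matrix_tuples n k d \<and> generic (entry_indices n k d) (entries n k d ` \<Omega>)"

text \<open>The matrix \<open>M(\<lambda>)\<close> and its homogenization; for the latter, coordinate \<open>0\<close> is the
  homogenizing variable \<open>\<lambda>\<^sub>0\<close>.\<close>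

definition pencil ::
  "nat \<Rightarrow> nat \<Rightarrow> nat \<Rightarrow> (multi_index \<Rightarrow> complex mat) \<Rightarrow> (nat \<Rightarrow> complex) \<Rightarrow> complex mat"
  where "pencil n k d A x =
    mat (n + k - 1) n (\<lambda>(i, j). \<Sum>\<omega>\<in>multi_indices k d. mi_power k x \<omega> * A \<omega> $$ (i, j))"

definition hom_pencil ::
  "nat \<Rightarrow> nat \<Rightarrow> nat \<Rightarrow> (multi_index \<Rightarrow> complex mat) \<Rightarrow> (nat \<Rightarrow> complex) \<Rightarrow> complex mat"
  where "hom_pencil n k d A x =
    mat (n + k - 1) n (\<lambda>(i, j). \<Sum>\<omega>\<in>multi_indices k d.
      x 0 ^ (d - mi_size k \<omega>) * mi_power k x \<omega> * A \<omega> $$ (i, j))"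

text \<open>The AFP rank takes the number of rows as a parameter.\<close>

definition mrank :: "complex mat \<Rightarrow> nat"
  where "mrank M = vec_space.rank (dim_row M) M"

definition nonzero_points :: "nat \<Rightarrow> (nat \<Rightarrow> complex) set"
  where "nonzero_points k = {x \<in> cspace {0..k}. \<exists>i\<in>{0..k}. x i \<noteq> 0}"

definition proj_rel :: "nat \<Rightarrow> ((nat \<Rightarrow> complex) \<times> (nat \<Rightarrow> complex)) set"
  where "proj_rel k = {(x, y). x \<in> nonzero_points k \<and> y \<in> nonzero_points k \<and>
    (\<exists>c. c \<noteq> 0 \<and> (\<forall>i\<in>{0..k}. y i = c * x i))}"

definition proj_space :: "nat \<Rightarrow> (nat \<Rightarrow> complex) set set"
  where "proj_space k = nonzero_points k // proj_rel k"

lemma equiv_proj_rel: "equiv (nonzero_points k) (proj_rel k)"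
proof (rule equivI)
  show "proj_rel k \<subseteq> nonzero_points k \<times> nonzero_points k"
    by (auto simp: proj_rel_def)
  show "refl_on (nonzero_points k) (proj_rel k)"
    by (auto simp: refl_on_def proj_rel_def intro!: exI[of _ 1])
  show "sym (proj_rel k)"
  proof (rule symI)
    fix x y assume "(x, y) \<in> proj_rel k"
    then obtain c where "x \<in> nonzero_points k" "y \<in> nonzero_points k" "c \<noteq> 0"
      "\<forall>i\<in>{0..k}. y i = c * x i" by (auto simp: proj_rel_def)
    then show "(y, x) \<in> proj_rel k"
      by (auto simp: proj_rel_def intro!: exI[of _ "inverse c"])
  qed
  show "trans (proj_rel k)"
  proof (rule transI)
    fix x y z assume "(x, y) \<in> proj_rel k" "(y, z) \<in> proj_rel k"
    then obtain c c' where "x \<in> nonzero_points k" "z \<in> nonzero_points k" "c \<noteq> 0" "c' \<noteq> 0"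
      "\<forall>i\<in>{0..k}. y i = c * x i" "\<forall>i\<in>{0..k}. z i = c' * y i"
      by (auto simp: proj_rel_def)
    then show "(x, z) \<in> proj_rel k"
      by (auto simp: proj_rel_def intro!: exI[of _ "c' * c"])
  qed
qed

text \<open>The rank of the homogenization at \<open>x\<close> only depends on the class of \<open>x\<close>, because all its
  entries are homogeneous of degree \<open>d\<close>; hence any representative may be used.\<close>

definition proj_eigenvalues ::
  "nat \<Rightarrow> nat \<Rightarrow> nat \<Rightarrow> (multi_index \<Rightarrow> complex mat) \<Rightarrow> (nat \<Rightarrow> complex) set set"
  where "proj_eigenvalues n k d A =
    {p \<in> proj_space k. \<exists>x\<in>p. mrank (hom_pencil n k d A x) < n}"

definition finite_eigenvalues ::
  "nat \<Rightarrow> nat \<Rightarrow> nat \<Rightarrow> (multi_index \<Rightarrow> complex mat) \<Rightarrow> (nat \<Rightarrow> complex) set"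
  where "finite_eigenvalues n k d A =
    {x \<in> cspace {1..k}. mrank (pencil n k d A x) < n}"

end

(*  Work over all coefficient families at once.  Let V_m be the vectors of polynomials of degree at most
    m in lambda_1, ..., lambda_k, and W_m the span of the multiples (of degree at most m) of the rows of
    M(lambda).  For a special family, whose rows are products of affine forms times constant vectors, a
    dimension count by induction on the factors gives codim W_m <= N = d^k binom(n+k-1,k) for large m, and
    there are N simple eigenvalues with distinct first coordinates.  Lifting these solutions formally along
    the line to any other family shows that the codimension never drops below N.  Hence, generically, the
    vectors lambda_1^a e_n (a < N) form a basis of V_m modulo W_m, and the eigenvalues correspond to the
    roots of the monic polynomial chi of degree N with chi(lambda_1) e_n in the row module; they are
    distinct as soon as the discriminant of chi is nonzero.  Since this basis lives in degree < m, there is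
    no eigenvalue at infinity.  All conditions are nonvanishing of determinants, hence Zariski open, and
    they hold for the special family. *)

theory Submission
  imports Defs Subresultants.Subresultant_Gcd "HOL-Library.Nat_Bijection"
    "HOL-Computational_Algebra.Field_as_Ring" "HOL-Computational_Algebra.Fundamental_Theorem_Algebra"
begin

text \<open>Codimension at most N amounts to a nonvanishing determinant, an open condition that a
  single family certifies for almost all others. Codimension at least N is a closed condition: W_m
  is spanned by multiples of the rows with many relations among them, and a perturbation could
  destroy these relations. So the lower bound cannot spread from one family by openness. It is
  obtained as an identity over C[t]: along the line from the special family, the Cramer coefficients
  that ought to vanish are divisible by every power of t. Newton lifting to finite order is enough
  for this. The special family makes two things computable: the codimension, since a row that is a
  product can be split factor by factor; and the solutions, since both the affine forms and the
  constant vectors come from Vandermonde nodes. A solution picks k rows in which an affine form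
  vanishes and one of the d forms in each, while the other n - 1 constant rows determine its vector
  up to a factor; this is the origin of N.\<close>

section \<open>Evaluation of formal polynomials\<close>

definition mon_eval :: "('v \<Rightarrow> 'r::comm_ring_1) \<Rightarrow> ('v \<Rightarrow>\<^sub>0 nat) \<Rightarrow> 'r"
  where "mon_eval x m = (\<Prod>v\<in>Poly_Mapping.keys m. x v ^ Poly_Mapping.lookup m v)"

text \<open>Coefficients pass through \<open>h\<close> because the same complex polynomial is
  evaluated at complex points (\<open>h\<close> the identity) and at curves with coordinates in C[t]
  (\<open>h\<close> the embedding of constants).\<close>

definition hom_eval :: "('a \<Rightarrow> 'r) \<Rightarrow> (('v \<Rightarrow>\<^sub>0 nat) \<Rightarrow>\<^sub>0 'a::comm_ring_1) \<Rightarrow> ('v \<Rightarrow> 'r::comm_ring_1) \<Rightarrow> 'r"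
  where "hom_eval h p x = (\<Sum>m\<in>Poly_Mapping.keys p. h (Poly_Mapping.lookup p m) * mon_eval x m)"

lemma mon_eval_superset:
  assumes "finite S" "Poly_Mapping.keys m \<subseteq> S"
  shows "mon_eval x m = (\<Prod>v\<in>S. x v ^ Poly_Mapping.lookup m v)"
  unfolding mon_eval_def by (rule prod.mono_neutral_left) (use assms in \<open>auto simp: in_keys_iff\<close>)

lemma mon_eval_0 [simp]: "mon_eval x 0 = 1"
  by (simp add: mon_eval_def)

lemma mon_eval_add: "mon_eval x (m + m') = mon_eval x m * mon_eval x m'"
proof -
  let ?S = "Poly_Mapping.keys m \<union> Poly_Mapping.keys m'"
  have "mon_eval x (m + m') = (\<Prod>v\<in>?S. x v ^ Poly_Mapping.lookup (m + m') v)"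
    by (rule mon_eval_superset) (simp_all add: keys_add)
  also have "\<dots> = (\<Prod>v\<in>?S. x v ^ Poly_Mapping.lookup m v) * (\<Prod>v\<in>?S. x v ^ Poly_Mapping.lookup m' v)"
    by (simp add: lookup_add power_add prod.distrib)
  finally show ?thesis by (simp add: mon_eval_superset[of ?S])
qed

lemma mon_eval_single: "mon_eval x (Poly_Mapping.single v a) = x v ^ a"
  by (simp add: mon_eval_def)

lemma poly_eval_hom_eval: "poly_eval p x = hom_eval (\<lambda>c. c) p x"
  by (simp add: poly_eval_def hom_eval_def mon_eval_def)

lemma poly_mapping_sum_singles:
  "p = (\<Sum>m\<in>Poly_Mapping.keys p. Poly_Mapping.single m (Poly_Mapping.lookup p m))"
  by (rule poly_mapping_eqI) (auto simp: lookup_sum lookup_single when_def in_keys_iff)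

context comm_ring_hom
begin

lemma hom_eval_superset:
  assumes "finite S" "Poly_Mapping.keys p \<subseteq> S"
  shows "hom_eval hom p x = (\<Sum>m\<in>S. hom (Poly_Mapping.lookup p m) * mon_eval x m)"
  unfolding hom_eval_def by (rule sum.mono_neutral_left) (use assms in \<open>auto simp: in_keys_iff\<close>)

lemma hom_eval_0 [simp]: "hom_eval hom 0 x = 0"
  by (simp add: hom_eval_def)

lemma hom_eval_add: "hom_eval hom (p + q) x = hom_eval hom p x + hom_eval hom q x"
proof -
  let ?S = "Poly_Mapping.keys p \<union> Poly_Mapping.keys q"
  have "hom_eval hom (p + q) x = (\<Sum>m\<in>?S. hom (Poly_Mapping.lookup (p + q) m) * mon_eval x m)"
    by (rule hom_eval_superset) (simp_all add: keys_add)
  also have "\<dots> = (\<Sum>m\<in>?S. hom (Poly_Mapping.lookup p m) * mon_eval x m)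
      + (\<Sum>m\<in>?S. hom (Poly_Mapping.lookup q m) * mon_eval x m)"
    by (simp add: lookup_add hom_add algebra_simps sum.distrib)
  finally show ?thesis by (simp add: hom_eval_superset[of ?S])
qed

lemma hom_eval_sum: "hom_eval hom (\<Sum>i\<in>I. f i) x = (\<Sum>i\<in>I. hom_eval hom (f i) x)"
  by (induction I rule: infinite_finite_induct) (auto simp: hom_eval_add)

lemma hom_eval_single: "hom_eval hom (Poly_Mapping.single m c) x = hom c * mon_eval x m"
  by (simp add: hom_eval_def)

lemma hom_eval_mult: "hom_eval hom (p * q) x = hom_eval hom p x * hom_eval hom q x"
proof -
  let ?s = "\<lambda>p m. Poly_Mapping.single m (Poly_Mapping.lookup p m)"
  have "p * q = (\<Sum>m\<in>Poly_Mapping.keys p. ?s p m) * (\<Sum>m\<in>Poly_Mapping.keys q. ?s q m)"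
    using poly_mapping_sum_singles by metis
  also have "\<dots> = (\<Sum>m\<in>Poly_Mapping.keys p. \<Sum>m'\<in>Poly_Mapping.keys q.
      Poly_Mapping.single (m + m') (Poly_Mapping.lookup p m * Poly_Mapping.lookup q m'))"
    by (simp add: sum_product mult_single)
  finally have "hom_eval hom (p * q) x = (\<Sum>m\<in>Poly_Mapping.keys p. \<Sum>m'\<in>Poly_Mapping.keys q.
      hom (Poly_Mapping.lookup p m) * mon_eval x m * (hom (Poly_Mapping.lookup q m') * mon_eval x m'))"
    by (simp add: hom_eval_sum hom_eval_single mon_eval_add hom_mult mult_ac)
  then show ?thesis by (simp add: hom_eval_def sum_product)
qed

lemma hom_eval_1 [simp]: "hom_eval hom 1 x = 1"
  using hom_eval_single[of 0 1 x] by simp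

lemma hom_eval_prod: "hom_eval hom (\<Prod>i\<in>I. f i) x = (\<Prod>i\<in>I. hom_eval hom (f i) x)"
  by (induction I rule: infinite_finite_induct) (auto simp: hom_eval_mult)

lemma hom_eval_power: "hom_eval hom (p ^ e) x = hom_eval hom p x ^ e"
  by (induction e) (auto simp: hom_eval_mult)

lemma hom_eval_uminus: "hom_eval hom (- p) x = - hom_eval hom p x"
  using hom_eval_add[of p "- p" x] by (simp add: eq_neg_iff_add_eq_0 add.commute)

lemma hom_eval_diff: "hom_eval hom (p - q) x = hom_eval hom p x - hom_eval hom q x"
  using hom_eval_add[of p "- q" x] by (simp add: hom_eval_uminus)

lemmas hom_eval_simps = hom_eval_add hom_eval_mult hom_eval_sum hom_eval_prod hom_eval_power
    hom_eval_uminus hom_eval_diff hom_eval_single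

end

lemma comm_ring_hom_ident: "comm_ring_hom (\<lambda>c :: 'a :: comm_ring_1. c)"
  by unfold_locales auto

lemma comm_ring_hom_pCons: "comm_ring_hom (\<lambda>c :: 'a :: comm_ring_1. [:c:])"
  by unfold_locales auto

lemmas hom_eval_ident = comm_ring_hom.hom_eval_simps[OF comm_ring_hom_ident]
lemmas hom_eval_pCons = comm_ring_hom.hom_eval_simps[OF comm_ring_hom_pCons]

section \<open>Polynomial functions\<close>

text \<open>Being polynomial is asserted of functions, so that determinants and Cramer coefficients
  are certified by closure rules and their polynomials never have to be written down.\<close>

definition polyfun :: "'v set \<Rightarrow> (('v \<Rightarrow> complex) \<Rightarrow> complex) \<Rightarrow> bool"
  where "polyfun I f \<longleftrightarrow> (\<exists>p. poly_vars p \<subseteq> I \<and> (\<forall>x. poly_eval p x = f x))"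

lemma polyfun_const: "polyfun I (\<lambda>_. c)"
  unfolding polyfun_def poly_eval_hom_eval
  by (rule exI[of _ "Poly_Mapping.single 0 c"]) (auto simp: poly_vars_def hom_eval_ident)

lemma polyfun_var: "v \<in> I \<Longrightarrow> polyfun I (\<lambda>x. x v)"
  unfolding polyfun_def poly_eval_hom_eval
  by (rule exI[of _ "Poly_Mapping.single (Poly_Mapping.single v 1) 1"])
    (auto simp: poly_vars_def hom_eval_ident mon_eval_single)

lemma polyfun_add:
  assumes "polyfun I f" "polyfun I g"
  shows "polyfun I (\<lambda>x. f x + g x)"
proof -
  obtain p q where "poly_vars p \<subseteq> I" "poly_vars q \<subseteq> I" "\<And>x. poly_eval p x = f x" "\<And>x. poly_eval q x = g x"
    using assms by (auto simp: polyfun_def)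
  moreover from this have "poly_vars (p + q) \<subseteq> I"
    using keys_add[of p q] unfolding poly_vars_def by blast
  ultimately show ?thesis unfolding polyfun_def
    by (intro exI[of _ "p + q"]) (simp add: poly_eval_hom_eval hom_eval_ident)
qed

lemma polyfun_mult:
  assumes "polyfun I f" "polyfun I g"
  shows "polyfun I (\<lambda>x. f x * g x)"
proof -
  obtain p q where pq: "poly_vars p \<subseteq> I" "poly_vars q \<subseteq> I" "\<And>x. poly_eval p x = f x" "\<And>x. poly_eval q x
      = g x"
    using assms by (auto simp: polyfun_def)
  have "poly_vars (p * q) \<subseteq> I"
  proof
    fix v assume "v \<in> poly_vars (p * q)"
    then obtain a b where "a \<in> Poly_Mapping.keys p" "b \<in> Poly_Mapping.keys q"
        "v \<in> Poly_Mapping.keys (a + b)"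
      using keys_mult[of p q] unfolding poly_vars_def by blast
    then show "v \<in> I" using pq(1,2) keys_add[of a b] unfolding poly_vars_def by blast
  qed
  then show ?thesis unfolding polyfun_def
    using \<open>poly_vars (p * q) \<subseteq> I\<close>
    by (intro exI[of _ "p * q"]) (simp add: poly_eval_hom_eval hom_eval_ident pq(3,4)[unfolded
        poly_eval_hom_eval])
qed

lemma polyfun_sum: "(\<And>i. i \<in> S \<Longrightarrow> polyfun I (f i)) \<Longrightarrow> polyfun I (\<lambda>x. \<Sum>i\<in>S. f i x)"
  by (induction S rule: infinite_finite_induct) (auto intro: polyfun_add polyfun_const)

lemma polyfun_prod: "(\<And>i. i \<in> S \<Longrightarrow> polyfun I (f i)) \<Longrightarrow> polyfun I (\<lambda>x. \<Prod>i\<in>S. f i x)"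
  by (induction S rule: infinite_finite_induct) (auto intro: polyfun_mult polyfun_const)

lemma polyfun_if: "polyfun I f \<Longrightarrow> polyfun I g \<Longrightarrow> polyfun I (\<lambda>x. if c then f x else g x)"
  by (cases c) auto

lemma polyfun_uminus: "polyfun I f \<Longrightarrow> polyfun I (\<lambda>x. - f x)"
  using polyfun_mult[OF polyfun_const[of I "-1"]] by simp

lemma permutes_nat_less: "p permutes {0..<r} \<Longrightarrow> i < r \<Longrightarrow> p i < (r :: nat)"
  using permutes_in_image[of p "{0..<r}" i] by simp

lemma polyfun_det:
  assumes "\<And>i j. i < r \<Longrightarrow> j < r \<Longrightarrow> polyfun I (\<lambda>x. M x i j)"
  shows "polyfun I (\<lambda>x. det (mat r r (\<lambda>(i, j). M x i j)))"
proof -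
  have "det (mat r r (\<lambda>(i, j). M x i j)) =
      (\<Sum>p\<in>{p. p permutes {0..<r}}. signof p * (\<Prod>i=0..<r. M x i (p i)))" for x
    by (subst det_def'[of _ r]) (auto intro!: sum.cong prod.cong simp: permutes_nat_less)
  moreover have "polyfun I (\<lambda>x. \<Sum>p\<in>{p. p permutes {0..<r}}. signof p * (\<Prod>i=0..<r. M x i (p i)))"
    by (intro polyfun_sum polyfun_mult polyfun_const polyfun_prod assms)
      (auto dest: permutes_in_image)
  ultimately show ?thesis by simp
qed

lemma polyfun_adj_mat:
  assumes "\<And>i j. i < r \<Longrightarrow> j < r \<Longrightarrow> polyfun I (\<lambda>x. M x i j)" and "i < r" "j < r"
  shows "polyfun I (\<lambda>x. adj_mat (mat r r (\<lambda>(i, j). M x i j)) $$ (i, j))"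
proof -
  have del: "mat_delete (mat r r (\<lambda>(i, j). M x i j)) j i =
      mat (r - 1) (r - 1) (\<lambda>(a, b). M x (if a < j then a else Suc a) (if b < i then b else Suc b))" for x
    by (rule eq_matI) (auto simp: mat_delete_def)
  have "polyfun I (\<lambda>x. (-1) ^ (j + i) * det (mat (r - 1) (r - 1)
      (\<lambda>(a, b). M x (if a < j then a else Suc a) (if b < i then b else Suc b))))"
    by (intro polyfun_mult polyfun_const polyfun_det assms) (use assms(2,3) in auto)
  then show ?thesis using assms(2,3) by (simp add: adj_mat_def cofactor_def del)
qed

text \<open>One point outside the zero set makes that set a proper variety; this is how a single
  special family yields genericity.\<close>

lemma generic_polyfun:
  assumes f: "polyfun I f" and special_coeffs: "special_coeffs \<in> cspace I" "f special_coeffs \<noteq> 0"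
  shows "generic I {x \<in> cspace I. f x \<noteq> 0}"
proof -
  obtain p where p: "poly_vars p \<subseteq> I" "\<And>x. poly_eval p x = f x"
    using f by (auto simp: polyfun_def)
  have "proper_variety I {x \<in> cspace I. f x = 0}"
    unfolding proper_variety_def algebraic_variety_def
    using p special_coeffs by (auto intro!: exI[of _ "{p}"])
  then show ?thesis unfolding generic_def by blast
qed

section \<open>Filtered submodules\<close>

abbreviation cst :: "'a \<Rightarrow> (nat \<Rightarrow>\<^sub>0 nat) \<Rightarrow>\<^sub>0 'a::zero"
  where "cst \<equiv> Poly_Mapping.single 0"

definition lam :: "nat \<Rightarrow> (nat \<Rightarrow>\<^sub>0 nat) \<Rightarrow>\<^sub>0 'a::zero_neq_one"
  where "lam i = Poly_Mapping.single (Poly_Mapping.single i 1) 1"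

lemma cst_mult: "cst (a * b) = cst a * (cst b :: (nat \<Rightarrow>\<^sub>0 nat) \<Rightarrow>\<^sub>0 'a::comm_ring_1)"
  by (simp add: mult_single)

lemma cst_sum: "cst (\<Sum>i\<in>I. f i) = (\<Sum>i\<in>I. cst (f i :: 'a::comm_ring_1))"
  by (induction I rule: infinite_finite_induct) (auto simp: single_add)

lemma lookup_cst_mult:
  "Poly_Mapping.lookup (cst c * f) m = c * Poly_Mapping.lookup (f :: (nat \<Rightarrow>\<^sub>0 nat) \<Rightarrow>\<^sub>0 'a::comm_ring_1) m"
  by (simp add: map.rep_eq when_def flip: mult_map_scale_conv_mult)

locale rect =
  fixes n k d :: nat
  assumes n: "n \<ge> 1" and k: "k \<ge> 1" and d: "d \<ge> 1"
begin

text \<open>The unknown vector \<open>x \<in> \<complex>\<^sup>n\<close> occupies the variables \<open>k + 1, \<dots>, k + n\<close>.\<close>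

definition xmon :: "nat \<Rightarrow> nat \<Rightarrow>\<^sub>0 nat"
  where "xmon j = Poly_Mapping.single (k + 1 + j) 1"

definition X :: "nat \<Rightarrow> (nat \<Rightarrow>\<^sub>0 nat) \<Rightarrow>\<^sub>0 'a::zero_neq_one"
  where "X j = Poly_Mapping.single (xmon j) 1"

definition mons :: "nat \<Rightarrow> (nat \<Rightarrow>\<^sub>0 nat) set"
  where "mons m = (\<lambda>(\<omega>, j). \<omega> + xmon j) ` (multi_indices k m \<times> {..<n})"

text \<open>For each \<open>m\<close> this is the span of the products of g with monomials
  lambda^beta, where (e, g) is in \<open>G\<close> and e + |beta| is at most \<open>m\<close>. The
  label \<open>e\<close> is carried along and not read off from \<open>g\<close>: the bound concerns
  the degree of a representation, so cancellation of leading terms does not lower it.\<close>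

inductive filt :: "(nat \<times> nat cpoly) set \<Rightarrow> nat \<Rightarrow> nat cpoly \<Rightarrow> bool" for G
  where
    zero: "filt G m 0"
  | gen: "(e, g) \<in> G \<Longrightarrow> filt G e g"
  | add: "filt G m f \<Longrightarrow> filt G m g \<Longrightarrow> filt G m (f + g)"
  | scale: "filt G m f \<Longrightarrow> filt G m (cst c * f)"
  | Suc: "filt G m f \<Longrightarrow> filt G (Suc m) f"
  | var: "filt G m f \<Longrightarrow> i \<in> {1..k} \<Longrightarrow> filt G (Suc m) (lam i * f)"

definition V :: "(nat \<times> nat cpoly) set"
  where "V = (\<lambda>j. (0, X j)) ` {..<n}"

lemma filt_le: "filt G m f \<Longrightarrow> m \<le> m' \<Longrightarrow> filt G m' f"
  by (induction m' arbitrary: m) (auto intro: filt.Suc simp: le_Suc_eq)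

lemma filt_uminus: "filt G m f \<Longrightarrow> filt G m (- f)"
  using filt.scale[of G m f "-1"] by (simp add: single_uminus)

lemma filt_diff: "filt G m f \<Longrightarrow> filt G m g \<Longrightarrow> filt G m (f - g)"
  using filt.add[of G m f "- g"] filt_uminus by simp

lemma filt_sum: "(\<And>i. i \<in> I \<Longrightarrow> filt G m (f i)) \<Longrightarrow> filt G m (\<Sum>i\<in>I. f i)"
  by (induction I rule: infinite_finite_induct) (auto intro: filt.zero filt.add)

lemma filt_genI: "(e, g) \<in> G \<Longrightarrow> e \<le> m \<Longrightarrow> filt G m g"
  using filt_le filt.gen by blast

lemma filt_map:
  assumes "filt G m f" and G: "\<And>a g. (a, g) \<in> G \<Longrightarrow> filt G' (a + e) (h * g)"
  shows "filt G' (m + e) (h * f)"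
  using assms(1)
proof induction
  case (add m f g)
  then show ?case using filt.add[of G' "m + e" "h * f" "h * g"] by (simp add: distrib_left)
next
  case (scale m f c)
  then show ?case using filt.scale[of G' "m + e" "h * f" c] by (simp add: mult_ac)
next
  case (var m f i)
  then show ?case using filt.var[of G' "m + e" "h * f" i] by (simp add: mult_ac)
qed (auto intro: filt.intros G)

lemma filt_subset: "filt G m f \<Longrightarrow> (\<And>a g. (a, g) \<in> G \<Longrightarrow> filt G' a g) \<Longrightarrow> filt G' m f"
  using filt_map[of G m f G' 0 1] by simp

lemma filt_mono: "filt G m f \<Longrightarrow> G \<subseteq> G' \<Longrightarrow> filt G' m f"
  by (rule filt_subset) (auto intro: filt.gen)

text \<open>The clause for \<open>m < e\<close> guards against truncated subtraction: below degree
  \<open>e\<close> no multiple of \<open>h\<close> is available, although \<open>m - e\<close> is 0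
  there. It is what saves the \<open>var\<close> case, where \<open>Suc m - e\<close> need not be
  the successor of \<open>m - e\<close>.\<close>

lemma filt_decomp:
  assumes "filt (B \<union> (\<lambda>j. (e, h * X j)) ` {..<n}) m f"
  shows "\<exists>u g. filt B m u \<and> filt V (m - e) g \<and> f = u + h * g \<and> (m < e \<longrightarrow> g = 0)"
proof -
  have I: "\<exists>u g. filt B m u \<and> filt V (m - e) g \<and> f = u + h * g \<and> (m < e \<longrightarrow> g = 0)"
    if "f = u + h * g" "filt B m u" "filt V (m - e) g" "m < e \<longrightarrow> g = 0" for u g m f
    using that by blast
  from assms show ?thesis
  proof induction
    case (zero m)
    then show ?case by (intro I[of 0 0 0]) (auto intro: filt.zero)
  next
    case (gen a g)
    then show ?case
    proof
      assume "(a, g) \<in> B"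
      then show ?thesis by (intro I[of g g 0]) (auto intro: filt.intros)
    next
      assume "(a, g) \<in> (\<lambda>j. (e, h * X j)) ` {..<n}"
      then obtain j where "j < n" "a = e" "g = h * X j" by auto
      then show ?thesis by (intro I[of _ "0 :: nat cpoly" "X j"]) (auto intro: filt.intros simp: V_def)
    qed
  next
    case (add m f g)
    then obtain u v u' v' where "filt B m u" "filt V (m - e) v" "f = u + h * v" "m < e \<longrightarrow> v = 0"
      "filt B m u'" "filt V (m - e) v'" "g = u' + h * v'" "m < e \<longrightarrow> v' = 0" by auto
    then show ?case by (intro I[of _ "u + u'" "v + v'"]) (auto intro: filt.add simp: algebra_simps)
  next
    case (scale m f c)
    then obtain u v where "filt B m u" "filt V (m - e) v" "f = u + h * v" "m < e \<longrightarrow> v = 0" by auto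
    then show ?case by (intro I[of _ "cst c * u" "cst c * v"])
      (simp_all add: filt.scale distrib_left mult.left_commute)
  next
    case (Suc m f)
    then obtain u v where "filt B m u" "filt V (m - e) v" "f = u + h * v" "m < e \<longrightarrow> v = 0" by auto
    then show ?case by (intro I[of _ u v]) (auto intro: filt.Suc elim: filt_le)
  next
    case (var m f i)
    then obtain u v where "filt B m u" "filt V (m - e) v" "f = u + h * v" "m < e \<longrightarrow> v = 0" by auto
    moreover from this have "filt V (Suc m - e) (lam i * v)"
      using var.hyps by (cases "m < e") (auto intro: filt.zero filt.var simp: Suc_diff_le)
    ultimately show ?case using var.hyps
      by (intro I[of _ "lam i * u" "lam i * v"]) (simp_all add: filt.var distrib_left mult.left_commute)
  qed
qed

text \<open>Bounds the dimension of V_m modulo W_m from above by a spanning list; the list may be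
  dependent, and lower bounds are treated separately.\<close>

definition codim_le :: "(nat \<times> nat cpoly) set \<Rightarrow> nat \<Rightarrow> nat \<Rightarrow> bool"
  where "codim_le G m N \<longleftrightarrow> (\<exists>e. (\<forall>a<N. filt V m (e a)) \<and>
    (\<forall>f. filt V m f \<longrightarrow> (\<exists>c. filt G m (f - (\<Sum>a<N. cst (c a) * e a)))))"

lemma sum_lessThan_add:
  fixes f :: "nat \<Rightarrow> 'a::comm_monoid_add"
  shows "(\<Sum>a<p + q. f a) = (\<Sum>a<p. f a) + (\<Sum>a<q. f (p + a))"
  by (induction q) (auto simp: add.assoc)

text \<open>Multiplication by \<open>h\<close> maps the quotient by \<open>G''\<close> onto the kernel of the projection to the
  quotient by \<open>h V\<close>.\<close>

lemma codim_le_add: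
  assumes 1: "codim_le (B \<union> (\<lambda>j. (e, h * X j)) ` {..<n}) m N1" and 2: "codim_le G'' (m - e) N2"
    and e: "e \<le> m" and V: "\<And>j. j < n \<Longrightarrow> filt V e (h * X j)"
    and G'': "\<And>a g. (a, g) \<in> G'' \<Longrightarrow> filt G (a + e) (h * g)" and B: "B \<subseteq> G"
  shows "codim_le G m (N1 + N2)"
proof -
  obtain e1 where e1: "\<And>a. a < N1 \<Longrightarrow> filt V m (e1 a)"
    "\<And>f. filt V m f \<Longrightarrow> \<exists>c. filt (B \<union> (\<lambda>j. (e, h * X j)) ` {..<n}) m (f - (\<Sum>a<N1. cst (c a) * e1 a))"
    using 1 by (auto simp: codim_le_def)
  obtain e2 where e2: "\<And>a. a < N2 \<Longrightarrow> filt V (m - e) (e2 a)"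
    "\<And>f. filt V (m - e) f \<Longrightarrow> \<exists>c. filt G'' (m - e) (f - (\<Sum>a<N2. cst (c a) * e2 a))"
    using 2 by (auto simp: codim_le_def)
  define E where "E = (\<lambda>a. if a < N1 then e1 a else h * e2 (a - N1))"
  have Vh: "filt V m (h * f)" if "filt V (m - e) f" for f
    using filt_map[OF that, of V e h] V e by (fastforce simp: V_def)
  have "filt V m (E a)" if "a < N1 + N2" for a
    using that e1(1)[of a] Vh[OF e2(1)[of "a - N1"]] by (auto simp: E_def)
  moreover have "\<exists>c. filt G m (f - (\<Sum>a<N1 + N2. cst (c a) * E a))" if f: "filt V m f" for f
  proof -
    obtain c1 where "filt (B \<union> (\<lambda>j. (e, h * X j)) ` {..<n}) m (f - (\<Sum>a<N1. cst (c1 a) * e1 a))"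
      using e1(2)[OF f] by blast
    then obtain u g where u: "filt B m u" "filt V (m - e) g" "f - (\<Sum>a<N1. cst (c1 a) * e1 a) = u + h * g"
      using filt_decomp by blast
    obtain c2 where "filt G'' (m - e) (g - (\<Sum>a<N2. cst (c2 a) * e2 a))"
      using e2(2)[OF u(2)] by blast
    then have "filt G m (h * (g - (\<Sum>a<N2. cst (c2 a) * e2 a)))"
      using filt_map[of G'' "m - e" _ G e h] G'' e by auto
    with u(1) B have "filt G m (u + h * (g - (\<Sum>a<N2. cst (c2 a) * e2 a)))"
      by (intro filt.add) (auto intro: filt_mono)
    also have "u + h * (g - (\<Sum>a<N2. cst (c2 a) * e2 a)) =
        f - (\<Sum>a<N1 + N2. cst (if a < N1 then c1 a else c2 (a - N1)) * E a)"
      using u(3) by (simp add: sum_lessThan_add E_def sum_distrib_left algebra_simps)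
    finally show ?thesis by (intro exI[of _ "\<lambda>a. if a < N1 then c1 a else c2 (a - N1)"])
  qed
  ultimately show ?thesis unfolding codim_le_def by (intro exI[of _ E]) auto
qed

lemma multi_indices_single: "i \<in> {1..k} \<Longrightarrow> \<omega> \<in> multi_indices k m \<Longrightarrow>
    Poly_Mapping.single i 1 + \<omega> \<in> multi_indices k (Suc m)"
  using keys_add[of "Poly_Mapping.single i (1::nat)" \<omega>]
  by (auto simp: multi_indices_def mi_size_def lookup_add sum.distrib lookup_single when_def split:
      if_splits)

lemma mi_size_add: "mi_size k (a + b) = mi_size k a + mi_size k b"
  by (simp add: mi_size_def lookup_add sum.distrib)

lemma multi_indices_mono: "m \<le> m' \<Longrightarrow> multi_indices k m \<subseteq> multi_indices k m'"
  by (auto simp: multi_indices_def)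

lemma finite_multi_indices: "finite (multi_indices k m)"
  using card_multi_indices[of k m] by (intro card_ge_0_finite) (simp add: zero_less_binomial)

lemma finite_mons: "finite (mons m)"
  by (simp add: mons_def finite_multi_indices)

lemma filt_mult_mono:
  assumes "filt G m g" and "Poly_Mapping.keys \<omega> \<subseteq> {1..k}"
  shows "filt G (m + mi_size k \<omega>) (Poly_Mapping.single \<omega> 1 * g)"
  using assms(2)
proof (induction "mi_size k \<omega>" arbitrary: \<omega>)
  case 0
  have "\<forall>i\<in>{1..k}. Poly_Mapping.lookup \<omega> i = 0"
    using 0(1)[symmetric] unfolding mi_size_def by (subst (asm) sum_eq_0_iff) simp_all
  then have "Poly_Mapping.lookup \<omega> i = 0" for i
    using 0(2) by (meson in_keys_iff subsetD)
  then have "\<omega> = 0" by (intro poly_mapping_eqI) simp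
  then show ?case using assms(1) by (simp add: mi_size_def)
next
  case (Suc s)
  then have "mi_size k \<omega> \<noteq> 0" by simp
  then obtain i where i: "i \<in> {1..k}" "Poly_Mapping.lookup \<omega> i > 0"
    unfolding mi_size_def by (metis gr0I sum.neutral)
  define \<omega>' where "\<omega>' = \<omega> - Poly_Mapping.single i 1"
  have \<omega>: "\<omega> = Poly_Mapping.single i 1 + \<omega>'"
    using i by (intro poly_mapping_eqI) (auto simp: \<omega>'_def lookup_add lookup_minus lookup_single when_def)
  have "mi_size k (Poly_Mapping.single i 1) = 1"
    using i by (simp add: mi_size_def lookup_single when_def)
  then have s: "mi_size k \<omega>' = s" "mi_size k \<omega> = Suc s"
    using Suc(2) mi_size_add[of "Poly_Mapping.single i 1" \<omega>'] unfolding \<omega>[symmetric] by simp_all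
  have "Poly_Mapping.keys \<omega>' \<subseteq> {1..k}"
    using Suc(3) by (auto simp: \<omega>'_def lookup_minus in_keys_iff dest!: subsetD)
  then have "filt G (m + s) (Poly_Mapping.single \<omega>' 1 * g)" using Suc(1)[of \<omega>'] s by simp
  then have "filt G (Suc (m + s)) (lam i * (Poly_Mapping.single \<omega>' 1 * g))" using i by (intro filt.var)
  also have "lam i * (Poly_Mapping.single \<omega>' 1 * g) = Poly_Mapping.single \<omega> 1 * g"
    unfolding mult.assoc[symmetric] lam_def mult_single \<omega>[symmetric] by simp
  finally show ?case using s by simp
qed

text \<open>Connects the inductive description, suited to inductions over multiplications, with the
  coordinates in which matrices are formed.\<close>

lemma filt_V_iff: "filt V m f \<longleftrightarrow> Poly_Mapping.keys f \<subseteq> mons m"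
proof
  assume "filt V m f"
  then show "Poly_Mapping.keys f \<subseteq> mons m"
  proof induction
    case (gen e g)
    then show ?case
      by (auto simp: V_def X_def mons_def multi_indices_def mi_size_def intro!: rev_image_eqI[of "(0, _)"])
  next
    case (add m f g)
    then show ?case using keys_add[of f g] by blast
  next
    case (scale m f c)
    then show ?case by (auto simp: in_keys_iff lookup_cst_mult subset_iff)
  next
    case (Suc m f)
    then show ?case using multi_indices_mono[of m "Suc m"] by (fastforce simp: mons_def)
  next
    case (var m f i)
    show ?case
    proof
      fix x assume "x \<in> Poly_Mapping.keys (lam i * f)"
      then obtain b where b: "b \<in> Poly_Mapping.keys f" "x = Poly_Mapping.single i 1 + b"
        using keys_mult[of "lam i" f] by (auto simp: lam_def)
      then obtain \<omega> j where \<omega>: "\<omega> \<in> multi_indices k m" "j < n" "b = \<omega> + xmon j"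
        using var.IH by (auto simp: mons_def)
      have "x = (Poly_Mapping.single i 1 + \<omega>) + xmon j" by (simp add: b \<omega> add.assoc)
      then show "x \<in> mons (Suc m)" using multi_indices_single[OF var.hyps(2) \<omega>(1)] \<omega>(2)
        unfolding mons_def by (intro image_eqI[of _ _ "(Poly_Mapping.single i 1 + \<omega>, j)"]) auto
    qed
  qed simp
next
  assume f: "Poly_Mapping.keys f \<subseteq> mons m"
  have single: "filt V m (Poly_Mapping.single x c)" if xm: "x \<in> mons m" for x c
  proof -
    obtain \<omega> j where x: "\<omega> \<in> multi_indices k m" "j < n" "x = \<omega> + xmon j" using xm by (auto simp: mons_def)
    have "filt V (0 + mi_size k \<omega>) (Poly_Mapping.single \<omega> 1 * X j)"
      using x by (intro filt_mult_mono filt.gen) (auto simp: V_def multi_indices_def)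
    then have "filt V m (Poly_Mapping.single \<omega> 1 * X j)"
      using x by (elim filt_le) (auto simp: multi_indices_def)
    from filt.scale[OF this, of c] show ?thesis by (simp add: X_def mult_single x)
  qed
  have "filt V m (\<Sum>x\<in>Poly_Mapping.keys f. Poly_Mapping.single x (Poly_Mapping.lookup f x))"
    using f by (intro filt_sum single) auto
  then show "filt V m f" by (metis poly_mapping_sum_singles)
qed

end

section \<open>Lagrange interpolation\<close>

definition lagrange_basis :: "('c \<Rightarrow> complex) \<Rightarrow> 'c set \<Rightarrow> 'c \<Rightarrow> complex poly"
  where "lagrange_basis \<tau> P c = (\<Prod>b\<in>P - {c}. smult (inverse (\<tau> c - \<tau> b)) [:- \<tau> b, 1:])"

lemma poly_lagrange_basis:
  assumes "finite P" "inj_on \<tau> P" "c \<in> P" "b \<in> P"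
  shows "poly (lagrange_basis \<tau> P c) (\<tau> b) = (if b = c then 1 else 0)"
proof (cases "b = c")
  case True
  have "poly (smult (inverse (\<tau> c - \<tau> x)) [:- \<tau> x, 1:]) (\<tau> c) = 1" if "x \<in> P - {c}" for x
  proof -
    have "\<tau> c \<noteq> \<tau> x" using that assms by (auto simp: inj_on_eq_iff)
    moreover have "poly (smult (inverse (\<tau> c - \<tau> x)) [:- \<tau> x, 1:]) (\<tau> c)
        = inverse (\<tau> c - \<tau> x) * (\<tau> c - \<tau> x)"
      by (simp add: algebra_simps)
    ultimately show ?thesis by (simp only: left_inverse right_minus_eq not_False_eq_True)
  qed
  then show ?thesis using True by (simp add: lagrange_basis_def poly_prod del: poly_smult poly_pCons)
next
  case False
  then show ?thesis using assms by (auto simp: lagrange_basis_def poly_prod intro!: prod_zero)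
qed

lemma degree_lagrange_basis:
  assumes "finite P" "c \<in> P"
  shows "degree (lagrange_basis \<tau> P c) < card P"
proof -
  have "degree (lagrange_basis \<tau> P c) \<le> (\<Sum>b\<in>P - {c}. degree (smult (inverse (\<tau> c - \<tau> b)) [:- \<tau> b, 1:]))"
    unfolding lagrange_basis_def using assms
        by (intro order_trans[OF degree_prod_sum_le]) (simp_all add: o_def)
  also have "\<dots> \<le> (\<Sum>b\<in>P - {c}. 1)" by (rule sum_mono) (auto intro: degree_smult_le[THEN order_trans])
  also have "\<dots> < card P"
    using assms card_gt_0_iff[of P] by (auto simp: card_Diff_singleton)
  finally show ?thesis .
qed

text \<open>The degree bound is put on the coefficients so that an empty \<open>P\<close> forces the
  zero polynomial; this case arises for n = 1.\<close>

lemma interpolation_ex: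
  fixes \<tau> :: "'c \<Rightarrow> complex"
  assumes "finite P" "inj_on \<tau> P"
  shows "\<exists>q. (\<forall>i\<ge>card P. coeff q i = 0) \<and> (\<forall>c\<in>P. poly q (\<tau> c) = b c)"
proof (intro exI conjI allI impI ballI)
  let ?q = "\<Sum>c\<in>P. smult (b c) (lagrange_basis \<tau> P c)"
  show "coeff ?q i = 0" if "i \<ge> card P" for i
  proof -
    have "coeff (lagrange_basis \<tau> P c) i = 0" if c: "c \<in> P" for c
      using degree_lagrange_basis[OF assms(1) c, of \<tau>] \<open>i \<ge> card P\<close> by (intro coeff_eq_0) simp
    then show ?thesis by (simp add: coeff_sum)
  qed
  show "poly ?q (\<tau> c) = b c" if "c \<in> P" for c
  proof -
    have "(\<Sum>x\<in>P. poly (smult (b x) (lagrange_basis \<tau> P x)) (\<tau> c)) = (\<Sum>x\<in>P. if c = x then b x else 0)"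
      using assms that by (intro sum.cong) (auto simp: poly_lagrange_basis)
    then show ?thesis using that assms by (simp add: poly_sum)
  qed
qed

text \<open>The coefficients of the Lagrange basis form the inverse Vandermonde matrix: the power
  with exponent \<open>u < card P\<close> is its own interpolant, and comparing coefficients at
  \<open>j\<close> gives the claim.\<close>

lemma dual_vandermonde:
  fixes \<tau> :: "'c \<Rightarrow> complex"
  assumes "finite P" "inj_on \<tau> P"
  shows "\<exists>a. \<forall>j<card P. \<forall>u<card P. (\<Sum>c\<in>P. a j c * \<tau> c ^ u) = (if u = j then 1 else (0::complex))"
proof (intro exI allI impI)
  fix j u assume ju: "j < card P" "u < card P"
  let ?q = "monom 1 u - (\<Sum>c\<in>P. smult (\<tau> c ^ u) (lagrange_basis \<tau> P c))"
  have "degree (\<Sum>c\<in>P. smult (\<tau> c ^ u) (lagrange_basis \<tau> P c)) < card P"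
    using ju by (intro degree_sum_less) (auto intro: degree_lagrange_basis[OF assms(1)] le_less_trans[OF
        degree_smult_le])
  then have deg: "degree ?q < card P" using ju by (intro degree_diff_less) (auto simp: degree_monom_eq)
  have "poly ?q x = 0" if x: "x \<in> \<tau> ` P" for x
  proof -
    obtain b where b: "b \<in> P" "x = \<tau> b" using x by blast
    then have "(\<Sum>c\<in>P. poly (smult (\<tau> c ^ u) (lagrange_basis \<tau> P c)) x) = (\<Sum>c\<in>P. if b
        = c then \<tau> c ^ u else 0)"
      using assms by (intro sum.cong) (auto simp: poly_lagrange_basis)
    then show ?thesis using b assms by (simp add: poly_monom poly_sum)
  qed
  then have sub: "\<tau> ` P \<subseteq> {x. poly ?q x = 0}" by blast
  have "?q = 0"
  proof (rule ccontr)
    assume "?q \<noteq> 0"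
    then have "card (\<tau> ` P) \<le> degree ?q"
      using sub by (intro order_trans[OF card_mono card_poly_roots_bound] poly_roots_finite)
    then show False using deg assms by (simp add: card_image)
  qed
  then have "coeff (monom 1 u) j = coeff (\<Sum>c\<in>P. smult (\<tau> c ^ u) (lagrange_basis \<tau> P c)) j" by simp
  then show "(\<Sum>c\<in>P. coeff (lagrange_basis \<tau> P c) j * \<tau> c ^ u) = (if u = j then 1 else 0)"
    by (simp add: coeff_sum mult.commute)
qed

lemma inj_power2_complex: "inj_on (\<lambda>c. 2 ^ c :: complex) S"
proof (rule inj_onI)
  fix a b :: nat assume "(2::complex) ^ a = 2 ^ b"
  then have "norm ((2::complex) ^ a) = norm ((2::complex) ^ b)" by simp
  then show "a = b" by (simp add: norm_power)
qed

context rect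
begin

section \<open>A system of products of affine forms\<close>

definition aform :: "nat \<Rightarrow> nat cpoly"
  where "aform c = cst (2 ^ (c * k)) + (\<Sum>s=1..k. cst (2 ^ (c * (k - s))) * lam s)"

text \<open>Vandermonde rows with nodes 0, 1, 2, and so on: any n of them are independent, so no
  choice of rows is exceptional.\<close>

definition vrow :: "nat \<Rightarrow> nat cpoly"
  where "vrow i = (\<Sum>j<n. cst (of_nat i ^ j) * X j)"

text \<open>The factor \<open>aform c\<close> belongs to row \<open>c div d\<close>. With the nodes \<open>2 ^ c\<close>, the first coordinate of a solution
  is minus a sum of distinct powers of two, so different solutions have different first coordinates.\<close>

definition codes :: "nat \<Rightarrow> nat set"
  where "codes i = {i * d..<i * d + d}"

definition aprod :: "nat \<Rightarrow> nat cpoly"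
  where "aprod i = (\<Prod>c\<in>codes i. aform c)"

definition mul_gens :: "nat \<Rightarrow> nat cpoly \<Rightarrow> (nat \<times> nat cpoly) set"
  where "mul_gens e h = (\<lambda>j. (e, h * X j)) ` {..<n}"

text \<open>The intermediate systems of the codimension count: forms with codes in \<open>P\<close>
  are set to zero, rows in \<open>Y\<close> have shed their affine factors, and rows in
  \<open>Z\<close> are still whole products.\<close>

definition special_gens :: "nat set \<Rightarrow> nat set \<Rightarrow> nat set \<Rightarrow> (nat \<times> nat cpoly) set"
  where "special_gens P Y Z = (\<Union>c\<in>P. mul_gens 1 (aform c)) \<union> (\<lambda>i. (0, vrow i)) ` Y \<union> (\<lambda>i. (d, aprod i
      * vrow i)) ` Z"

lemma card_codes: "card (codes i) = d"
  by (simp add: codes_def)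

lemma finite_codes: "finite (codes i)"
  by (simp add: codes_def)

lemma codes_iff: "c \<in> codes i \<longleftrightarrow> c div d = i"
proof
  assume "c \<in> codes i"
  then show "c div d = i" by (intro div_nat_eqI) (auto simp: codes_def mult.commute)
next
  assume "c div d = i"
  moreover have "c mod d < d" using d by simp
  ultimately show "c \<in> codes i" using div_mult_mod_eq[of c d]
    unfolding codes_def by (simp only: atLeastLessThan_iff) linarith
qed

lemma filt_aform: "filt G m f \<Longrightarrow> filt G (Suc m) (aform c * f)"
  unfolding aform_def distrib_right sum_distrib_right mult.assoc
  by (intro filt.add filt_sum filt.scale filt.var filt.Suc[OF filt.scale]) auto

lemma filt_aform_prod: "finite C \<Longrightarrow> filt G m f \<Longrightarrow> filt G (m + card C) ((\<Prod>c\<in>C. aform c) * f)"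
  by (induction C rule: finite_induct) (auto simp: mult.assoc intro: filt_aform)

lemma filt_VX: "j < n \<Longrightarrow> filt V 0 (X j)"
  by (rule filt.gen) (auto simp: V_def)

lemma filt_Vvrow: "filt V 0 (vrow i)"
  unfolding vrow_def by (intro filt_sum filt.scale filt_VX) auto

lemma codim_le_0:
  assumes "\<And>j. j < n \<Longrightarrow> filt G 0 (X j)"
  shows "codim_le G m 0"
proof -
  have "filt G m f" if "filt V m f" for f
    using that by (rule filt_subset) (auto simp: V_def assms)
  then show ?thesis by (simp add: codim_le_def)
qed

text \<open>\<open>pt P\<close> is the common zero of the affine forms with codes in \<open>P\<close>: evaluating \<open>aform c\<close> amounts
  to evaluating the polynomial with coefficients \<open>1, \<lambda>\<^sub>1, \<dots>, \<lambda>\<^sub>k\<close> at \<open>2 ^ c\<close>.\<close>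

definition pt :: "nat set \<Rightarrow> nat \<Rightarrow> complex"
  where "pt P s = coeff (\<Prod>c\<in>P. [:- (2 ^ c), 1:]) (k - s)"

definition aform_val :: "nat \<Rightarrow> (nat \<Rightarrow> complex) \<Rightarrow> complex"
  where "aform_val c p = 2 ^ (c * k) + (\<Sum>s=1..k. 2 ^ (c * (k - s)) * p s)"

lemma aform_val_pt:
  assumes "finite P" "card P = k"
  shows "aform_val c (pt P) = (\<Prod>b\<in>P. 2 ^ c - 2 ^ b)"
proof -
  define q :: "complex poly" where "q = (\<Prod>b\<in>P. [:- (2 ^ b), 1:])"
  have deg: "degree q = k"
    unfolding q_def using assms by (subst degree_prod_eq_sum_degree) auto
  have lead: "coeff q k = 1"
  proof -
    have "coeff q (degree q) = 1" unfolding q_def by (rule monic_prod) auto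
    then show ?thesis by (simp only: deg)
  qed
  have "poly q (2 ^ c) = (\<Sum>i\<le>k. coeff q i * (2 ^ c) ^ i)" unfolding poly_altdef deg ..
  also have "{..k} = insert k {0..<k}" by auto
  also have "(\<Sum>i\<in>insert k {0..<k}. coeff q i * (2 ^ c) ^ i)
      = 2 ^ (c * k) + (\<Sum>i\<in>{0..<k}. coeff q i * (2 ^ c) ^ i)"
    by (simp add: lead power_mult)
  also have "(\<Sum>i\<in>{0..<k}. coeff q i * (2 ^ c) ^ i) = (\<Sum>s=1..k. 2 ^ (c * (k - s)) * pt P s)"
    by (rule sum.reindex_bij_witness[of _ "\<lambda>s. k - s" "\<lambda>i. k - i"]) (auto simp: pt_def q_def power_mult)
  finally show ?thesis by (simp add: aform_val_def q_def poly_prod)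
qed

lemma aform_val_pt_eq_0:
  assumes "finite P" "card P = k"
  shows "aform_val c (pt P) = 0 \<longleftrightarrow> c \<in> P"
  using assms inj_power2_complex[of UNIV] by (auto simp: aform_val_pt inj_on_eq_iff)

text \<open>The forms with codes in \<open>P\<close> vanish at \<open>pt P\<close>, so they are
  linear in the differences from that point, with a Vandermonde matrix that
  \<open>dual_vandermonde\<close> inverts. The coefficient of \<open>lam s\<close> is the power k -
  s of the node, hence the index \<open>k - i\<close>.\<close>

lemma lam_diff_pt:
  assumes "finite P" "card P = k" "i \<in> {1..k}"
  shows "\<exists>a. lam i - cst (pt P i) = (\<Sum>c\<in>P. cst (a c) * aform c)"
proof -
  obtain a where a: "\<forall>j<k. \<forall>u<k. (\<Sum>c\<in>P. a j c * (2 ^ c) ^ u) = (if u = j then 1 else (0::complex))"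
    using dual_vandermonde[OF assms(1) inj_power2_complex] assms(2) by metis
  have aform: "aform c = (\<Sum>s=1..k. cst (2 ^ (c * (k - s))) * (lam s - cst (pt P s)))" if "c \<in> P" for c
  proof -
    have "aform c - cst (aform_val c (pt P)) = (\<Sum>s=1..k. cst (2 ^ (c * (k - s))) * (lam s - cst (pt P s)))"
      by (simp add: aform_def aform_val_def single_add cst_sum right_diff_distrib sum_subtractf flip:
          cst_mult)
    moreover have "aform_val c (pt P) = 0" using that assms by (simp add: aform_val_pt_eq_0)
    ultimately show ?thesis by simp
  qed
  have "(\<Sum>c\<in>P. cst (a (k - i) c) * aform c)
      = (\<Sum>c\<in>P. \<Sum>s=1..k. cst (a (k - i) c * 2 ^ (c * (k - s))) * (lam s - cst (pt P s)))"
    by (auto simp: aform sum_distrib_left cst_mult mult.assoc intro!: sum.cong)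
  also have "\<dots> = (\<Sum>s=1..k. cst (\<Sum>c\<in>P. a (k - i) c * (2 ^ c) ^ (k - s)) * (lam s - cst (pt P s)))"
    by (subst sum.swap) (simp add: cst_sum sum_distrib_right power_mult)
  also have "\<dots> = (\<Sum>s=1..k. if s = i then lam s - cst (pt P s) else 0)"
    using assms(3) a by (intro sum.cong) auto
  also have "\<dots> = lam i - cst (pt P i)" using assms(3) by simp
  finally show ?thesis by (intro exI[of _ "\<lambda>c. a (k - i) c"]) (rule sym)
qed

context
  fixes P G
  assumes P: "finite P" "card P = k" and G: "\<And>c. c \<in> P \<Longrightarrow> mul_gens 1 (aform c) \<subseteq> G"
begin

lemma filt_aform_zero: "filt V m f \<Longrightarrow> c \<in> P \<Longrightarrow> filt G (Suc m) (aform c * f)"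
  using filt_map[of V m f G 1 "aform c"] G[of c] by (auto simp: V_def mul_gens_def intro: filt.gen)

text \<open>Modulo \<open>G\<close> each variable acts as the number \<open>pt P i\<close>, at the
  cost of one degree; forms and products of forms then act by their values at the point.\<close>

lemma filt_lam_pt: "filt V m f \<Longrightarrow> i \<in> {1..k} \<Longrightarrow> filt G (Suc m) ((lam i - cst (pt P i)) * f)"
proof -
  assume "filt V m f" "i \<in> {1..k}"
  moreover obtain a where "lam i - cst (pt P i) = (\<Sum>c\<in>P. cst (a c) * aform c)"
    using lam_diff_pt P calculation(2) by blast
  ultimately show ?thesis
    by (auto simp: sum_distrib_right mult.assoc intro!: filt_sum filt.scale filt_aform_zero)
qed

lemma filt_aform_pt: "filt V m f \<Longrightarrow> filt G (Suc m) (aform c * f - cst (aform_val c (pt P)) * f)"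
proof -
  assume f: "filt V m f"
  have "aform c * f - cst (aform_val c (pt P)) * f
      = (\<Sum>s=1..k. cst (2 ^ (c * (k - s))) * ((lam s - cst (pt P s)) * f))"
    by (simp add: aform_def aform_val_def single_add cst_sum right_diff_distrib left_diff_distrib
        sum_subtractf
        cst_mult distrib_right sum_distrib_right mult.assoc)
  then show ?thesis using f by (auto intro!: filt_sum filt.scale filt_lam_pt)
qed

lemma filt_aform_prod_pt:
  assumes "finite C" "filt V m f"
  shows "filt G (m + card C) ((\<Prod>c\<in>C. aform c) * f - cst (\<Prod>c\<in>C. aform_val c (pt P)) * f)"
  using assms(1)
proof (induction C rule: finite_induct)
  case (insert c C)
  have "filt G (Suc (m + card C)) (aform c * ((\<Prod>c\<in>C. aform c) * f)
      - cst (aform_val c (pt P)) * ((\<Prod>c\<in>C. aform c) * f))"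
    by (rule filt_aform_pt) (use insert assms filt_aform_prod in auto)
  moreover have "filt G (Suc (m + card C)) (cst (aform_val c (pt P)) *
      ((\<Prod>c\<in>C. aform c) * f - cst (\<Prod>c\<in>C. aform_val c (pt P)) * f))"
    using insert.IH by (intro filt.scale filt.Suc)
  ultimately have "filt G (Suc (m + card C)) (aform c * ((\<Prod>c\<in>C. aform c) * f)
      - cst (aform_val c (pt P)) * ((\<Prod>c\<in>C. aform c) * f)
      + cst (aform_val c (pt P)) * ((\<Prod>c\<in>C. aform c) * f - cst (\<Prod>c\<in>C. aform_val c (pt P)) * f))"
    by (rule filt.add)
  then show ?case using insert by (simp add: algebra_simps cst_mult)
qed (simp add: filt.zero)

text \<open>Substituting the point for lambda turns any vector of polynomials into a constant
  vector, and the error stays within the same degree \<open>m\<close>.\<close>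

lemma filt_V_const:
  assumes "filt V m f"
  shows "\<exists>b. filt G m (f - (\<Sum>j<n. cst (b j) * X j))"
  using assms
proof induction
  case (zero m)
  show ?case by (rule exI[of _ "\<lambda>_. 0"]) (simp add: filt.zero)
next
  case (gen e g)
  then obtain j where "j < n" "g = X j" by (auto simp: V_def)
  then have "(\<Sum>i<n. cst (if i = j then 1 else 0) * X i) = g"
    by (simp add: if_distrib[of cst] if_distrib[of "\<lambda>x. x * _"] cong: if_cong)
  then show ?case by (intro exI[of _ "\<lambda>i. if i = j then 1 else 0"]) (simp add: filt.zero)
next
  case (add m f g)
  then obtain b b' where "filt G m (f - (\<Sum>j<n. cst (b j) * X j))" "filt G m (g - (\<Sum>j<n. cst (b' j) * X j))"
    by auto
  from filt.add[OF this] show ?case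
    by (intro exI[of _ "\<lambda>j. b j + b' j"]) (simp add: single_add distrib_right sum.distrib algebra_simps)
next
  case (scale m f c)
  then obtain b where "filt G m (f - (\<Sum>j<n. cst (b j) * X j))" by auto
  from filt.scale[OF this, of c] show ?case
    by (intro exI[of _ "\<lambda>j. c * b j"]) (simp add: right_diff_distrib sum_distrib_left cst_mult mult.assoc)
next
  case (Suc m f)
  then show ?case by (auto intro: filt.Suc)
next
  case (var m f i)
  then obtain b where "filt G m (f - (\<Sum>j<n. cst (b j) * X j))" by auto
  from filt.add[OF filt_lam_pt[OF var.hyps] filt.Suc[OF filt.scale[OF this, of "pt P i"]]]
  show ?case
    by (intro exI[of _ "\<lambda>j. pt P i * b j"])
      (simp add: right_diff_distrib left_diff_distrib sum_distrib_left cst_mult mult.assoc)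
qed

end

section \<open>Codimension count for the special system\<close>

lemma vrow_combination:
  assumes "finite Y" "card Y = r" "r \<le> n"
  shows "\<exists>a b. \<forall>j<r. (\<Sum>i\<in>Y. cst (a j i) * vrow i) = X j + (\<Sum>u=r..<n. cst (b j u) * X u)"
proof -
  \<comment> \<open>Inverting the Vandermonde block of the first \<open>r\<close> columns brings the
    rows to reduced echelon form.\<close>
  obtain a where a: "\<forall>j<r. \<forall>u<r. (\<Sum>i\<in>Y. a j i * of_nat i ^ u) = (if u = j then 1 else (0::complex))"
    using dual_vandermonde[OF assms(1), of of_nat] assms(2) by (auto simp: inj_on_def)
  have *: "(\<Sum>i\<in>Y. cst (a j i) * vrow i) = X j + (\<Sum>u=r..<n. cst (\<Sum>i\<in>Y. a j i * of_nat i ^ u) * X u)"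
    if "j < r" for j
  proof -
    have "(\<Sum>i\<in>Y. cst (a j i) * vrow i) = (\<Sum>u<n. cst (\<Sum>i\<in>Y. a j i * of_nat i ^ u) * X u)"
      unfolding vrow_def sum_distrib_left
          by (subst sum.swap) (simp add: cst_sum cst_mult sum_distrib_right mult.assoc)
    also have "{..<n} = {..<r} \<union> {r..<n}" using assms by auto
    also have "(\<Sum>u\<in>{..<r} \<union> {r..<n}. cst (\<Sum>i\<in>Y. a j i * of_nat i ^ u) * X u)
        = (\<Sum>u<r. cst (\<Sum>i\<in>Y. a j i * of_nat i ^ u) * X u)
            + (\<Sum>u=r..<n. cst (\<Sum>i\<in>Y. a j i * of_nat i ^ u) * X u)"
      by (rule sum.union_disjoint) auto
    also have "(\<Sum>u<r. cst (\<Sum>i\<in>Y. a j i * of_nat i ^ u) * X u) = (\<Sum>u<r. if u = j then X u else 0)"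
      using a that by (intro sum.cong) auto
    finally show ?thesis using that by simp
  qed
  show ?thesis
    by (rule exI[of _ a], rule exI[of _ "\<lambda>j u. \<Sum>i\<in>Y. a j i * of_nat i ^ u"]) (use * in blast)
qed

text \<open>With lambda pinned to \<open>pt P\<close>, every row in \<open>Z\<close> reduces to a
  nonzero multiple of its constant vector, because none of its forms has its code in
  \<open>P\<close>. The n - 1 independent constant vectors leave one dimension, represented by the
  last unit vector.\<close>

lemma codim_special_point:
  assumes fin: "finite P" "finite Y" "finite Z" and "Y \<inter> Z = {}" and PZ: "\<And>c. c \<in> P \<Longrightarrow> c div d \<notin> Z"
    and P: "card P = k" and YZ: "card Y + card Z = n - 1" and m: "d * card Z \<le> m"
  shows "codim_le (special_gens P Y Z) m 1"
proof -
  let ?G = "special_gens P Y Z"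
  have G: "mul_gens 1 (aform c) \<subseteq> ?G" if "c \<in> P" for c using that by (auto simp: special_gens_def)
  have row: "filt ?G m (vrow i)" if "i \<in> Y \<union> Z" for i
  proof (cases "i \<in> Y")
    case True
    then show ?thesis by (intro filt_genI[of 0]) (auto simp: special_gens_def)
  next
    case False
    then have i: "i \<in> Z" using that by blast
    \<comment> \<open>Since a row in \<open>Z\<close> is present, the bound on \<open>m\<close>
      leaves room for the degree \<open>d\<close> of that row.\<close>
    then have "card Z \<ge> 1" using fin by (metis card_0_eq empty_iff less_one not_le)
    then have dm: "d \<le> m" using m by (metis le_trans mult.right_neutral mult_le_mono2)
    let ?l = "\<Prod>c\<in>codes i. aform_val c (pt P)"
    have "?l \<noteq> 0" using i PZ P fin by (auto simp: aform_val_pt_eq_0 finite_codes codes_iff)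
    have 1: "filt ?G d (aprod i * vrow i - cst ?l * vrow i)"
      using filt_aform_prod_pt[OF fin(1) P G finite_codes filt_Vvrow] by (simp add: aprod_def card_codes)
    have 2: "filt ?G d (aprod i * vrow i)" using i by (intro filt.gen) (auto simp: special_gens_def)
    have "filt ?G d (aprod i * vrow i - (aprod i * vrow i - cst ?l * vrow i))"
      by (rule filt_diff[OF 2 1])
    moreover have "aprod i * vrow i - (aprod i * vrow i - cst ?l * vrow i) = cst ?l * vrow i" by simp
    ultimately have "filt ?G d (cst (inverse ?l) * (cst ?l * vrow i))" by (metis filt.scale)
    moreover have "cst (inverse ?l) * (cst ?l * vrow i) = vrow i"
      using \<open>?l \<noteq> 0\<close> by (simp add: mult_single flip: mult.assoc)
    ultimately show ?thesis using dm filt_le by simp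
  qed
  obtain a b' where a: "\<forall>j<n - 1. (\<Sum>i\<in>Y \<union> Z. cst (a j i) * vrow i)
      = X j + (\<Sum>u=n - 1..<n. cst (b' j u) * X u)"
    using vrow_combination[of "Y \<union> Z" "n - 1"] fin assms(4) YZ by (auto simp: card_Un_disjoint)
  have nn: "{n - 1..<n} = {n - 1}" "{..<n} = insert (n - 1) {..<n - 1}" using n by auto
  define b where "b j = b' j (n - 1)" for j
  have b: "(\<Sum>i\<in>Y \<union> Z. cst (a j i) * vrow i) = X j + cst (b j) * X (n - 1)" if j: "j < n - 1" for j
    using a[rule_format, OF j] unfolding nn(1) b_def by simp
  have Xj: "filt ?G m (X j + cst (b j) * X (n - 1))" if "j < n - 1" for j
    unfolding b[OF that, symmetric] by (intro filt_sum filt.scale row)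
  have "\<exists>c. filt ?G m (f - cst c * X (n - 1))" if f: "filt V m f" for f
  proof -
    obtain g where g: "filt ?G m (f - (\<Sum>j<n. cst (g j) * X j))"
      using filt_V_const[OF fin(1) P G f] by blast
    have A: "filt ?G m (\<Sum>j<n - 1. cst (g j) * (X j + cst (b j) * X (n - 1)))"
      by (intro filt_sum filt.scale Xj) auto
    have eq: "(\<Sum>j<n - 1. cst (g j) * (X j + cst (b j) * X (n - 1)))
        = (\<Sum>j<n - 1. cst (g j) * X j) + cst (\<Sum>j<n - 1. g j * b j) * X (n - 1)"
      by (simp add: distrib_left sum.distrib cst_sum cst_mult sum_distrib_right mult.assoc)
    have "filt ?G m (f - (\<Sum>j<n. cst (g j) * X j) +
        ((\<Sum>j<n - 1. cst (g j) * X j) + cst (\<Sum>j<n - 1. g j * b j) * X (n - 1)))"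
      using filt.add[OF g A] unfolding eq .
    then have "filt ?G m (f - cst (g (n - 1) - (\<Sum>j<n - 1. g j * b j)) * X (n - 1))"
      by (simp add: nn(2) single_diff algebra_simps)
    then show ?thesis by blast
  qed
  moreover have "filt V m (X (n - 1))" using filt_le[OF filt_VX[of "n - 1"], of m] n by simp
  ultimately show ?thesis unfolding codim_le_def
  proof (intro exI[of _ "\<lambda>_. X (n - 1)"] conjI allI impI)
    fix f assume "filt V m f"
    then obtain c where "filt ?G m (f - cst c * X (n - 1))"
      using \<open>\<And>f. filt V m f \<Longrightarrow> \<exists>c. filt ?G m (f - cst c * X (n - 1))\<close> by blast
    then show "\<exists>c. filt ?G m (f - (\<Sum>a<(1::nat). cst (c a) * X (n - 1)))"
      by (intro exI[of _ "\<lambda>_. c"]) simp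
  qed
qed

text \<open>One factor is split off at a time: the quotient by that factor contributes
  \<open>M\<close>, and the rest is the image, under multiplication by it, of the quotient for the
  shorter product. Assumption \<open>B\<close> makes this multiplication respect \<open>B\<close>.
  Each step uses up one degree, whence \<open>card C + m0\<close>.\<close>

lemma codim_partial_product:
  assumes "finite C" and "\<And>c m. c \<in> C \<Longrightarrow> m0 \<le> m \<Longrightarrow>
      codim_le (B \<union> mul_gens 1 (aform c)) m M" and "card C + m0 \<le> m"
    and B: "\<And>a g c. (a, g) \<in> B \<Longrightarrow> filt B (Suc a) (aform c * g)"
  shows "codim_le (B \<union> mul_gens (card C) (\<Prod>c\<in>C. aform c)) m (card C * M)"
  using assms(1-3)
proof (induction C arbitrary: m rule: finite_induct)
  case empty
  have "codim_le (B \<union> mul_gens 0 1) m 0" by (rule codim_le_0) (auto simp: mul_gens_def intro!: filt.gen)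
  then show ?case by simp
next
  case (insert c C)
  have 1: "codim_le (B \<union> (\<lambda>j. (1, aform c * X j)) ` {..<n}) m M"
    using insert.prems(1)[of c m] insert.prems(2) insert.hyps by (simp add: mul_gens_def)
  have 2: "codim_le (B \<union> mul_gens (card C) (\<Prod>c\<in>C. aform c)) (m - 1) (card C * M)"
    by (rule insert.IH) (use insert.prems insert.hyps in auto)
  have "codim_le (B \<union> mul_gens (card (insert c C)) (\<Prod>c\<in>insert c C. aform c)) m (M + card C * M)"
  proof (rule codim_le_add[OF 1 2])
    show "1 \<le> m" using insert.prems insert.hyps by simp
    show "filt V 1 (aform c * X j)" if "j < n" for j using filt_aform[OF filt_VX[OF that]] by simp
    fix a g assume ag: "(a, g) \<in> B \<union> mul_gens (card C) (\<Prod>c\<in>C. aform c)"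
    show "filt (B \<union> mul_gens (card (insert c C)) (\<Prod>c\<in>insert c C. aform c)) (a + 1) (aform c * g)"
    proof (cases "(a, g) \<in> B")
      case True
      then show ?thesis using B[of a g c] by (auto intro: filt_mono)
    next
      case False
      then obtain j where "j < n" "a = card C" "g = (\<Prod>c\<in>C. aform c) * X j" using ag
          by (auto simp: mul_gens_def)
      then show ?thesis using insert.hyps
        by (intro filt.gen UnI2) (auto simp: mul_gens_def mult.assoc)
    qed
  qed auto
  then show ?case using insert.hyps by simp
qed

text \<open>A row in \<open>Z\<close> vanishes if one of its \<open>d\<close> forms does, which adds
  a code to \<open>P\<close>, or if its constant vector does, which moves the row to
  \<open>Y\<close>. The count therefore follows Pascal's rule with a factor \<open>d\<close> per
  chosen form. A branch ends when \<open>P\<close> determines a point, leaving dimension one, or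
  when no row is left and \<open>Y\<close> provides n independent vectors, leaving dimension
  zero.\<close>

lemma codim_special:
  assumes "finite Z" "finite P" "finite Y" "Y \<inter> Z = {}" "\<And>c. c \<in> P \<Longrightarrow> c div d \<notin> Z"
    "card P \<le> k" "card P + card Y + card Z = n + k - 1" "d * card Z \<le> m"
  shows "codim_le (special_gens P Y Z) m (d ^ (k - card P) * (card Z choose (k - card P)))"
  using assms
proof (induction Z arbitrary: P Y m rule: finite_induct)
  case empty
  show ?case
  proof (cases "card P = k")
    case True
    then show ?thesis using codim_special_point[of P Y "{}" m] empty by simp
  next
    case False
    then have "n \<le> card Y" using empty by simp
    then obtain Y' where Y': "Y' \<subseteq> Y" "card Y' = n" "finite Y'"
      using empty(2) by (meson obtain_subset_with_card_n)
    obtain a b where a: "\<forall>j<n. (\<Sum>i\<in>Y'. cst (a j i) * vrow i) = X j + (\<Sum>u=n..<n. cst (b j u) * X u)"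
      using vrow_combination[of Y' n] Y' by auto
    have "codim_le (special_gens P Y {}) m 0"
    proof (rule codim_le_0)
      fix j assume "j < n"
      then have "X j = (\<Sum>i\<in>Y'. cst (a j i) * vrow i)" using a by simp
      also have "filt (special_gens P Y {}) 0 \<dots>"
        using Y' by (intro filt_sum filt.scale filt.gen) (auto simp: special_gens_def)
      finally show "filt (special_gens P Y {}) 0 (X j)" .
    qed
    moreover have "(0 choose (k - card P)) = 0" using False empty by (intro binomial_eq_0) simp
    ultimately show ?thesis by (metis card.empty mult_0_right)
  qed
next
  case (insert i Z)
  show ?case
  proof (cases "card P = k")
    case True
    then show ?thesis using codim_special_point[of P Y "insert i Z" m] insert.prems insert.hyps by simp
  next
    case False
    define q where "q = k - card P - 1"
    have q: "k - card P = Suc q" using False insert.prems by (simp add: q_def)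
    let ?B = "special_gens P Y Z"
    have P: "c \<notin> P" if "c \<in> codes i" for c using that insert.prems(4)[of c] by (auto simp: codes_iff)
    have m: "d * Suc (card Z) \<le> m" using insert.prems insert.hyps by simp
    have 1: "codim_le (?B \<union> mul_gens d (aprod i)) m (d * (d ^ q * (card Z choose q)))"
    proof -
      have "codim_le (?B \<union> mul_gens (card (codes i)) (\<Prod>c\<in>codes i. aform c)) m (card (codes i) * (d ^ q
          * (card Z choose q)))"
      proof (rule codim_partial_product)
        fix c m assume c: "c \<in> codes i" and "d * card Z \<le> m"
        then have "codim_le (special_gens (insert c P) Y Z) m (d ^ (k
            - card (insert c P)) * (card Z choose (k - card (insert c P))))"
          using insert.prems insert.hyps P[OF c] False
          by (intro insert.IH) (auto simp: codes_iff)
        moreover have "special_gens (insert c P) Y Z = ?B \<union> mul_gens 1 (aform c)"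
            by (auto simp: special_gens_def)
        moreover have "k - card (insert c P) = q" using P[OF c] insert.prems by (simp add: q_def)
        ultimately show "codim_le (?B \<union> mul_gens 1 (aform c)) m (d ^ q * (card Z choose q))" by simp
      next
        fix a g c assume "(a, g) \<in> ?B"
        then show "filt ?B (Suc a) (aform c * g)" by (intro filt_aform filt.gen)
      qed (use m in \<open>auto simp: finite_codes card_codes\<close>)
      then show ?thesis by (simp add: card_codes aprod_def)
    qed
    have 2: "codim_le (special_gens P (insert i Y) Z) (m - d) (d ^ Suc q * (card Z choose Suc q))"
    proof -
      have "codim_le (special_gens P (insert i Y) Z) (m - d) (d ^ (k - card P) * (card Z choose (k
          - card P)))"
        using insert.prems insert.hyps m by (intro insert.IH) auto
      then show ?thesis by (simp add: q)
    qed
    have "codim_le (special_gens P Y (insert i Z)) m (d * (d ^ q * (card Z choose q))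
        + d ^ Suc q * (card Z choose Suc q))"
    proof (rule codim_le_add[OF 1[unfolded mul_gens_def] 2])
      show "d \<le> m" using m by simp
      show "filt V d (aprod i * X j)" if "j < n" for j
        using filt_aform_prod[OF finite_codes filt_VX[OF that], of i] by (simp add: card_codes aprod_def)
      show "?B \<subseteq> special_gens P Y (insert i Z)" by (auto simp: special_gens_def)
      fix a g assume ag: "(a, g) \<in> special_gens P (insert i Y) Z"
      show "filt (special_gens P Y (insert i Z)) (a + d) (aprod i * g)"
      proof (cases "(a, g) \<in> special_gens P Y (insert i Z)")
        case True
        then show ?thesis
          using filt_aform_prod[OF finite_codes filt.gen, of a g _ i] by (simp add: card_codes aprod_def)
      next
        case False
        then have "a = 0" "g = vrow i" using ag by (auto simp: special_gens_def)
        then show ?thesis by (auto simp: special_gens_def intro!: filt.gen)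
      qed
    qed
    moreover have "d * (d ^ q * (card Z choose q)) + d ^ Suc q * (card Z choose Suc q)
        = d ^ Suc q * (card (insert i Z) choose Suc q)"
      using insert.hyps by (simp add: algebra_simps)
    ultimately show ?thesis by (simp only: q)
  qed
qed

end

section \<open>A monomial basis of the quotient\<close>

context rect
begin

abbreviation rows :: nat where "rows \<equiv> n + k - 1"

definition N :: nat where "N = d ^ k * (rows choose k)"

definition last_mono :: "nat \<Rightarrow> (nat \<Rightarrow>\<^sub>0 nat) \<Rightarrow>\<^sub>0 'a::zero_neq_one"
  where "last_mono a = Poly_Mapping.single (Poly_Mapping.single 1 a + xmon (n - 1)) 1"

lemma last_mono_0: "last_mono 0 = X (n - 1)"
  by (simp add: last_mono_def X_def)

lemma last_mono_Suc: "last_mono (Suc a) = lam 1 * (last_mono a :: nat cpoly)"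
  by (simp add: last_mono_def lam_def mult_single flip: add.assoc single_add)

lemma filt_last_mono: "a \<le> m \<Longrightarrow> filt V m (last_mono a)"
proof (induction a arbitrary: m)
  case 0
  then show ?case using filt_le[OF filt_VX[of "n - 1"], of m] n by (simp add: last_mono_0)
next
  case (Suc a)
  then have "filt V (Suc (m - 1)) (last_mono (Suc a))" using k
      by (simp only: last_mono_Suc) (intro filt.var Suc.IH, auto)
  then show ?case using Suc by simp
qed

text \<open>A dimension argument without quotient spaces: \<open>M\<close> independent elements in a
  quotient spanned by \<open>M\<close> elements. \<open>A\<close> expresses the former through the
  latter; a kernel vector of \<open>A\<close> would be a dependence, and its adjugate exchanges the
  two lists.\<close>

lemma codim_le_basis:
  assumes codim: "codim_le G m M" and E: "\<And>a. a < M \<Longrightarrow> filt V m (E a)"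
    and indep: "\<And>v. filt G m (\<Sum>a<M. cst (v a) * E a) \<Longrightarrow> \<forall>a<M. v a = 0"
    and f: "filt V m f"
  shows "\<exists>c. filt G m (f - (\<Sum>a<M. cst (c a) * E a))"
proof -
  obtain e where e: "\<And>f. filt V m f \<Longrightarrow> \<exists>c. filt G m (f - (\<Sum>a<M. cst (c a) * e a))"
    using codim unfolding codim_le_def by blast
  have "\<forall>a. \<exists>c. a < M \<longrightarrow> filt G m (E a - (\<Sum>b<M. cst (c b) * e b))" using e E by blast
  then obtain C where C: "\<And>a. a < M \<Longrightarrow> filt G m (E a - (\<Sum>b<M. cst (C a b) * e b))"
    using choice[of "\<lambda>a c. a < M \<longrightarrow> filt G m (E a - (\<Sum>b<M. cst (c b) * e b))"] by blast
  define A where "A = mat M M (\<lambda>(b, a). C a b)"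
  have A: "A \<in> carrier_mat M M" by (simp add: A_def)
  have "det A \<noteq> 0"
  proof
    assume "det A = 0"
    then obtain v where v: "v \<in> carrier_vec M" "v \<noteq> 0\<^sub>v M" "A *\<^sub>v v = 0\<^sub>v M"
      using det_0_iff_vec_prod_zero_field[OF A] by blast
    have 0: "(\<Sum>a<M. v $ a * C a b) = 0" if "b < M" for b
    proof -
      have "(A *\<^sub>v v) $ b = (\<Sum>a<M. v $ a * C a b)"
        using that v(1) by (simp add: A_def scalar_prod_def lessThan_atLeast0 mult.commute)
      then show ?thesis using v(3) that by simp
    qed
    have "filt G m (\<Sum>a<M. cst (v $ a) * (E a - (\<Sum>b<M. cst (C a b) * e b)))"
      by (intro filt_sum filt.scale C) auto
    also have "(\<Sum>a<M. cst (v $ a) * (E a - (\<Sum>b<M. cst (C a b) * e b)))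
        = (\<Sum>a<M. cst (v $ a) * E a) - (\<Sum>a<M. \<Sum>b<M. cst (v $ a * C a b) * e b)"
      by (simp add: right_diff_distrib sum_subtractf sum_distrib_left cst_mult mult.assoc)
    also have "(\<Sum>a<M. \<Sum>b<M. cst (v $ a * C a b) * e b) = (\<Sum>b<M. cst (\<Sum>a<M. v $ a * C a b) * e b)"
      by (subst sum.swap) (simp add: cst_sum sum_distrib_right)
    also have "\<dots> = 0" by (simp add: 0)
    finally have "\<forall>a<M. v $ a = 0" by (intro indep) simp
    then show False using v(1,2) by (auto simp: vec_eq_iff)
  qed
  define I where "I = adj_mat A"
  have I: "(\<Sum>a<M. I $$ (a, c) * C a b) = (if b = c then det A else 0)" if "b < M" "c < M" for b c
  proof -
    have "(A * I) $$ (b, c) = (\<Sum>a<M. I $$ (a, c) * C a b)"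
      using that adj_mat(1)[OF A] by (simp add: A_def I_def scalar_prod_def lessThan_atLeast0 mult.commute)
    then show ?thesis using that adj_mat(2)[OF A] by (auto simp: I_def split: if_splits)
  qed
  obtain c where c: "filt G m (f - (\<Sum>a<M. cst (c a) * e a))" using e f by blast
  define g where "g a = (\<Sum>b<M. c b * I $$ (a, b)) / det A" for a
  have "filt G m (\<Sum>a<M. cst (g a) * (E a - (\<Sum>b<M. cst (C a b) * e b)))"
    by (intro filt_sum filt.scale C) auto
  also have "(\<Sum>a<M. cst (g a) * (E a - (\<Sum>b<M. cst (C a b) * e b)))
      = (\<Sum>a<M. cst (g a) * E a) - (\<Sum>a<M. \<Sum>b<M. cst (g a * C a b) * e b)"
    by (simp add: right_diff_distrib sum_subtractf sum_distrib_left cst_mult mult.assoc)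
  also have "(\<Sum>a<M. \<Sum>b<M. cst (g a * C a b) * e b) = (\<Sum>b<M. cst (\<Sum>a<M. g a * C a b) * e b)"
    by (subst sum.swap) (simp add: cst_sum sum_distrib_right)
  also have "\<dots> = (\<Sum>b<M. cst (c b) * e b)"
  proof (intro sum.cong refl arg_cong2[where f = times] arg_cong[where f = cst])
    fix b assume b: "b \<in> {..<M}"
    have "(\<Sum>a<M. g a * C a b) = (\<Sum>a<M. \<Sum>b'<M. c b' * (I $$ (a, b') * C a b)) / det A"
      by (simp add: g_def sum_divide_distrib sum_distrib_right mult.assoc)
    also have "(\<Sum>a<M. \<Sum>b'<M. c b' * (I $$ (a, b') * C a b)) = (\<Sum>b'<M. c b' * (\<Sum>a<M. I $$ (a, b') * C a b))"
      by (subst sum.swap) (simp add: sum_distrib_left)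
    also have "\<dots> = (\<Sum>b'<M. if b = b' then c b' * det A else 0)" using b I by (intro sum.cong) auto
    finally show "(\<Sum>a<M. g a * C a b) = c b" using b \<open>det A \<noteq> 0\<close> by simp
  qed
  finally have "filt G m ((f - (\<Sum>b<M. cst (c b) * e b)) - ((\<Sum>a<M. cst (g a) * E a)
      - (\<Sum>b<M. cst (c b) * e b)))"
    using c by (intro filt_diff[OF c])
  then show ?thesis by (intro exI[of _ g]) simp
qed

section \<open>The solutions of the special system\<close>

text \<open>One vanishing form in each of \<open>k\<close> different rows; such a choice determines
  a solution of the special system.\<close>

definition special_sols :: "nat set set"
  where "special_sols = {S. S \<subseteq> {..<rows * d} \<and> card S = k \<and> inj_on (\<lambda>c. c div d) S}"

text \<open>The n - 1 rows not hit by \<open>S\<close> are the roots of a monic polynomial of degree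
  n - 1. Its coefficient vector is annihilated by the \<open>vrow\<close> of these rows and by no
  other of the system, and its last entry is 1.\<close>

definition kernel_coeff :: "nat set \<Rightarrow> nat \<Rightarrow> complex"
  where "kernel_coeff S j = coeff (\<Prod>i\<in>{..<rows} - (\<lambda>c. c div d) ` S. [:- of_nat i, 1:]) j"

definition special_pt :: "nat set \<Rightarrow> nat \<Rightarrow> complex"
  where "special_pt S v = (if v \<le> k then pt S v else kernel_coeff S (v - (k + 1)))"

lemma special_sols_finite: "S \<in> special_sols \<Longrightarrow> finite S"
  using k by (auto simp: special_sols_def intro: finite_subset)

lemma finite_special_sols: "finite special_sols"
  by (rule finite_subset[of _ "Pow {..<rows * d}"]) (auto simp: special_sols_def)

lemma special_sols_div: "S \<in> special_sols \<Longrightarrow> c \<in> S \<Longrightarrow> c div d < rows"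
  using d by (auto simp: special_sols_def less_mult_imp_div_less)

text \<open>\<open>N\<close> counts the choices of \<open>k\<close> rows and of a remainder below
  \<open>d\<close> in each; division by \<open>d\<close> recovers the choice from its set of
  codes.\<close>

lemma card_special_sols: "N \<le> card special_sols"
proof -
  let ?D = "SIGMA K : {K. K \<subseteq> {..<rows} \<and> card K = k}. K \<rightarrow>\<^sub>E {..<d}"
  define F where "F = (\<lambda>(K, g). (\<lambda>i. i * d + g i) ` (K :: nat set))"
  have div: "(i * d + g i) div d = i" "(i * d + g i) mod d = g i"
    if "i \<in> K" "g \<in> K \<rightarrow>\<^sub>E {..<d}" for i K and g :: "nat \<Rightarrow> nat"
    using PiE_mem[OF that(2,1)] by auto
  have "card ?D = (\<Sum>K | K \<subseteq> {..<rows} \<and> card K = k. card (K \<rightarrow>\<^sub>E {..<d}))"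
    by (rule card_SigmaI) (auto intro!: finite_PiE dest: finite_subset[OF _ finite_lessThan])
  also have "\<dots> = (\<Sum>K | K \<subseteq> {..<rows} \<and> card K = k. d ^ k)"
    by (intro sum.cong) (auto simp: card_PiE dest: finite_subset[OF _ finite_lessThan])
  also have "\<dots> = N" using n_subsets[of "{..<rows}" k] by (simp add: N_def)
  finally have "card ?D = N" .
  moreover have "card ?D \<le> card special_sols"
  proof (rule card_inj_on_le)
    show "inj_on F ?D"
    proof (rule inj_onI)
      fix a b assume a: "a \<in> ?D" and b: "b \<in> ?D" and eq: "F a = F b"
      obtain K g K' g' where ab: "a = (K, g)" "b = (K', g')" by (cases a, cases b)
      have g: "g \<in> K \<rightarrow>\<^sub>E {..<d}" "g' \<in> K' \<rightarrow>\<^sub>E {..<d}" using a b ab by auto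
      have "(\<lambda>c. c div d) ` F a = K" "(\<lambda>c. c div d) ` F b = K'"
        using div(1)[OF _ g(1)] div(1)[OF _ g(2)] by (auto simp: F_def ab image_image)
      then have K: "K = K'" using eq by simp
      have "g i = g' i" if i: "i \<in> K" for i
      proof -
        have "i * d + g i \<in> F b" using i eq by (auto simp: F_def ab)
        then obtain i' where i': "i' \<in> K" "i * d + g i = i' * d + g' i'" using K by (auto simp: F_def ab)
        have "i = i'" using div(1)[OF i g(1)] div(1)[of i' K' g'] i' g K by metis
        then show ?thesis using i' by simp
      qed
      then have "g = g'" using g K by (intro PiE_ext) auto
      then show "a = b" using K ab by simp
    qed
    show "F ` ?D \<subseteq> special_sols"
    proof
      fix S assume "S \<in> F ` ?D"
      then obtain K g where K: "K \<subseteq> {..<rows}" "card K = k" and g: "g \<in> K \<rightarrow>\<^sub>E {..<d}" and S: "S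
          = (\<lambda>i. i * d + g i) ` K"
        by (auto simp: F_def)
      have "i * d + g i < rows * d" if "i \<in> K" for i
      proof -
        have "i * d + g i < Suc i * d" using PiE_mem[OF g that] by simp
        also have "\<dots> \<le> rows * d" using K that by (intro mult_le_mono1) auto
        finally show ?thesis .
      qed
      moreover have "inj_on (\<lambda>i. i * d + g i) K"
        by (rule inj_on_inverseI[of _ "\<lambda>c. c div d"]) (rule div(1)[OF _ g])
      moreover have "inj_on (\<lambda>c. c div d) S"
        unfolding S by (rule inj_on_imageI) (simp add: div(1)[OF _ g] o_def inj_on_def)
      ultimately show "S \<in> special_sols" using K by (auto simp: special_sols_def S card_image)
    qed
  qed (rule finite_special_sols)
  ultimately show ?thesis by simp
qed

lemma
  assumes "S \<in> special_sols"
  shows kernel_coeff_top: "kernel_coeff S (n - 1) = 1"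
    and poly_kernel_coeff: "(\<Sum>j<n. y ^ j * kernel_coeff S j)
        = (\<Prod>i\<in>{..<rows} - (\<lambda>c. c div d) ` S. y - of_nat i)"
proof -
  define q :: "complex poly" where "q = (\<Prod>i\<in>{..<rows} - (\<lambda>c. c div d) ` S. [:- of_nat i, 1:])"
  have "card ((\<lambda>c. c div d) ` S) = k" using assms by (simp add: special_sols_def card_image)
  moreover have "(\<lambda>c. c div d) ` S \<subseteq> {..<rows}" using special_sols_div[OF assms] by auto
  ultimately have "card ({..<rows} - (\<lambda>c. c div d) ` S) = n - 1"
    using n special_sols_finite[OF assms] by (simp add: card_Diff_subset)
  then have deg: "degree q = n - 1"
    unfolding q_def by (subst degree_prod_eq_sum_degree) auto
  have "coeff q (degree q) = 1" unfolding q_def by (rule monic_prod) auto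
  then show "kernel_coeff S (n - 1) = 1" unfolding kernel_coeff_def deg by (simp only: q_def)
  have "poly q y = (\<Sum>j\<le>n - 1. coeff q j * y ^ j)" unfolding poly_altdef deg ..
  also have "{..n - 1} = {..<n}" using n by auto
  finally show "(\<Sum>j<n. y ^ j * kernel_coeff S j) = (\<Prod>i\<in>{..<rows} - (\<lambda>c. c div d) ` S. y - of_nat i)"
    by (simp add: kernel_coeff_def q_def poly_prod mult.commute)
qed

lemma special_pt_lam: "v \<in> {1..k} \<Longrightarrow> special_pt S v = pt S v"
  and special_pt_X: "special_pt S (k + 1 + j) = kernel_coeff S j"
  by (auto simp: special_pt_def)

context
  fixes hom :: "complex \<Rightarrow> 'r::comm_ring_1"
  assumes hom: "comm_ring_hom hom"
begin

interpretation comm_ring_hom hom by (rule hom)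

lemma hom_eval_X: "hom_eval hom (X j) x = x (k + 1 + j)"
  by (simp add: X_def hom_eval_single xmon_def mon_eval_single)

lemma hom_eval_lam: "hom_eval hom (lam i) x = x i"
  by (simp add: lam_def hom_eval_single mon_eval_single)

lemma hom_eval_cst: "hom_eval hom (cst c) x = hom c"
  by (simp add: hom_eval_single)

lemma hom_eval_aform: "hom_eval hom (aform c) x
    = hom (2 ^ (c * k)) + (\<Sum>s=1..k. hom (2 ^ (c * (k - s))) * x s)"
  by (simp add: aform_def hom_eval_simps hom_eval_lam hom_eval_cst del: hom_eval_single)

lemma hom_eval_vrow: "hom_eval hom (vrow i) x = (\<Sum>j<n. hom (of_nat i ^ j) * x (k + 1 + j))"
  by (simp add: vrow_def hom_eval_simps hom_eval_X hom_eval_cst del: hom_eval_single)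

end

abbreviation pev :: "nat cpoly \<Rightarrow> (nat \<Rightarrow> complex) \<Rightarrow> complex"
  where "pev \<equiv> hom_eval (\<lambda>c. c)"

lemma pev_0 [simp]: "pev 0 x = 0"
  using comm_ring_hom.hom_eval_0[OF comm_ring_hom_ident] .

lemma pev_aform: "pev (aform c) (special_pt S) = aform_val c (pt S)"
  by (simp add: hom_eval_aform[OF comm_ring_hom_ident] aform_val_def special_pt_lam)

lemma pev_vrow: "S \<in> special_sols \<Longrightarrow> i < rows \<Longrightarrow> pev (vrow i) (special_pt S) = 0 \<longleftrightarrow> i \<notin> (\<lambda>c. c div d) ` S"
  using special_pt_X[of S] poly_kernel_coeff[of S "of_nat i"]
      by (auto simp: hom_eval_vrow[OF comm_ring_hom_ident])

lemma pev_aprod: "S \<in> special_sols \<Longrightarrow> pev (aprod i) (special_pt S) = 0 \<longleftrightarrow> i \<in> (\<lambda>c. c div d) ` S"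
  using special_sols_finite[of S] aform_val_pt_eq_0[of S]
  by (auto simp: aprod_def hom_eval_ident pev_aform finite_codes codes_iff special_sols_def)

lemma pev_last_mono: "pev (last_mono a) x = x 1 ^ a * x (k + n)"
  using n by (simp add: last_mono_def hom_eval_ident mon_eval_add mon_eval_single xmon_def)

lemma pev_filt: "filt G m f \<Longrightarrow> (\<And>e g. (e, g) \<in> G \<Longrightarrow> pev g x = 0) \<Longrightarrow> pev f x = 0"
  by (induction rule: filt.induct) (auto simp: hom_eval_ident)

lemma pt_1: "S \<in> special_sols \<Longrightarrow> pt S 1 = - (\<Sum>c\<in>S. 2 ^ c)"
proof -
  assume S: "S \<in> special_sols"
  \<comment> \<open>Vieta's formula for the second coefficient. The leading coefficient is carried
    along because it enters the second one when a factor is added.\<close>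
  have "coeff (\<Prod>c\<in>A. [:- (2 ^ c), 1:]) (card A - 1) = - (\<Sum>c\<in>A. (2::complex) ^ c) \<and>
      coeff (\<Prod>c\<in>A. [:- (2 ^ c), 1:]) (card A) = (1::complex)" if "finite A" "A \<noteq> {}" for A :: "nat set"
    using that
  proof (induction A rule: finite_ne_induct)
    case (insert c A)
    then have "card A > 0" by (simp add: card_gt_0_iff)
    then obtain r where r: "card A = Suc r" by (cases "card A") auto
    have "degree (\<Prod>c\<in>A. [:- (2 ^ c), 1:] :: complex poly) = card A"
      by (subst degree_prod_eq_sum_degree) auto
    then have "coeff (\<Prod>c\<in>A. [:- (2 ^ c), 1:] :: complex poly) (Suc (card A)) = 0"
      by (intro coeff_eq_0) simp
    then show ?case using insert r by simp
  qed auto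
  moreover have "S \<noteq> {}" using S k by (auto simp: special_sols_def)
  ultimately show ?thesis using S special_sols_finite[OF S] by (auto simp: pt_def special_sols_def)
qed

text \<open>Binary expansions are unique: up to sign, the first coordinate is the number
  \<open>set_encode S\<close>.\<close>

lemma inj_pt_1: "inj_on (\<lambda>S. pt S 1) special_sols"
proof (rule inj_onI)
  fix S T assume S: "S \<in> special_sols" and T: "T \<in> special_sols" and "pt S 1 = pt T 1"
  then have "(\<Sum>c\<in>S. 2 ^ c) = (\<Sum>c\<in>T. (2::complex) ^ c)" by (simp add: pt_1[simplified])
  then have "of_nat (\<Sum>c\<in>S. 2 ^ c) = (of_nat (\<Sum>c\<in>T. 2 ^ c) :: complex)" by simp
  then have "(\<Sum>c\<in>S. 2 ^ c) = (\<Sum>c\<in>T. 2 ^ c :: nat)" by (simp only: of_nat_eq_iff)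
  then have "set_encode S = set_encode T" by (simp add: set_encode_def)
  then show "S = T" using set_encode_eq[OF special_sols_finite[OF S] special_sols_finite[OF T]] by blast
qed

text \<open>There are at least \<open>N\<close> distinct first coordinates, so a polynomial of
  degree below \<open>N\<close> is determined by its values there.\<close>

lemma power_sums_zero:
  assumes "\<And>S. S \<in> special_sols \<Longrightarrow> (\<Sum>a<N. v a * pt S 1 ^ a) = 0"
  shows "\<forall>a<N. v a = 0"
proof (intro allI impI)
  fix j assume j: "j < N"
  obtain b where b: "\<forall>j<card special_sols. \<forall>u<card special_sols. (\<Sum>S\<in>special_sols. b j S * pt S 1 ^ u)
      = (if u = j then 1 else 0)"
    using dual_vandermonde[OF finite_special_sols inj_pt_1] by metis
  have "0 = (\<Sum>S\<in>special_sols. b j S * (\<Sum>a<N. v a * pt S 1 ^ a))" using assms by simp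
  also have "\<dots> = (\<Sum>a<N. v a * (\<Sum>S\<in>special_sols. b j S * pt S 1 ^ a))"
    unfolding sum_distrib_left by (subst sum.swap) (simp add: mult_ac)
  also have "\<dots> = (\<Sum>a<N. if a = j then v a else 0)"
    using b j card_special_sols by (intro sum.cong) auto
  finally show "v j = 0" using j by simp
qed

text \<open>Two bounds meet: the codimension count leaves at most \<open>N\<close> dimensions, and
  the \<open>N\<close> monomials are independent because evaluation at a special solution
  annihilates every multiple of the rows.\<close>

lemma special_span:
  assumes m: "d * rows \<le> m" "N \<le> m" and f: "filt V m f"
  shows "\<exists>c. filt (special_gens {} {} {..<rows}) m (f - (\<Sum>a<N. cst (c a) * last_mono a))"
proof (rule codim_le_basis[OF _ _ _ f])
  show "codim_le (special_gens {} {} {..<rows}) m N"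
    using codim_special[of "{..<rows}" "{}" "{}" m] m by (simp add: N_def)
  show "filt V m (last_mono a)" if "a < N" for a using that m by (intro filt_last_mono) simp
  fix v assume v: "filt (special_gens {} {} {..<rows}) m (\<Sum>a<N. cst (v a) * last_mono a)"
  show "\<forall>a<N. v a = 0"
  proof (rule power_sums_zero)
    fix S assume S: "S \<in> special_sols"
    have "pev (\<Sum>a<N. cst (v a) * last_mono a) (special_pt S) = 0"
      using v by (rule pev_filt) (use S pev_aprod pev_vrow in \<open>auto simp: special_gens_def hom_eval_ident\<close>)
    then show "(\<Sum>a<N. v a * pt S 1 ^ a) = 0"
      using kernel_coeff_top[OF S] special_pt_X[of S "n - 1"] special_pt_lam[of 1 S] n k
          by (simp add: hom_eval_ident pev_last_mono)
  qed
qed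

section \<open>Coefficient families\<close>

text \<open>The coefficient ring is left open because rows are also formed over C[t], for the
  families on a line.\<close>

definition row :: "(multi_index \<times> nat \<times> nat \<Rightarrow> 'a) \<Rightarrow> nat \<Rightarrow> (nat \<Rightarrow>\<^sub>0 nat) \<Rightarrow>\<^sub>0 'a::comm_ring_1"
  where "row x i = (\<Sum>(\<omega>, j)\<in>multi_indices k d \<times> {..<n}. Poly_Mapping.single (\<omega> + xmon j) (x (\<omega>, i, j)))"

definition row_gens :: "(multi_index \<times> nat \<times> nat \<Rightarrow> complex) \<Rightarrow> (nat \<times> nat cpoly) set"
  where "row_gens x = (\<lambda>i. (d, row x i)) ` {..<rows}"

definition special_coeffs :: "multi_index \<times> nat \<times> nat \<Rightarrow> complex"
  where "special_coeffs = (\<lambda>(\<omega>, i, j)\<in>entry_indices n k d. Poly_Mapping.lookup (aprod i * vrow i) (\<omega>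
      + xmon j))"

lemma inj_mons: "inj_on (\<lambda>(\<omega>, j). \<omega> + xmon j) (multi_indices k m \<times> {..<n})"
proof (rule inj_onI, clarify)
  fix \<omega> j \<omega>' j' assume *: "\<omega> \<in> multi_indices k m" "\<omega>' \<in> multi_indices k m" "\<omega> + xmon j = \<omega>' + xmon j'"
  have "k + 1 + j \<notin> Poly_Mapping.keys \<omega>'" "k + 1 + j \<notin> Poly_Mapping.keys \<omega>" using *
      by (auto simp: multi_indices_def)
  then have "Poly_Mapping.lookup \<omega>' (k + 1 + j) = 0" "Poly_Mapping.lookup \<omega> (k + 1 + j) = 0"
      by (auto simp: in_keys_iff)
  then have "(1 :: nat) = (if j = j' then 1 else 0)"
    using arg_cong[OF *(3), of "\<lambda>m. Poly_Mapping.lookup m (k + 1 + j)"]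
    by (auto simp: lookup_add xmon_def lookup_single when_def split: if_splits)
  then have "j = j'" by (simp split: if_splits)
  then show "\<omega> = \<omega>' \<and> j = j'" using *(3) by simp
qed

lemma sum_mons: "(\<Sum>x\<in>mons m. f x) = (\<Sum>(\<omega>, j)\<in>multi_indices k m \<times> {..<n}. f (\<omega> + xmon j))"
  unfolding mons_def by (subst sum.reindex[OF inj_mons]) (auto intro!: sum.cong)

lemma row_special_coeffs: "i < rows \<Longrightarrow> row special_coeffs i = aprod i * vrow i"
proof -
  assume i: "i < rows"
  let ?f = "aprod i * vrow i"
  have "filt V d ?f" using filt_aform_prod[OF finite_codes filt_Vvrow] by (simp add: card_codes aprod_def)
  then have keys: "Poly_Mapping.keys ?f \<subseteq> mons d" by (simp add: filt_V_iff)
  have "row special_coeffs i = (\<Sum>x\<in>mons d. Poly_Mapping.single x (Poly_Mapping.lookup ?f x))"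
    unfolding row_def sum_mons using i by (intro sum.cong) (auto simp: special_coeffs_def entry_indices_def)
  also have "\<dots> = (\<Sum>x\<in>Poly_Mapping.keys ?f. Poly_Mapping.single x (Poly_Mapping.lookup ?f x))"
    using keys by (intro sum.mono_neutral_right finite_mons) (auto simp: in_keys_iff)
  also have "\<dots> = ?f" using poly_mapping_sum_singles[of ?f] by (rule sym)
  finally show ?thesis .
qed

lemma special_gens_special_coeffs: "special_gens {} {} {..<rows} = row_gens special_coeffs"
  by (auto simp: special_gens_def row_gens_def row_special_coeffs)

end

section \<open>Lifting solutions along a line\<close>

abbreviation tt :: "complex poly" where "tt \<equiv> [:0, 1:]"

lemma tt_dvd_iff: "tt dvd p \<longleftrightarrow> poly p 0 = 0"
  by (simp add: poly_eq_0_iff_dvd)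

lemma dvd_diff_prod:
  fixes m :: "'r::comm_ring_1"
  assumes "m dvd a - b" "m dvd a' - b'"
  shows "m dvd a * a' - b * b'"
proof -
  have "a * a' - b * b' = a * (a' - b') + (a - b) * b'" by (simp add: algebra_simps)
  then show ?thesis using assms by simp
qed

lemma dvd_diff_power: "m dvd a - b \<Longrightarrow> m dvd a ^ e - (b :: 'r::comm_ring_1) ^ e"
  by (induction e) (auto intro: dvd_diff_prod)

lemma dvd_diff_mon_eval:
  assumes "\<And>v. m dvd x v - (y v :: 'r::comm_ring_1)"
  shows "m dvd mon_eval x u - mon_eval y u"
proof -
  have "m dvd (\<Prod>v\<in>A. x v ^ Poly_Mapping.lookup u v) - (\<Prod>v\<in>A. y v ^ Poly_Mapping.lookup u v)" for A
    by (induction A rule: infinite_finite_induct) (auto intro: dvd_diff_prod dvd_diff_power assms)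
  then show ?thesis by (simp add: mon_eval_def)
qed

lemma dvd_diff_hom_eval:
  assumes "\<And>v. m dvd x v - (y v :: 'r::comm_ring_1)"
  shows "m dvd hom_eval h f x - hom_eval h f y"
proof -
  have "hom_eval h f x - hom_eval h f y = (\<Sum>u\<in>Poly_Mapping.keys f. h (Poly_Mapping.lookup f u)
      * (mon_eval x u - mon_eval y u))"
    by (simp add: hom_eval_def right_diff_distrib sum_subtractf)
  moreover have "m dvd mon_eval x u - mon_eval y u" for u
    by (rule dvd_diff_mon_eval) (rule assms)
  ultimately show ?thesis by (simp add: dvd_sum)
qed

lemma poly_hom_eval_pCons: "poly (hom_eval (\<lambda>c. [:c:]) f P) z = hom_eval (\<lambda>c. c) f (\<lambda>v. poly (P v) z)"
  by (simp add: hom_eval_def mon_eval_def poly_sum poly_prod)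

lemma pCons_sum: "[:\<Sum>i\<in>I. f i:] = (\<Sum>i\<in>I. [:f i :: 'r::comm_ring_1:])"
proof (induction I rule: infinite_finite_induct)
  case (insert i I)
  have "[:\<Sum>i\<in>insert i I. f i:] = [:f i:] + [:\<Sum>i\<in>I. f i:]" by (simp add: insert(1,2))
  then show ?case using insert by simp
qed auto

text \<open>\<open>a\<close> is the factor that vanishes at t = 0 and \<open>b\<close> its cofactor.
  A change of \<open>b\<close> is multiplied by \<open>a\<close>, a change of \<open>g\<close> by t,
  so both disappear modulo t^(r+2). Only the correction \<open>e\<close> of \<open>a\<close> is
  visible, and it has to solve one scalar equation.\<close>

lemma newton_step:
  assumes a: "poly a 0 = 0" and b: "tt ^ Suc r dvd b' - b" and g: "tt ^ Suc r dvd g' - g"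
    and a': "a' = a + tt ^ Suc r * [:e:]" and R: "a * b + tt * g = tt ^ Suc r * R"
    and e: "poly R 0 + poly b 0 * e = 0"
  shows "tt ^ Suc (Suc r) dvd a' * b' + tt * g'"
proof -
  obtain q where q: "b' = b + tt ^ Suc r * q" using b
      by (metis add_diff_cancel_left' diff_add_cancel add.commute dvdE)
  obtain h where h: "g' = g + tt ^ Suc r * h" using g
      by (metis add_diff_cancel_left' diff_add_cancel add.commute dvdE)
  obtain \<alpha> where \<alpha>: "a = tt * \<alpha>" using a tt_dvd_iff by (metis dvdE)
  have "tt dvd R + b * [:e:]" using e by (simp only: tt_dvd_iff) (simp add: mult.commute)
  then obtain \<rho> where \<rho>: "R + b * [:e:] = tt * \<rho>" by (metis dvdE)
  have "a' * b' + tt * g' = (a * b + tt * g) + tt ^ Suc r * (b * [:e:]) + a * tt ^ Suc r * q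
      + tt ^ Suc r * [:e:] * (tt ^ Suc r * q) + tt * tt ^ Suc r * h"
    unfolding a' q h by (simp only: distrib_left distrib_right add.assoc mult.assoc mult.commute
        mult.left_commute add.commute add.left_commute)
  also have "\<dots> = tt ^ Suc r * (R + b * [:e:]) + tt ^ Suc (Suc r) * (\<alpha> * q + tt ^ r * [:e:] * q + h)"
    unfolding R unfolding \<alpha> power_Suc
    by (simp only: distrib_left distrib_right mult.assoc mult.commute mult.left_commute add.assoc
        add.commute add.left_commute)
  also have "\<dots> = tt ^ Suc (Suc r) * (\<rho> + (\<alpha> * q + tt ^ r * [:e:] * q + h))"
    unfolding \<rho> power_Suc by (simp only: distrib_left mult.assoc mult.commute mult.left_commute)
  finally show ?thesis by (rule dvdI)
qed

context rect
begin

text \<open>The line that passes through the special family at t = 0 and through \<open>x\<close> at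
  t = 1.\<close>

definition line_coeffs :: "(multi_index \<times> nat \<times> nat \<Rightarrow> complex) \<Rightarrow> multi_index \<times> nat \<times> nat \<Rightarrow> complex poly"
  where "line_coeffs x v = [:special_coeffs v, x v - special_coeffs v:]"

abbreviation tev :: "((nat \<Rightarrow>\<^sub>0 nat) \<Rightarrow>\<^sub>0 complex poly) \<Rightarrow> (nat \<Rightarrow> complex poly) \<Rightarrow> complex poly"
  where "tev \<equiv> hom_eval (\<lambda>c. c)"

abbreviation lev :: "nat cpoly \<Rightarrow> (nat \<Rightarrow> complex poly) \<Rightarrow> complex poly"
  where "lev \<equiv> hom_eval (\<lambda>c. [:c:])"

lemma hom_eval_row: "comm_ring_hom h \<Longrightarrow>
    hom_eval h (row x i) P = (\<Sum>(\<omega>, j)\<in>multi_indices k d \<times> {..<n}. h (x (\<omega>, i, j)) * mon_eval P (\<omega>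
        + xmon j))"
  by (simp add: row_def comm_ring_hom.hom_eval_simps case_prod_unfold)

text \<open>Separates the special row, whose product structure is what \<open>newton_step\<close>
  exploits, from a perturbation divisible by t.\<close>

lemma tev_row: "tev (row (line_coeffs x) i) P = lev (row special_coeffs i) P
    + tt * lev (row (\<lambda>v. x v - special_coeffs v) i) P"
proof -
  have *: "line_coeffs x v = [:special_coeffs v:] + tt * [:x v - special_coeffs v:]" for v
      by (simp add: line_coeffs_def)
  show ?thesis
    unfolding hom_eval_row[OF comm_ring_hom_ident] hom_eval_row[OF comm_ring_hom_pCons]
        * sum_distrib_left sum.distrib[symmetric]
    by (intro sum.cong refl) (simp only: case_prod_unfold distrib_right mult.assoc)
qed

text \<open>An affine form responds linearly to a shift of the point, so the correction of the
  vanishing factor is exact, as \<open>newton_step\<close> requires.\<close>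

lemma lev_aform_shift:
  assumes "\<And>v. P' v = P v + r * [:\<delta> v:]"
  shows "lev (aform c) P' = lev (aform c) P + r * [:\<Sum>s=1..k. 2 ^ (c * (k - s)) * \<delta> s:]"
proof -
  have *: "[:\<Sum>s=1..k. 2 ^ (c * (k - s)) * \<delta> s:] = (\<Sum>s=1..k. [:2 ^ (c * (k - s)):] * [:\<delta> s:])"
    by (simp add: pCons_sum mult.commute)
  show ?thesis unfolding * hom_eval_aform[OF comm_ring_hom_pCons] assms
    by (simp only: distrib_left sum.distrib sum_distrib_left mult.assoc mult.left_commute add.assoc)
qed

lemma lev_vrow_shift:
  assumes "\<And>v. P' v = P v + r * [:\<delta> v:]"
  shows "lev (vrow i) P' = lev (vrow i) P + r * [:\<Sum>j<n. of_nat i ^ j * \<delta> (k + 1 + j):]"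
proof -
  have *: "[:\<Sum>j<n. of_nat i ^ j * \<delta> (k + 1 + j):] = (\<Sum>j<n. [:of_nat i ^ j:] * [:\<delta> (k + 1 + j):])"
    by (simp add: pCons_sum mult.commute)
  show ?thesis unfolding * hom_eval_vrow[OF comm_ring_hom_pCons] assms
    by (simp only: distrib_left sum.distrib sum_distrib_left mult.assoc mult.left_commute)
qed

lemma poly_interp_sum:
  assumes "\<forall>i\<ge>r. coeff q i = (0::complex)"
  shows "poly q y = (\<Sum>i<r. coeff q i * y ^ i)"
proof -
  have "poly q y = (\<Sum>i\<le>degree q. coeff q i * y ^ i)" by (rule poly_altdef)
  also have "\<dots> = (\<Sum>i<r + Suc (degree q). coeff q i * y ^ i)"
    by (rule sum.mono_neutral_left) (auto intro: coeff_eq_0)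
  also have "\<dots> = (\<Sum>i<r. coeff q i * y ^ i)"
    by (rule sum.mono_neutral_right) (use assms in auto)
  finally show ?thesis .
qed

text \<open>The Jacobian of the vanishing factors is invertible: the forms with codes in
  \<open>S\<close> see only the lambda part of a direction, the remaining rows only its vector part,
  and each part is an interpolation problem. Freezing the last vector entry leaves n - 1 unknowns
  for n - 1 rows.\<close>

lemma hensel_directions:
  assumes S: "S \<in> special_sols"
  shows "\<exists>\<delta>. (\<forall>c\<in>S. (\<Sum>s=1..k. 2 ^ (c * (k - s)) * \<delta> s) = e (c div d)) \<and>
    (\<forall>i\<in>{..<rows} - (\<lambda>c. c div d) ` S. (\<Sum>j<n. of_nat i ^ j * \<delta> (k + 1 + j)) = e i) \<and> \<delta> (k + n)
        = (0::complex)"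
proof -
  let ?I = "{..<rows} - (\<lambda>c. c div d) ` S"
  have cS: "card S = k" using S by (simp add: special_sols_def)
  obtain p where p: "\<forall>i\<ge>k. coeff p i = 0" "\<forall>c\<in>S. poly p (2 ^ c) = e (c div d)"
    using interpolation_ex[OF special_sols_finite[OF S] inj_power2_complex, of "\<lambda>c. e (c div d)"] cS by auto
  have "card ((\<lambda>c. c div d) ` S) = k" "(\<lambda>c. c div d) ` S \<subseteq> {..<rows}"
    using S special_sols_div[OF S] by (auto simp: special_sols_def card_image)
  then have "card ?I = n - 1" using n special_sols_finite[OF S] by (simp add: card_Diff_subset)
  then obtain q where q: "\<forall>i\<ge>n - 1. coeff q i = 0" "\<forall>i\<in>?I. poly q (of_nat i) = e i"
    using interpolation_ex[of ?I of_nat e] by (auto simp: inj_on_def)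
  define \<delta> where "\<delta> v = (if v \<le> k then coeff p (k - v) else coeff q (v - (k + 1)))" for v
  have "(\<Sum>s=1..k. 2 ^ (c * (k - s)) * \<delta> s) = poly p (2 ^ c)" for c
    unfolding poly_interp_sum[OF p(1)]
    by (rule sum.reindex_bij_witness[of _ "\<lambda>s. k - s" "\<lambda>i. k - i"]) (auto simp: \<delta>_def power_mult)
  moreover have "(\<Sum>j<n. of_nat i ^ j * \<delta> (k + 1 + j)) = poly q (of_nat i)" for i
  proof -
    have "\<forall>i\<ge>n. coeff q i = 0" using q(1) by simp
    from poly_interp_sum[OF this] show ?thesis by (simp add: \<delta>_def mult.commute)
  qed
  moreover have "\<delta> (k + n) = 0" using q(1) n by (simp add: \<delta>_def)
  ultimately show ?thesis using p(2) q(2) by (intro exI[of _ \<delta>]) auto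
qed

text \<open>Newton iteration from the constant curve: at t = 0 each row has a single vanishing
  factor, and \<open>hensel_directions\<close> corrects all of them at once. A separate polynomial
  curve for each order takes the place of a power series, and the last vector entry stays 1
  throughout.\<close>

lemma hensel:
  assumes S: "S \<in> special_sols"
  shows "\<exists>P. (\<forall>i<rows. tt ^ Suc r dvd tev (row (line_coeffs x) i) P) \<and> (\<forall>v. poly (P v) 0
      = special_pt S v) \<and> P (k + n) = 1"
proof (induction r)
  case 0
  define P where "P v = [:special_pt S v:]" for v
  have P0: "poly (P v) 0 = special_pt S v" for v by (simp add: P_def)
  have "tt ^ Suc 0 dvd tev (row (line_coeffs x) i) P" if "i < rows" for i
  proof -
    have "poly (lev (row special_coeffs i) P) 0 = 0"
      using pev_aprod[OF S, of i] pev_vrow[OF S that]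
          by (auto simp: poly_hom_eval_pCons P0 row_special_coeffs[OF that] hom_eval_ident)
    then show ?thesis unfolding power_Suc0_right tt_dvd_iff by (simp add: tev_row)
  qed
  moreover have "P (k + n) = 1" using kernel_coeff_top[OF S] n by (simp add: P_def special_pt_def)
  ultimately show ?case using P0 by blast
next
  case (Suc r)
  let ?D = "(\<lambda>c. c div d) ` S"
  obtain P where P: "\<And>i. i < rows \<Longrightarrow> tt ^ Suc r dvd tev (row (line_coeffs x) i) P"
    "\<And>v. poly (P v) 0 = special_pt S v" "P (k + n) = 1" using Suc by blast
  have lev0: "poly (lev f P) 0 = pev f (special_pt S)" for f by (simp add: poly_hom_eval_pCons P(2))
  have injS: "inj_on (\<lambda>c. c div d) S" using S by (simp add: special_sols_def)
  define R where "R i = (SOME R. tev (row (line_coeffs x) i) P = tt ^ Suc r * R)" for i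
  have R: "tev (row (line_coeffs x) i) P = tt ^ Suc r * R i" if "i < rows" for i
    unfolding R_def by (rule someI_ex) (use P(1)[OF that] in \<open>auto elim: dvdE\<close>)
  \<comment> \<open>What remains of row \<open>i\<close> when its vanishing factor is removed: that
    factor is an affine form if \<open>S\<close> hits the row, and the constant row otherwise.
    \<open>e\<close> below solves the scalar equation of \<open>newton_step\<close>.\<close>
  define co where "co i = (if i \<in> ?D then (\<Prod>c\<in>codes i - S. aform c) * vrow i else aprod i)" for i
  define e where "e i = - poly (R i) 0 / pev (co i) (special_pt S)" for i
  have co: "pev (co i) (special_pt S) \<noteq> 0" if "i < rows" for i
  proof (cases "i \<in> ?D")
    case True
    have "aform_val c (pt S) \<noteq> 0" if "c \<notin> S" for c
      using that aform_val_pt_eq_0[of S c] special_sols_finite[OF S] S by (simp add: special_sols_def)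
    then show ?thesis using True pev_vrow[OF S \<open>i < rows\<close>] finite_codes[of i]
      by (auto simp: co_def hom_eval_ident pev_aform)
  next
    case False
    then show ?thesis using pev_aprod[OF S] by (simp add: co_def)
  qed
  obtain \<delta> where \<delta>: "\<forall>c\<in>S. (\<Sum>s=1..k. 2 ^ (c * (k - s)) * \<delta> s) = e (c div d)"
    "\<forall>i\<in>{..<rows} - ?D. (\<Sum>j<n. of_nat i ^ j * \<delta> (k + 1 + j)) = e i" "\<delta> (k + n) = 0"
    using hensel_directions[OF S, of e] by blast
  define P' where "P' v = P v + tt ^ Suc r * [:\<delta> v:]" for v
  have cong: "tt ^ Suc r dvd lev f P' - lev f P" for f
    by (rule dvd_diff_hom_eval) (simp only: P'_def add_diff_cancel_left' dvd_triv_left)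
  have "tt ^ Suc (Suc r) dvd tev (row (line_coeffs x) i) P'" if i: "i < rows" for i
  proof -
    let ?g = "row (\<lambda>v. x v - special_coeffs v) i"
    have fac: "\<exists>f. aprod i * vrow i = f * co i \<and> pev f (special_pt S) = 0 \<and> lev f P'
        = lev f P + tt ^ Suc r * [:e i:]"
    proof (cases "i \<in> ?D")
      case True
      then obtain c where c: "c \<in> S" "c div d = i" by blast
      \<comment> \<open>\<open>S\<close> has at most one code per row, so \<open>c\<close> is the
        only form of this row that vanishes.\<close>
      have "codes i = insert c (codes i - S)" using c by (auto simp: codes_iff dest: inj_onD[OF injS])
      moreover have "c \<notin> codes i - S" using c by simp
      ultimately have "aprod i = aform c * (\<Prod>c\<in>codes i - S. aform c)"
        unfolding aprod_def by (metis finite_codes finite_Diff prod.insert)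
      moreover have "pev (aform c) (special_pt S) = 0"
        using aform_val_pt_eq_0[of S c] special_sols_finite[OF S] S c
            by (simp add: special_sols_def pev_aform)
      ultimately show ?thesis using True c \<delta>(1) lev_aform_shift[OF P'_def, of c]
        by (intro exI[of _ "aform c"]) (simp add: co_def mult.assoc)
    next
      case False
      then have "pev (vrow i) (special_pt S) = 0" using pev_vrow[OF S i] by simp
      then show ?thesis using False i \<delta>(2) lev_vrow_shift[OF P'_def, of i]
        by (intro exI[of _ "vrow i"]) (simp add: co_def)
    qed
    then obtain f where f: "aprod i * vrow i = f * co i" "pev f (special_pt S) = 0" "lev f P'
        = lev f P + tt ^ Suc r * [:e i:]"
      by blast
    have eq: "tev (row (line_coeffs x) i) Q = lev f Q * lev (co i) Q + tt * lev ?g Q" for Q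
      unfolding tev_row row_special_coeffs[OF i] f(1) hom_eval_pCons ..
    show ?thesis unfolding eq
    proof (rule newton_step[OF _ cong cong f(3)])
      show "poly (lev f P) 0 = 0" by (simp add: lev0 f(2))
      show "lev f P * lev (co i) P + tt * lev ?g P = tt ^ Suc r * R i" using R[OF i] by (simp only: eq)
      show "poly (R i) 0 + poly (lev (co i) P) 0 * e i = 0" using co[OF i] by (simp add: lev0 e_def)
    qed
  qed
  moreover have "poly (P' v) 0 = special_pt S v" for v using P(2) by (simp add: P'_def)
  moreover have "P' (k + n) = 1" by (simp add: P'_def P(3) \<delta>(3))
  ultimately show ?case by blast
qed

end

section \<open>Coordinates and Cramer's rule\<close>

interpretation cpv: vector_space "\<lambda>c (p :: nat cpoly). cst c * p"
  by unfold_locales (auto simp: distrib_left distrib_right single_add cst_mult mult.assoc)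

context rect
begin

definition rowmult_idx :: "nat \<Rightarrow> ((nat \<Rightarrow>\<^sub>0 nat) \<times> nat) set"
  where "rowmult_idx m = {(\<beta>, i). Poly_Mapping.keys \<beta> \<subseteq> {1..k} \<and> mi_size k \<beta> + d \<le> m \<and> i < rows}"

definition rowmult :: "(multi_index \<times> nat \<times> nat \<Rightarrow> 'r) \<Rightarrow> (nat \<Rightarrow>\<^sub>0 nat) \<times> nat \<Rightarrow> (nat \<Rightarrow>\<^sub>0 nat) \<Rightarrow>\<^sub>0
    'r::comm_ring_1"
  where "rowmult x = (\<lambda>(\<beta>, i). Poly_Mapping.single \<beta> 1 * row x i)"

lemma rowmult_sum: "rowmult x (\<beta>, i) = (\<Sum>(\<omega>, j)\<in>multi_indices k d \<times> {..<n}. Poly_Mapping.single (\<beta> + (\<omega>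
    + xmon j)) (x (\<omega>, i, j)))"
  by (simp add: rowmult_def row_def sum_distrib_left case_prod_unfold mult_single)

lemma lookup_rowmult: "Poly_Mapping.lookup (rowmult x (\<beta>, i)) u =
    (\<Sum>(\<omega>, j)\<in>multi_indices k d \<times> {..<n}. if \<beta> + (\<omega> + xmon j) = u then x (\<omega>, i, j) else 0)"
  by (simp add: rowmult_sum lookup_sum case_prod_unfold lookup_single when_def)

lemma keys_rowmult: "g \<in> rowmult_idx m \<Longrightarrow> Poly_Mapping.keys (rowmult x g) \<subseteq> mons m"
proof -
  assume g: "g \<in> rowmult_idx m"
  obtain \<beta> i where gi: "g = (\<beta>, i)" by (cases g)
  have "\<beta> + (\<omega> + xmon j) \<in> mons m" if "\<omega> \<in> multi_indices k d" "j < n" for \<omega> j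
  proof -
    have "\<beta> + \<omega> \<in> multi_indices k m"
      using that g gi keys_add[of \<beta> \<omega>] by (auto simp: rowmult_idx_def multi_indices_def mi_size_add)
    then show ?thesis using that unfolding mons_def
      by (intro image_eqI[of _ _ "(\<beta> + \<omega>, j)"]) (auto simp: add.assoc)
  qed
  then show ?thesis unfolding gi rowmult_sum
    by (intro order_trans[OF keys_sum]) (auto split: if_splits)
qed

lemma keys_last_mono: "a \<le> m \<Longrightarrow> Poly_Mapping.keys (last_mono a :: (nat \<Rightarrow>\<^sub>0 nat) \<Rightarrow>\<^sub>0 'r::comm_ring_1) \<subseteq>
    mons m"
  using filt_V_iff[of m "last_mono a"] filt_last_mono[of a m] by (simp add: last_mono_def)

definition mon_enum :: "nat \<Rightarrow> nat \<Rightarrow> nat \<Rightarrow>\<^sub>0 nat"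
  where "mon_enum m = (SOME f. bij_betw f {..<card (mons m)} (mons m))"

lemma mon_enum: "bij_betw (mon_enum m) {..<card (mons m)} (mons m)"
  unfolding mon_enum_def using someI_ex[OF ex_bij_betw_nat_finite[OF finite_mons]]
      by (simp add: lessThan_atLeast0)

text \<open>The candidate basis of the quotient comes first; \<open>G\<close> selects row multiples
  for the positions from \<open>N\<close> on.\<close>

definition column :: "(multi_index \<times> nat \<times> nat \<Rightarrow> 'r) \<Rightarrow> (nat \<Rightarrow> (nat \<Rightarrow>\<^sub>0 nat) \<times> nat) \<Rightarrow> nat \<Rightarrow> (nat \<Rightarrow>\<^sub>0 nat)
    \<Rightarrow>\<^sub>0 'r::comm_ring_1"
  where "column x G q = (if q < N then last_mono q else rowmult x (G q))"

definition colmat :: "(multi_index \<times> nat \<times> nat \<Rightarrow> 'r::comm_ring_1) \<Rightarrow> nat \<Rightarrow> (nat \<Rightarrow> (nat \<Rightarrow>\<^sub>0 nat) \<times> nat) \<Rightarrow>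
    'r mat"
  where "colmat x m G = mat (card (mons m)) (card (mons m)) (\<lambda>(u, q). Poly_Mapping.lookup (column x G q)
      (mon_enum m u))"

definition admissible :: "nat \<Rightarrow> (nat \<Rightarrow> (nat \<Rightarrow>\<^sub>0 nat) \<times> nat) \<Rightarrow> bool"
  where "admissible m G \<longleftrightarrow> N \<le> m \<and> N \<le> card (mons m) \<and> (\<forall>q. N \<le> q \<longrightarrow> q < card (mons m) \<longrightarrow> G q \<in> rowmult_idx m)"

text \<open>The coordinates of \<open>f\<close> in the columns, times the determinant. Being free of
  division, they are polynomial in the family and make sense over C[t].\<close>

definition cramer_coeff :: "(multi_index \<times> nat \<times> nat \<Rightarrow> 'r::comm_ring_1) \<Rightarrow> nat \<Rightarrow> (nat \<Rightarrow> (nat \<Rightarrow>\<^sub>0 nat) \<times>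
    nat) \<Rightarrow>
    ((nat \<Rightarrow>\<^sub>0 nat) \<Rightarrow>\<^sub>0 'r) \<Rightarrow> nat \<Rightarrow> 'r"
  where "cramer_coeff x m G f q = (\<Sum>a<card (mons m). adj_mat (colmat x m G) $$ (q, a)
      * Poly_Mapping.lookup f (mon_enum m a))"

lemma keys_column: "admissible m G \<Longrightarrow> q < card (mons m) \<Longrightarrow> Poly_Mapping.keys (column x G q) \<subseteq> mons m"
  using keys_rowmult[of "G q" m x] keys_last_mono[of q m] by (auto simp: column_def admissible_def)

lemma colmat_carrier: "colmat x m G \<in> carrier_mat (card (mons m)) (card (mons m))"
  by (simp add: colmat_def)

lemma smult_one_mult_vec: "h \<in> carrier_vec r \<Longrightarrow> (c \<cdot>\<^sub>m 1\<^sub>m r) *\<^sub>v h = c \<cdot>\<^sub>v (h :: 'r::comm_ring_1 vec)"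
  by (rule eq_vecI) auto

lemma cramer:
  fixes x :: "multi_index \<times> nat \<times> nat \<Rightarrow> 'r::comm_ring_1"
  assumes G: "admissible m G" and f: "Poly_Mapping.keys f \<subseteq> mons m"
  shows "cst (det (colmat x m G)) * f = (\<Sum>q<card (mons m). cst (cramer_coeff x m G f q) * column x G q)"
proof (rule poly_mapping_eqI)
  fix u
  let ?r = "card (mons m)" and ?B = "colmat x m G"
  show "Poly_Mapping.lookup (cst (det ?B) * f) u
      = Poly_Mapping.lookup (\<Sum>q<?r. cst (cramer_coeff x m G f q) * column x G q) u"
  proof (cases "u \<in> mons m")
    case False
    then have "Poly_Mapping.lookup f u = 0" using f by (auto simp: in_keys_iff)
    moreover have "Poly_Mapping.lookup (column x G q) u = 0" if "q < ?r" for q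
      using False keys_column[OF G that, of x] by (auto simp: in_keys_iff)
    ultimately show ?thesis by (simp add: lookup_sum lookup_cst_mult)
  next
    case True
    then obtain a where a: "a < ?r" "u = mon_enum m a" using mon_enum[of m] by (auto simp: bij_betw_def)
    define h where "h = vec ?r (\<lambda>a. Poly_Mapping.lookup f (mon_enum m a))"
    have h: "h \<in> carrier_vec ?r" by (simp add: h_def)
    have adj: "adj_mat ?B \<in> carrier_mat ?r ?r" using adj_mat(1)[OF colmat_carrier] .
    have y: "(adj_mat ?B *\<^sub>v h) $ q = cramer_coeff x m G f q" if "q < ?r" for q
      using that adj by (simp add: scalar_prod_def h_def cramer_coeff_def lessThan_atLeast0)
    have "?B *\<^sub>v (adj_mat ?B *\<^sub>v h) = (?B * adj_mat ?B) *\<^sub>v h"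
      by (rule assoc_mult_mat_vec[OF colmat_carrier adj h, symmetric])
    also have "\<dots> = det ?B \<cdot>\<^sub>v h" using adj_mat(2)[OF colmat_carrier, of x m G] h
      by (simp add: smult_one_mult_vec)
    finally have eq: "?B *\<^sub>v (adj_mat ?B *\<^sub>v h) = det ?B \<cdot>\<^sub>v h" .
    have "(?B *\<^sub>v (adj_mat ?B *\<^sub>v h)) $ a = (\<Sum>q<?r. Poly_Mapping.lookup (column x G q) u
        * (adj_mat ?B *\<^sub>v h) $ q)"
      using a adj by (simp add: scalar_prod_def colmat_def lessThan_atLeast0)
    also have "\<dots> = (\<Sum>q<?r. cramer_coeff x m G f q * Poly_Mapping.lookup (column x G q) u)"
      by (intro sum.cong) (auto simp: y mult.commute)
    finally have "det ?B * Poly_Mapping.lookup f u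
        = (\<Sum>q<?r. cramer_coeff x m G f q * Poly_Mapping.lookup (column x G q) u)"
      unfolding eq using a by (simp add: h_def)
    then show ?thesis by (simp add: lookup_sum lookup_cst_mult)
  qed
qed

lemma filt_rowmult:
  assumes "g \<in> rowmult_idx m"
  shows "filt (row_gens x) m (rowmult x g)"
proof -
  obtain \<beta> i where g: "g = (\<beta>, i)" "Poly_Mapping.keys \<beta> \<subseteq> {1..k}" "mi_size k \<beta> + d \<le> m" "i < rows"
    using assms by (auto simp: rowmult_idx_def)
  have "filt (row_gens x) (d + mi_size k \<beta>) (Poly_Mapping.single \<beta> 1 * row x i)"
    using g by (intro filt_mult_mono filt.gen) (auto simp: row_gens_def)
  then show ?thesis using g by (auto simp: rowmult_def intro: filt_le)
qed

lemma filt_row_gens_span: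
  assumes "filt (row_gens x) m f"
  shows "f \<in> cpv.span (rowmult x ` rowmult_idx m)"
  using assms
proof induction
  case (gen e g)
  then obtain i where "i < rows" "e = d" "g = row x i" by (auto simp: row_gens_def)
  then have "(0, i) \<in> rowmult_idx e" "g = rowmult x (0, i)"
      by (auto simp: rowmult_idx_def mi_size_def rowmult_def)
  then show ?case by (auto intro: cpv.span_base)
next
  case (Suc m f)
  have "rowmult_idx m \<subseteq> rowmult_idx (Suc m)" by (auto simp: rowmult_idx_def)
  then show ?case using Suc cpv.span_mono[of "rowmult x ` rowmult_idx m"
      "rowmult x ` rowmult_idx (Suc m)"] by blast
next
  case (var m f i)
  have "lam i * f \<in> cpv.span (rowmult x ` rowmult_idx (Suc m))"
    using var.IH
  proof (induction rule: cpv.span_induct_alt)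
    case (step c b f)
    then obtain \<beta> j where g: "(\<beta>, j) \<in> rowmult_idx m" "b = Poly_Mapping.single \<beta> 1 * row x j"
        by (auto simp: rowmult_def)
    define \<beta>' where "\<beta>' = Poly_Mapping.single i 1 + \<beta>"
    have "mi_size k (Poly_Mapping.single i 1) = 1"
      using var.hyps by (simp add: mi_size_def lookup_single when_def)
    then have "(\<beta>', j) \<in> rowmult_idx (Suc m)"
      using g var.hyps keys_add[of "Poly_Mapping.single i (1::nat)" \<beta>]
      by (auto simp: rowmult_idx_def \<beta>'_def mi_size_add)
    moreover have "lam i * b = rowmult x (\<beta>', j)"
      by (simp add: g rowmult_def lam_def \<beta>'_def mult_single flip: mult.assoc)
    ultimately have "lam i * b \<in> cpv.span (rowmult x ` rowmult_idx (Suc m))" by (auto intro: cpv.span_base)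
    then have "cst c * (lam i * b) + lam i * f \<in> cpv.span (rowmult x ` rowmult_idx (Suc m))"
      using step.IH by (intro cpv.span_add cpv.span_scale)
    then show ?case by (simp add: distrib_left mult.left_commute)
  qed (simp add: cpv.span_zero)
  then show ?case .
qed (auto intro: cpv.span_zero cpv.span_add cpv.span_scale)

lemma monomials_independent: "cpv.independent ((\<lambda>u. Poly_Mapping.single u 1) ` A)" if "finite A" for A
proof (rule cpv.independent_if_scalars_zero)
  let ?s = "\<lambda>u :: nat \<Rightarrow>\<^sub>0 nat. Poly_Mapping.single u (1::complex)"
  have inj: "inj_on ?s A"
    by (rule inj_onI) (metis keys_single singleton_inject zero_neq_one)
  fix f b assume *: "(\<Sum>b\<in>?s ` A. cst (f b) * b) = 0" and "b \<in> ?s ` A"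
  then obtain u where u: "u \<in> A" "b = ?s u" by blast
  have "0 = Poly_Mapping.lookup (\<Sum>u\<in>A. cst (f (?s u)) * ?s u) u" using * by (simp add: sum.reindex[OF inj])
  also have "\<dots> = (\<Sum>v\<in>A. if v = u then f (?s v) else 0)"
    by (simp add: lookup_sum lookup_cst_mult lookup_single when_def if_distrib cong: if_cong)
  finally show "f b = 0" using u that by simp
qed (use that in simp)

lemma single_eq_1_iff: "Poly_Mapping.single u (1::complex) = Poly_Mapping.single v 1 \<longleftrightarrow> u = v"
  by (metis keys_single singleton_inject zero_neq_one)

lemma last_mono_inj: "last_mono a = (last_mono b :: nat cpoly) \<Longrightarrow> a = b"
  using n by (auto simp: last_mono_def single_eq_1_iff dest: arg_cong[of _ _ "\<lambda>m. Poly_Mapping.lookup m 1"])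

lemma span_monomials: "cpv.span ((\<lambda>u. Poly_Mapping.single u 1) ` mons m)
    = {f. Poly_Mapping.keys f \<subseteq> mons m}"
proof (intro equalityI subsetI)
  fix f assume "f \<in> cpv.span ((\<lambda>u. Poly_Mapping.single u (1::complex)) ` mons m)"
  then have "filt V m f"
  proof (induction rule: cpv.span_induct_alt)
    case (step c b f)
    then have "filt V m b" by (auto simp: filt_V_iff)
    then show ?case using step by (intro filt.add filt.scale) auto
  qed (rule filt.zero)
  then show "f \<in> {f. Poly_Mapping.keys f \<subseteq> mons m}" by (simp add: filt_V_iff)
next
  fix f :: "nat cpoly" assume f: "f \<in> {f. Poly_Mapping.keys f \<subseteq> mons m}"
  have "(\<Sum>u\<in>Poly_Mapping.keys f. cst (Poly_Mapping.lookup f u) * Poly_Mapping.single u 1)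
      \<in> cpv.span ((\<lambda>u. Poly_Mapping.single u 1) ` mons m)"
    using f by (intro cpv.span_sum cpv.span_scale cpv.span_base) auto
  then show "f \<in> cpv.span ((\<lambda>u. Poly_Mapping.single u 1) ` mons m)"
    using poly_mapping_sum_singles[of f] by (simp add: mult_single)
qed

lemma det_colmat_nonzero:
  assumes G: "admissible m G" and inj: "inj_on (column x G) {..<card (mons m)}"
    and indep: "cpv.independent (column x G ` {..<card (mons m)})"
  shows "det (colmat x m G) \<noteq> 0"
proof
  let ?r = "card (mons m)" and ?c = "column x G"
  assume "det (colmat x m G) = 0"
  then obtain v where v: "v \<in> carrier_vec ?r" "v \<noteq> 0\<^sub>v ?r" "colmat x m G *\<^sub>v v = 0\<^sub>v ?r"
    using det_0_iff_vec_prod_zero_field[OF colmat_carrier] by blast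
  have "(\<Sum>q<?r. cst (v $ q) * ?c q) = 0"
  proof (rule poly_mapping_eqI)
    fix u
    show "Poly_Mapping.lookup (\<Sum>q<?r. cst (v $ q) * ?c q) u = Poly_Mapping.lookup 0 u"
    proof (cases "u \<in> mons m")
      case False
      then have "Poly_Mapping.lookup (?c q) u = 0" if "q < ?r" for q
        using keys_column[OF G that, of x] by (auto simp: in_keys_iff)
      then show ?thesis by (simp add: lookup_sum lookup_cst_mult)
    next
      case True
      then obtain a where a: "a < ?r" "u = mon_enum m a" using mon_enum[of m] by (auto simp: bij_betw_def)
      have "0 = (colmat x m G *\<^sub>v v) $ a" using v a by simp
      also have "\<dots> = (\<Sum>q<?r. v $ q * Poly_Mapping.lookup (?c q) u)"
        using a v(1) by (simp add: scalar_prod_def colmat_def lessThan_atLeast0 mult.commute)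
      finally show ?thesis by (simp add: lookup_sum lookup_cst_mult)
    qed
  qed
  then have sum0: "(\<Sum>b\<in>?c ` {..<?r}. cst (v $ the_inv_into {..<?r} ?c b) * b) = 0"
    by (simp add: sum.reindex[OF inj] the_inv_into_f_f[OF inj])
  have "v $ q = 0" if "q < ?r" for q
  proof -
    have "v $ the_inv_into {..<?r} ?c (?c q) = 0"
      using cpv.independentD[OF indep finite_imageI[OF finite_lessThan] order_refl sum0 imageI] that
          by blast
    then show ?thesis using that by (simp add: the_inv_into_f_f[OF inj])
  qed
  then show False using v(1,2) by (auto simp: vec_eq_iff)
qed

text \<open>Steinitz exchange: the independent monomials are completed by row multiples to a basis
  of V_m, and an enumeration of the added elements gives \<open>G\<close>.\<close>

lemma select_columns:
  assumes m: "N \<le> m" and span: "\<And>f. filt V m f \<Longrightarrow>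
      \<exists>c. filt (row_gens x) m (f - (\<Sum>a<N. cst (c a) * last_mono a))"
  shows "\<exists>G. admissible m G \<and> det (colmat x m G) \<noteq> 0"
proof -
  let ?M = "(\<lambda>u. Poly_Mapping.single u (1::complex)) ` mons m" and ?r = "card (mons m)"
  let ?E = "last_mono ` {..<N} :: nat cpoly set"
  let ?S = "?E \<union> rowmult x ` rowmult_idx m"
  have M: "cpv.independent ?M" "finite ?M" "card ?M = ?r"
    using monomials_independent[OF finite_mons] finite_mons
        by (auto intro!: card_image inj_onI simp: single_eq_1_iff)
  have indE: "cpv.independent ?E"
    unfolding last_mono_def using monomials_independent[of
        "(\<lambda>a. Poly_Mapping.single 1 a + xmon (n - 1)) ` {..<N}"]
    by (simp add: image_image)
  obtain B where B: "?E \<subseteq> B" "B \<subseteq> ?S" "cpv.independent B" "?S \<subseteq> cpv.span B"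
    using cpv.maximal_independent_subset_extend[of ?E ?S] indE by blast
  have SM: "?S \<subseteq> cpv.span ?M"
  proof (rule Un_least; rule image_subsetI)
    show "last_mono a \<in> cpv.span ?M" if "a \<in> {..<N}" for a
      using keys_last_mono[of a m] that m by (simp add: span_monomials)
    show "rowmult x g \<in> cpv.span ?M" if "g \<in> rowmult_idx m" for g
      using keys_rowmult[OF that, of x] by (simp add: span_monomials)
  qed
  have MB: "?M \<subseteq> cpv.span B"
  proof
    fix f assume "f \<in> ?M"
    then obtain u where "u \<in> mons m" "f = Poly_Mapping.single u 1" by blast
    then have fV: "filt V m f" by (simp add: filt_V_iff)
    obtain c where c: "filt (row_gens x) m (f - (\<Sum>a<N. cst (c a) * last_mono a))" using span[OF fV] by blast
    have "f - (\<Sum>a<N. cst (c a) * last_mono a) \<in> cpv.span ?S"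
      using filt_row_gens_span[OF c] cpv.span_mono[of "rowmult x ` rowmult_idx m" ?S] by blast
    moreover have "(\<Sum>a<N. cst (c a) * last_mono a) \<in> cpv.span ?S"
      by (intro cpv.span_sum cpv.span_scale cpv.span_base) auto
    ultimately have "f - (\<Sum>a<N. cst (c a) * last_mono a) + (\<Sum>a<N. cst (c a) * last_mono a) \<in> cpv.span ?S"
      by (rule cpv.span_add)
    then have "f \<in> cpv.span ?S" by simp
    then show "f \<in> cpv.span B" using cpv.span_minimal[OF B(4) cpv.subspace_span] by blast
  qed
  have finB: "finite B" and "card B \<le> ?r"
    using cpv.independent_span_bound[OF M(2) B(3) order_trans[OF B(2) SM]] M(3) by auto
  moreover have "?r \<le> card B" using cpv.independent_span_bound[OF finB M(1) MB] M(3) by auto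
  ultimately have cB: "card B = ?r" by simp
  have cE: "card ?E = N" by (subst card_image) (auto intro: inj_onI last_mono_inj)
  then have Nr: "N \<le> ?r" using card_mono[OF finB B(1)] cB by simp
  have "card (B - ?E) = ?r - N" using B(1) finB cB cE by (simp add: card_Diff_subset)
  then obtain h where h: "bij_betw h {N..<?r} (B - ?E)"
    using finite_same_card_bij[of "{N..<?r}" "B - ?E"] finB by auto
  define G where "G q = (SOME g. g \<in> rowmult_idx m \<and> rowmult x g = h q)" for q
  have G: "G q \<in> rowmult_idx m \<and> rowmult x (G q) = h q" if "N \<le> q" "q < ?r" for q
  proof -
    have hq: "h q \<in> B - ?E" using bij_betwE[OF h] that by simp
    have "h q \<in> ?S" using B(2) hq by (rule subsetD[OF _ DiffD1])
    then have "h q \<in> rowmult x ` rowmult_idx m" using DiffD2[OF hq] by (elim UnE) (rule notE)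
    then have "\<exists>g. g \<in> rowmult_idx m \<and> rowmult x g = h q" by (metis imageE)
    then show ?thesis unfolding G_def by (rule someI_ex)
  qed
  have adm: "admissible m G" using m Nr G by (simp add: admissible_def)
  have col: "column x G q = (if q < N then last_mono q else h q)" if "q < ?r" for q
    using G[of q] that by (simp add: column_def)
  have split: "{..<?r} = {..<N} \<union> {N..<?r}" using Nr by auto
  have img: "column x G ` {..<?r} = B"
  proof -
    have "column x G ` {..<N} = ?E" using col Nr by (intro image_cong) auto
    moreover have "column x G ` {N..<?r} = h ` {N..<?r}" using col by (intro image_cong) auto
    ultimately show ?thesis using h B(1) unfolding split image_Un by (auto simp: bij_betw_def)
  qed
  have inj: "inj_on (column x G) {..<?r}" by (rule eq_card_imp_inj_on) (simp_all add: img cB)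
  have "det (colmat x m G) \<noteq> 0" by (rule det_colmat_nonzero[OF adm inj]) (simp add: img B(3))
  with adm show ?thesis by (intro exI[of _ G] conjI)
qed

lemma cst_cst: "cst a * (cst b * f) = cst (a * b) * (f :: nat cpoly)"
  by (simp only: cst_mult mult.assoc)

text \<open>The converse of \<open>select_columns\<close> for a given \<open>G\<close>: spanning
  follows from a nonvanishing determinant, which is the open condition used for generic
  families.\<close>

lemma span_of_det:
  assumes G: "admissible m G" and det: "det (colmat x m G) \<noteq> 0" and f: "filt V m f"
  shows "filt (row_gens x) m (f - (\<Sum>a<N. cst (cramer_coeff x m G f a / det (colmat x m G)) * last_mono a))"
proof -
  let ?D = "det (colmat x m G)"
  have "cst ?D * f = (\<Sum>q<card (mons m). cst (cramer_coeff x m G f q) * column x G q)"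
    using f by (intro cramer[OF G]) (simp add: filt_V_iff)
  also have "{..<card (mons m)} = {..<N} \<union> {N..<card (mons m)}" using G by (auto simp: admissible_def)
  also have "(\<Sum>q\<in>\<dots>. cst (cramer_coeff x m G f q) * column x G q)
      = (\<Sum>q<N. cst (cramer_coeff x m G f q) * last_mono q)
      + (\<Sum>q=N..<card (mons m). cst (cramer_coeff x m G f q) * rowmult x (G q))"
    by (subst sum.union_disjoint) (auto simp: column_def intro!: arg_cong2[where f = plus] sum.cong)
  finally have *: "cst ?D * f - (\<Sum>q<N. cst (cramer_coeff x m G f q) * last_mono q)
      = (\<Sum>q=N..<card (mons m). cst (cramer_coeff x m G f q) * rowmult x (G q))"
    by simp
  have "filt (row_gens x) m (cst (inverse ?D) * (\<Sum>q=N..<card (mons m). cst (cramer_coeff x m G f q)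
      * rowmult x (G q)))"
    using G by (intro filt.scale filt_sum filt_rowmult) (auto simp: admissible_def)
  also have "cst (inverse ?D) * (\<Sum>q=N..<card (mons m). cst (cramer_coeff x m G f q) * rowmult x (G q))
      = f - (\<Sum>a<N. cst (cramer_coeff x m G f a / ?D) * last_mono a)"
    unfolding *[symmetric] using det
    by (simp add: right_diff_distrib sum_distrib_left cst_cst divide_inverse_commute)
  finally show ?thesis .
qed

text \<open>Assumption \<open>E\<close> says that no row multiple has a component along the
  \<open>N\<close> monomials; hence the selected row multiples already span W_m.\<close>

lemma rowmult_span:
  assumes "admissible m G" "det (colmat x m G) \<noteq> 0"
    and E: "\<And>g a. g \<in> rowmult_idx m \<Longrightarrow> a < N \<Longrightarrow> cramer_coeff x m G (rowmult x g) a = 0"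
    and f: "filt (row_gens x) m f"
  shows "\<exists>w. f = (\<Sum>q=N..<card (mons m). cst (w q) * column x G q)"
proof -
  let ?D = "det (colmat x m G)" and ?r = "card (mons m)"
  let ?T = "{f. \<exists>w. f = (\<Sum>q=N..<?r. cst (w q) * column x G q)}"
  have "cpv.subspace ?T"
  proof (rule cpv.subspaceI)
    show "0 \<in> ?T" by (rule CollectI, rule exI[of _ "\<lambda>_. 0"]) simp
    fix f g assume "f \<in> ?T" "g \<in> ?T"
    then obtain w w' where "f = (\<Sum>q=N..<?r. cst (w q) * column x G q)" "g
        = (\<Sum>q=N..<?r. cst (w' q) * column x G q)" by blast
    then show "f + g \<in> ?T"
      by (intro CollectI exI[of _ "\<lambda>q. w q + w' q"]) (simp add: single_add distrib_right sum.distrib)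
  next
    fix c f assume "f \<in> ?T"
    then obtain w where "f = (\<Sum>q=N..<?r. cst (w q) * column x G q)" by blast
    then show "cst c * f \<in> ?T"
      by (intro CollectI exI[of _ "\<lambda>q. c * w q"]) (simp add: sum_distrib_left cst_cst)
  qed
  moreover have "rowmult x g \<in> ?T" if g: "g \<in> rowmult_idx m" for g
  proof -
    have "cst ?D * rowmult x g = (\<Sum>q<?r. cst (cramer_coeff x m G (rowmult x g) q) * column x G q)"
      by (intro cramer[OF assms(1)] keys_rowmult g)
    also have "{..<?r} = {..<N} \<union> {N..<?r}" using assms(1) by (auto simp: admissible_def)
    also have "(\<Sum>q\<in>\<dots>. cst (cramer_coeff x m G (rowmult x g) q) * column x G q)
        = (\<Sum>q=N..<?r. cst (cramer_coeff x m G (rowmult x g) q) * column x G q)"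
      by (rule sum.mono_neutral_right) (auto simp: E[OF g])
    finally have eq: "cst ?D * rowmult x g = (\<Sum>q=N..<?r. cst (cramer_coeff x m G (rowmult x g) q)
        * column x G q)" .
    have "rowmult x g = cst (inverse ?D) * (cst ?D * rowmult x g)" using assms(2) by (simp add: cst_cst)
    also have "\<dots> = (\<Sum>q=N..<?r. cst (inverse ?D * cramer_coeff x m G (rowmult x g) q) * column x G q)"
      unfolding eq by (simp add: sum_distrib_left cst_cst)
    finally show ?thesis by (intro CollectI exI[of _ "\<lambda>q. inverse ?D * cramer_coeff x m G (rowmult x g) q"])
  qed
  ultimately have "cpv.span (rowmult x ` rowmult_idx m) \<subseteq> ?T" by (intro cpv.span_minimal) auto
  then show ?thesis using filt_row_gens_span[OF f] by blast
qed

lemma colmat_kernel: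
  assumes "admissible m G" "det (colmat x m G) \<noteq> 0" "(\<Sum>q<card (mons m). cst (w q) * column x G q)
      = (0 :: nat cpoly)"
  shows "\<forall>q<card (mons m). w q = 0"
proof -
  let ?r = "card (mons m)"
  have "colmat x m G *\<^sub>v vec ?r w = 0\<^sub>v ?r"
  proof (rule eq_vecI)
    fix a assume "a < dim_vec (0\<^sub>v ?r :: complex vec)"
    then have a: "a < ?r" by simp
    have "(colmat x m G *\<^sub>v vec ?r w) $ a = (\<Sum>q<?r. w q
        * Poly_Mapping.lookup (column x G q) (mon_enum m a))"
      using a by (simp add: colmat_def scalar_prod_def lessThan_atLeast0 mult.commute)
    also have "\<dots> = Poly_Mapping.lookup (\<Sum>q<?r. cst (w q) * column x G q) (mon_enum m a)"
      by (simp add: lookup_sum lookup_cst_mult)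
    finally show "(colmat x m G *\<^sub>v vec ?r w) $ a = 0\<^sub>v ?r $ a" using a assms(3) by simp
  qed (simp add: colmat_def)
  then have "vec ?r w = 0\<^sub>v ?r"
    using assms(2) det_0_iff_vec_prod_zero_field[OF colmat_carrier] by (metis vec_carrier)
  then show ?thesis by (metis index_vec index_zero_vec(1))
qed

section \<open>The codimension does not drop\<close>

lemma map_colmat: "map_mat (\<lambda>p. poly p 1) (colmat (line_coeffs x) m G) = colmat x m G"
proof (rule eq_matI)
  fix a q assume "a < dim_row (colmat x m G)" "q < dim_col (colmat x m G)"
  then have aq: "a < card (mons m)" "q < card (mons m)" by (auto simp: colmat_def)
  have "poly (Poly_Mapping.lookup (column (line_coeffs x) G q) u) 1
      = Poly_Mapping.lookup (column x G q) u" for u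
    by (cases "G q") (auto simp: column_def last_mono_def lookup_single when_def lookup_rowmult poly_sum
        line_coeffs_def case_prod_unfold
        intro!: sum.cong)
  then show "map_mat (\<lambda>p. poly p 1) (colmat (line_coeffs x) m G) $$ (a, q) = colmat x m G $$ (a, q)"
    using aq by (simp add: colmat_def)
qed (auto simp: colmat_def)

lemma poly_hom_1: "comm_ring_hom (\<lambda>p :: complex poly. poly p 1)"
  by unfold_locales auto

lemma map_adj:
  assumes "A \<in> carrier_mat r r"
  shows "adj_mat (map_mat (\<lambda>p. poly p (1::complex)) A) = map_mat (\<lambda>p. poly p 1) (adj_mat A)"
proof (rule eq_matI)
  interpret comm_ring_hom "\<lambda>p :: complex poly. poly p 1" by (rule poly_hom_1)
  fix i j assume "i < dim_row (map_mat (\<lambda>p. poly p 1) (adj_mat A))"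
      "j < dim_col (map_mat (\<lambda>p. poly p 1) (adj_mat A))"
  then have ij: "i < r" "j < r" using adj_mat(1)[OF assms] by auto
  have "mat_delete (map_mat (\<lambda>p. poly p 1) A) j i = map_mat (\<lambda>p. poly p 1) (mat_delete A j i)"
    using ij assms by (intro eq_matI) (auto simp: mat_delete_def)
  then have "det (mat_delete (map_mat (\<lambda>p. poly p 1) A) j i) = poly (det (mat_delete A j i)) 1"
    using comm_ring_hom.hom_det[OF poly_hom_1] by metis
  then show "adj_mat (map_mat (\<lambda>p. poly p 1) A) $$ (i, j) = map_mat (\<lambda>p. poly p 1) (adj_mat A) $$ (i, j)"
    using ij assms by (simp add: adj_mat_def cofactor_def)
qed (auto simp: adj_mat_def)

text \<open>Adjugates commute with ring homomorphisms, here with the substitution t = 1, where the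
  line reaches \<open>x\<close>.\<close>

lemma cramer_coeff_at_1:
  assumes "q < card (mons m)"
  shows "poly (cramer_coeff (line_coeffs x) m G (rowmult (line_coeffs x) g) q) 1
      = cramer_coeff x m G (rowmult x g) q"
proof -
  have "poly (Poly_Mapping.lookup (rowmult (line_coeffs x) g) u) 1
      = Poly_Mapping.lookup (rowmult x g) u" for u
    by (cases g) (auto simp: lookup_rowmult poly_sum line_coeffs_def case_prod_unfold intro!: sum.cong)
  moreover have "poly (adj_mat (colmat (line_coeffs x) m G) $$ (q, a)) 1
      = adj_mat (colmat x m G) $$ (q, a)" if "a < card (mons m)" for a
    using assms that adj_mat(1)[OF colmat_carrier, of "line_coeffs x" m G]
    by (subst map_colmat[symmetric], subst map_adj[OF colmat_carrier]) simp
  ultimately show ?thesis by (simp add: cramer_coeff_def poly_sum)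
qed

text \<open>At a curve solving the rows modulo t^(r+1), Cramer's relation loses all row multiples,
  and the sum of \<open>y q * P 1 ^ q\<close> over q below \<open>N\<close> is left. If t^r divides
  every \<open>y q\<close>, the quotients at t = 0 form a polynomial that vanishes at all special
  first coordinates, so one more t divides. The determinant enters only as a factor, so it does no
  harm that \<open>G\<close>, selected at t = 1, may be singular at t = 0.\<close>

lemma cramer_coeff_t_zero:
  assumes G: "admissible m G" and g: "g \<in> rowmult_idx m" and a: "a < N"
  shows "cramer_coeff (line_coeffs x) m G (rowmult (line_coeffs x) g) a = 0"
proof -
  define y where "y = cramer_coeff (line_coeffs x) m G (rowmult (line_coeffs x) g)"
  have tev: "tt ^ Suc r dvd tev (rowmult (line_coeffs x) g') P"
    if "g' \<in> rowmult_idx m" and "\<forall>i<rows. tt ^ Suc r dvd tev (row (line_coeffs x) i) P" for g' r P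
    using that by (auto simp: rowmult_idx_def rowmult_def hom_eval_ident)
  have rel: "tt ^ Suc r dvd (\<Sum>q<N. y q * P 1 ^ q)"
    if P: "\<forall>i<rows. tt ^ Suc r dvd tev (row (line_coeffs x) i) P" "P (k + n) = 1" for r P
  proof -
    have Ncard: "{..<card (mons m)} = {..<N} \<union> {N..<card (mons m)}" using G by (auto simp: admissible_def)
    have "cst (det (colmat (line_coeffs x) m G)) * rowmult (line_coeffs x) g
        = (\<Sum>q<card (mons m). cst (y q) * column (line_coeffs x) G q)"
      unfolding y_def by (intro cramer[OF G] keys_rowmult g)
    then have "tev (cst (det (colmat (line_coeffs x) m G)) * rowmult (line_coeffs x) g) P
        = tev (\<Sum>q<card (mons m). cst (y q) * column (line_coeffs x) G q) P" by simp
    then have "det (colmat (line_coeffs x) m G) * tev (rowmult (line_coeffs x) g) P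
        = (\<Sum>q<card (mons m). y q * tev (column (line_coeffs x) G q) P)"
      by (simp add: hom_eval_ident)
    also have "\<dots> = (\<Sum>q<N. y q * tev (last_mono q) P)
        + (\<Sum>q=N..<card (mons m). y q * tev (rowmult (line_coeffs x) (G q)) P)"
      unfolding Ncard by (subst sum.union_disjoint) (auto simp: column_def intro!: arg_cong2[where f
          = plus] sum.cong)
    also have "(\<Sum>q<N. y q * tev (last_mono q) P) = (\<Sum>q<N. y q * P 1 ^ q)"
      using P(2) n by (simp add: last_mono_def hom_eval_ident mon_eval_add mon_eval_single xmon_def)
    finally have "(\<Sum>q<N. y q * P 1 ^ q) = det (colmat (line_coeffs x) m G)
        * tev (rowmult (line_coeffs x) g) P
        - (\<Sum>q=N..<card (mons m). y q * tev (rowmult (line_coeffs x) (G q)) P)" by simp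
    moreover have "tt ^ Suc r dvd \<dots>"
      using G by (intro dvd_diff dvd_mult dvd_sum tev[OF g P(1)] tev[OF _ P(1)]) (auto simp: admissible_def)
    ultimately show ?thesis by simp
  qed
  have "\<forall>q<N. tt ^ r dvd y q" for r
  proof (induction r)
    case (Suc r)
    then have "\<forall>q. \<exists>z. q < N \<longrightarrow> y q = tt ^ r * z" by (auto elim: dvdE)
    then obtain z where z: "\<And>q. q < N \<Longrightarrow> y q = tt ^ r * z q"
      using choice[of "\<lambda>q z. q < N \<longrightarrow> y q = tt ^ r * z"] by blast
    have "\<forall>q<N. poly (z q) 0 = 0"
    proof (rule power_sums_zero)
      fix S assume S: "S \<in> special_sols"
      obtain P where P: "\<forall>i<rows. tt ^ Suc r dvd tev (row (line_coeffs x) i) P" "\<forall>v. poly (P v) 0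
          = special_pt S v" "P (k + n) = 1"
        using hensel[OF S] by blast
      have "(\<Sum>q<N. y q * P 1 ^ q) = tt ^ r * (\<Sum>q<N. z q * P 1 ^ q)"
        by (simp add: z sum_distrib_left mult.assoc)
      then have "tt ^ r * tt dvd tt ^ r * (\<Sum>q<N. z q * P 1 ^ q)"
        using rel[OF P(1,3)] by (simp only: power_Suc2)
      then have "tt dvd (\<Sum>q<N. z q * P 1 ^ q)"
        by (simp only: dvd_mult_cancel_left) simp
      then have "(\<Sum>q<N. poly (z q) 0 * special_pt S 1 ^ q) = 0"
        using P(2) by (simp only: tt_dvd_iff poly_sum poly_mult poly_power)
      then show "(\<Sum>q<N. poly (z q) 0 * pt S 1 ^ q) = 0" using k by (simp add: special_pt_lam)
    qed
    then have "tt dvd z q" if "q < N" for q using that by (simp only: tt_dvd_iff)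
    then show ?case by (metis z mult_dvd_mono dvd_refl power_Suc2)
  qed simp
  \<comment> \<open>A power of t beyond its degree divides a polynomial only if the polynomial is
    zero.\<close>
  then have "tt ^ Suc (degree (y a)) dvd y a" using a by blast
  then have "y a = 0"
    using dvd_imp_degree_le[of "tt ^ Suc (degree (y a))" "y a"]
        by (auto simp: degree_power_eq simp del: power_Suc)
  then show ?thesis by (simp add: y_def)
qed

text \<open>The vanishing over C[t] is specialised to t = 1: W_m lies in the span of the selected
  row multiples, which together with the monomials form a basis of V_m.\<close>

theorem last_mono_independent:
  assumes m: "N \<le> m" and span: "\<And>f. filt V m f \<Longrightarrow>
      \<exists>c. filt (row_gens x) m (f - (\<Sum>a<N. cst (c a) * last_mono a))"
    and c: "filt (row_gens x) m (\<Sum>a<N. cst (c a) * last_mono a)"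
  shows "\<forall>a<N. c a = 0"
proof -
  let ?r = "card (mons m)"
  obtain G where G: "admissible m G" "det (colmat x m G) \<noteq> 0" using select_columns[OF m span] by blast
  have Nr: "N \<le> ?r" using G by (simp add: admissible_def)
  have "cramer_coeff x m G (rowmult x g) a = 0" if "g \<in> rowmult_idx m" "a < N" for g a
    using cramer_coeff_t_zero[OF G(1) that] cramer_coeff_at_1[of a m x G g] that Nr by simp
  then obtain w where w: "(\<Sum>a<N. cst (c a) * last_mono a) = (\<Sum>q=N..<?r. cst (w q) * column x G q)"
    using rowmult_span[OF G _ c] by blast
  define v where "v q = (if q < N then c q else - w q)" for q
  have "(\<Sum>q<?r. cst (v q) * column x G q) = 0"
  proof -
    have split: "{..<?r} = {..<N} \<union> {N..<?r}" using Nr by auto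
    have "(\<Sum>q<?r. cst (v q) * column x G q) = (\<Sum>q<N. cst (v q) * column x G q)
        + (\<Sum>q=N..<?r. cst (v q) * column x G q)"
      unfolding split by (rule sum.union_disjoint) auto
    also have "(\<Sum>q<N. cst (v q) * column x G q) = (\<Sum>a<N. cst (c a) * last_mono a)"
        by (simp add: v_def column_def)
    also have "(\<Sum>q=N..<?r. cst (v q) * column x G q) = - (\<Sum>q=N..<?r. cst (w q) * column x G q)"
      by (simp add: v_def single_uminus sum_negf)
    finally show ?thesis using w by simp
  qed
  note K = colmat_kernel[OF G this]
  show ?thesis
  proof (intro allI impI)
    fix a assume "a < N"
    then show "c a = 0" using K[rule_format, of a] Nr by (simp add: v_def)
  qed
qed

end

lemma pCons_0_power: "[:0, a:] ^ e = monom (a ^ e :: 'a::comm_ring_1) e"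
  by (induction e) (simp_all add: monom_Suc smult_monom)

context rect
begin

section \<open>The shape lemma\<close>

text \<open>\<open>last_poly g\<close> is the vector polynomial \<open>g(\<lambda>\<^sub>1) x\<^sub>n\<close>.\<close>

definition last_poly :: "complex poly \<Rightarrow> nat cpoly"
  where "last_poly g = (\<Sum>a\<le>degree g. cst (coeff g a) * last_mono a)"

lemma last_poly_bound: "degree g \<le> b \<Longrightarrow> last_poly g = (\<Sum>a\<le>b. cst (coeff g a) * last_mono a)"
  unfolding last_poly_def by (rule sum.mono_neutral_left) (auto simp: coeff_eq_0)

lemma last_poly_lessThan: "(\<And>a. b \<le> a \<Longrightarrow> coeff g a = 0) \<Longrightarrow>
    last_poly g = (\<Sum>a<b. cst (coeff g a) * last_mono a)"
proof -
  assume g: "\<And>a. b \<le> a \<Longrightarrow> coeff g a = 0"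
  have "last_poly g = (\<Sum>a\<le>degree g + b. cst (coeff g a) * last_mono a)" by (rule last_poly_bound) simp
  also have "\<dots> = (\<Sum>a<b. cst (coeff g a) * last_mono a)"
    by (rule sum.mono_neutral_right) (auto simp: g)
  finally show ?thesis .
qed

lemma last_poly_0: "last_poly 0 = 0"
  by (simp add: last_poly_def)

lemma last_poly_1: "last_poly 1 = X (n - 1)"
  by (simp add: last_poly_def last_mono_0)

lemma last_poly_add: "last_poly (g + h) = last_poly g + last_poly h"
proof -
  let ?b = "max (degree g) (degree h)"
  have "last_poly (g + h) = (\<Sum>a\<le>?b. cst (coeff (g + h) a) * last_mono a)"
      by (rule last_poly_bound) (rule degree_add_le_max)
  also have "\<dots> = (\<Sum>a\<le>?b. cst (coeff g a) * last_mono a) + (\<Sum>a\<le>?b. cst (coeff h a) * last_mono a)"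
    by (simp add: single_add distrib_right sum.distrib)
  finally show ?thesis by (simp add: last_poly_bound[of g ?b] last_poly_bound[of h ?b])
qed

lemma last_poly_smult: "last_poly (smult c g) = cst c * last_poly g"
proof -
  have "last_poly (smult c g) = (\<Sum>a\<le>degree g. cst (coeff (smult c g) a) * last_mono a)"
    by (rule last_poly_bound) (rule degree_smult_le)
  then show ?thesis by (simp add: last_poly_def sum_distrib_left cst_cst)
qed

lemma last_poly_diff: "last_poly (g - h) = last_poly g - last_poly h"
  using last_poly_add[of g "smult (-1) h"] last_poly_smult[of "-1" h] by (simp add: single_uminus)

lemma last_poly_pCons_0: "last_poly (pCons 0 g) = lam 1 * last_poly g"
proof -
  have "last_poly (pCons 0 g) = (\<Sum>a\<le>Suc (degree g). cst (coeff (pCons 0 g) a) * last_mono a)"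
    by (rule last_poly_bound) (rule degree_pCons_le)
  also have "\<dots> = (\<Sum>a\<le>degree g. cst (coeff g a) * last_mono (Suc a))"
    by (simp add: sum.atMost_Suc_shift del: sum.atMost_Suc)
  finally show ?thesis by (simp add: last_poly_def sum_distrib_left last_mono_Suc mult.left_commute)
qed

lemma last_poly_pCons: "last_poly (pCons c g) = cst c * X (n - 1) + lam 1 * last_poly g"
proof -
  have "pCons c g = smult c 1 + pCons 0 g" by simp
  then have "last_poly (pCons c g) = last_poly (smult c 1) + last_poly (pCons 0 g)"
      by (simp only: last_poly_add)
  then show ?thesis by (simp only: last_poly_smult last_poly_1 last_poly_pCons_0)
qed

lemma pev_last_poly: "pev (last_poly g) p = poly g (p 1) * p (k + n)"
proof -
  have "Suc (k + (n - Suc 0)) = k + n" using n by simp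
  then show ?thesis
    by (induction g) (auto simp: last_poly_0 last_poly_pCons hom_eval_ident algebra_simps hom_eval_X[OF
        comm_ring_hom_ident] hom_eval_lam[OF comm_ring_hom_ident])
qed

text \<open>Position 0 falls into the second case; its value is immaterial, as no row involves that
  variable.\<close>

definition join_pt :: "(nat \<Rightarrow> complex) \<Rightarrow> (nat \<Rightarrow> complex) \<Rightarrow> nat \<Rightarrow> complex"
  where "join_pt l v u = (if u \<in> {1..k} then l u else v (u - (k + 1)))"

lemma join_pt_X: "join_pt l v (k + 1 + j) = v j"
  and join_pt_lam: "i \<in> {1..k} \<Longrightarrow> join_pt l v i = l i"
  by (auto simp: join_pt_def)

definition eigen_pts :: "(multi_index \<times> nat \<times> nat \<Rightarrow> complex) \<Rightarrow> (nat \<Rightarrow> complex) set"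
  where "eigen_pts x = {l \<in> cspace {1..k}. \<exists>v. (\<exists>j<n. v j \<noteq> 0) \<and> (\<forall>i<rows. pev (row x i) (join_pt l v)
      = 0)}"

lemma filt_V_row: "filt V d (row x i)"
  unfolding filt_V_iff row_def mons_def
  by (intro order_trans[OF keys_sum]) (auto split: if_splits)

lemma one_in_k: "1 \<in> {1..k}"
  using k by simp

context
  fixes x :: "multi_index \<times> nat \<times> nat \<Rightarrow> complex" and M :: nat
  assumes NM: "N < M"
    and span: "\<And>f. filt V M f \<Longrightarrow> \<exists>c. filt (row_gens x) M (f - (\<Sum>a<N. cst (c a) * last_mono a))"
begin

text \<open>Spanning propagates upwards from degree \<open>M\<close>: a variable times a basis
  monomial has degree at most \<open>N\<close>, which is below \<open>M\<close>, so after each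
  multiplication the result can be reduced again at level \<open>M\<close>.\<close>

lemma span_all:
  assumes "filt V m f" "m \<le> M'" "M \<le> M'"
  shows "\<exists>c. filt (row_gens x) M' (f - (\<Sum>a<N. cst (c a) * last_mono a))"
  using assms
proof (induction arbitrary: M')
  case (zero m)
  show ?case by (rule exI[of _ "\<lambda>_. 0"]) (simp add: filt.zero)
next
  case (gen e g)
  then have "filt V M g" by (intro filt_genI[of e]) (auto simp: V_def)
  then show ?case using span gen.prems filt_le by blast
next
  case (add m f g)
  obtain c c' where *: "filt (row_gens x) M' (f - (\<Sum>a<N. cst (c a) * last_mono a))"
      "filt (row_gens x) M' (g - (\<Sum>a<N. cst (c' a) * last_mono a))"
    using add.IH(1)[OF add.prems] add.IH(2)[OF add.prems] by blast
  from filt.add[OF *] show ?case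
    by (intro exI[of _ "\<lambda>a. c a + c' a"]) (simp add: single_add distrib_right sum.distrib algebra_simps)
next
  case (scale m f b)
  obtain c where *: "filt (row_gens x) M' (f - (\<Sum>a<N. cst (c a) * last_mono a))"
    using scale.IH[OF scale.prems] by blast
  from filt.scale[OF *, of b] show ?case
    by (intro exI[of _ "\<lambda>a. b * c a"]) (simp add: right_diff_distrib sum_distrib_left cst_cst)
next
  case (Suc m f)
  then show ?case by simp
next
  case (var m f i)
  show ?case
  proof (cases "M' = M")
    case True
    have "filt V M (lam i * f)" using filt_le[OF filt.var[OF var.hyps]] var.prems True by simp
    then show ?thesis using span True by blast
  next
    case False
    then obtain M'' where M'': "M' = Suc M''" using var.prems by (cases M') auto
    obtain c where c: "filt (row_gens x) M'' (f - (\<Sum>a<N. cst (c a) * last_mono a))"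
      using var.IH[of M''] var.prems M'' False by auto
    let ?f = "\<Sum>a<N. cst (c a) * (lam i * last_mono a)"
    have "filt V M (lam i * last_mono a)" if "a < N" for a
    proof -
      have "filt V (Suc a) (lam i * last_mono a)" by (intro filt.var filt_last_mono order_refl var.hyps)
      then show ?thesis by (rule filt_le) (use that NM in simp)
    qed
    then have "filt V M ?f" by (intro filt_sum filt.scale) auto
    then obtain c' where "filt (row_gens x) M (?f - (\<Sum>a<N. cst (c' a) * last_mono a))" using span by blast
    then have 1: "filt (row_gens x) M' (?f - (\<Sum>a<N. cst (c' a) * last_mono a))" using var.prems
        by (elim filt_le) simp
    have 2: "filt (row_gens x) M' (lam i * (f - (\<Sum>a<N. cst (c a) * last_mono a)))"
      unfolding M'' by (rule filt.var[OF c var.hyps(2)])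
    have "lam i * (f - (\<Sum>a<N. cst (c a) * last_mono a)) = lam i * f - ?f"
      by (simp add: right_diff_distrib sum_distrib_left mult.left_commute)
    then have eq: "lam i * (f - (\<Sum>a<N. cst (c a) * last_mono a)) + (?f - (\<Sum>a<N. cst (c' a) * last_mono a))
        = lam i * f - (\<Sum>a<N. cst (c' a) * last_mono a)" by simp
    show ?thesis using filt.add[OF 2 1] unfolding eq by (intro exI[of _ c'])
  qed
qed

definition row_module :: "nat cpoly \<Rightarrow> bool" where "row_module f \<longleftrightarrow> (\<exists>m. filt (row_gens x) m f)"

lemma row_module_filt: "filt (row_gens x) m f \<Longrightarrow> row_module f"
  by (auto simp: row_module_def)

lemma row_module_0: "row_module 0"
  by (rule row_module_filt[OF filt.zero])

lemma row_module_add: "row_module f \<Longrightarrow> row_module g \<Longrightarrow> row_module (f + g)"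
proof -
  assume "row_module f" "row_module g"
  then obtain m m' where "filt (row_gens x) m f" "filt (row_gens x) m' g" by (auto simp: row_module_def)
  then have "filt (row_gens x) (max m m') (f + g)" by (intro filt.add) (auto elim: filt_le)
  then show ?thesis by (rule row_module_filt)
qed

lemma row_module_scale: "row_module f \<Longrightarrow> row_module (cst c * f)"
  unfolding row_module_def by (blast intro: filt.scale)

lemma row_module_lam: "row_module f \<Longrightarrow> i \<in> {1..k} \<Longrightarrow> row_module (lam i * f)"
  unfolding row_module_def by (blast intro: filt.var)

lemma row_module_diff: "row_module f \<Longrightarrow> row_module g \<Longrightarrow> row_module (f - g)"
  using row_module_add[of f "cst (-1) * g"] row_module_scale[of g "-1"] by (simp add: single_uminus)

text \<open>Membership in the module is witnessed at some degree; raising it to at least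
  \<open>M\<close> brings in \<open>span_all\<close> and with it
  \<open>last_mono_independent\<close>.\<close>

lemma row_module_last_mono: "row_module (\<Sum>a<N. cst (c a) * last_mono a) \<Longrightarrow> \<forall>a<N. c a = 0"
proof -
  assume "row_module (\<Sum>a<N. cst (c a) * last_mono a)"
  then obtain m where m: "filt (row_gens x) m (\<Sum>a<N. cst (c a) * last_mono a)"
      by (auto simp: row_module_def)
  let ?m = "max m M"
  have m': "filt (row_gens x) ?m (\<Sum>a<N. cst (c a) * last_mono a)" using m by (rule filt_le) simp
  show ?thesis
  proof (rule last_mono_independent[OF _ _ m'])
    show "N \<le> ?m" using NM by simp
    show "\<exists>c. filt (row_gens x) ?m (f - (\<Sum>a<N. cst (c a) * last_mono a))" if "filt V ?m f" for f
      using span_all[OF that] by simp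
  qed
qed

text \<open>By spanning, the last unknown generates the quotient by the row module over the
  polynomials in lambda_1; \<open>g\<close> represents the class of \<open>f\<close>.\<close>

definition reduces_to :: "nat cpoly \<Rightarrow> complex poly \<Rightarrow> bool"
    where "reduces_to f g \<longleftrightarrow> row_module (f - last_poly g)"

lemma reduces_to_ex: "filt V m f \<Longrightarrow> \<exists>c. reduces_to f (\<Sum>a<N. monom (c a) a)"
proof -
  assume "filt V m f"
  from span_all[OF this, of "max m M"] obtain c where c: "row_module (f - (\<Sum>a<N. cst (c a) * last_mono a))"
    by (auto simp: row_module_def)
  have co: "coeff (\<Sum>a<N. monom (c a) a) b = (if b < N then c b else 0)" for b
    by (simp add: coeff_sum)
  have "last_poly (\<Sum>a<N. monom (c a) a) = (\<Sum>a<N. cst (coeff (\<Sum>a<N. monom (c a) a) a) * last_mono a)"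
    by (rule last_poly_lessThan) (simp add: co)
  then have "last_poly (\<Sum>a<N. monom (c a) a) = (\<Sum>a<N. cst (c a) * last_mono a)" by (simp add: co)
  then show ?thesis using c by (intro exI[of _ c]) (simp add: reduces_to_def)
qed

context
  fixes \<chi> :: "complex poly" and c
  assumes \<chi>: "\<chi> = monom 1 N - (\<Sum>a<N. monom (c a) a)" and W\<chi>: "row_module (last_poly \<chi>)"
begin

lemma coeff_chi: "coeff \<chi> a = (if a = N then 1 else if a < N then - c a else 0)"
  by (simp add: \<chi> coeff_sum)

lemma degree_chi: "degree \<chi> = N"
proof (rule antisym)
  show "degree \<chi> \<le> N" by (rule degree_le) (simp add: coeff_chi)
  show "N \<le> degree \<chi>" by (rule le_degree) (simp add: coeff_chi)
qed

lemma chi_nonzero: "\<chi> \<noteq> 0"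
  using coeff_chi[of N] by auto

lemma row_module_mult_chi: "row_module (last_poly (h * \<chi>))"
proof (induction h)
  case (pCons a h)
  have "pCons a h * \<chi> = smult a \<chi> + pCons 0 (h * \<chi>)" by simp
  then show ?case
    by (simp only: last_poly_add last_poly_smult last_poly_pCons_0) (intro row_module_add
        row_module_scale row_module_lam W\<chi> pCons.IH one_in_k)
qed (simp add: last_poly_0 row_module_0)

text \<open>The remainder modulo \<open>\<chi>\<close> has degree below \<open>N\<close>, so
  independence makes it zero. Thus \<open>\<chi>\<close> generates the annihilator of the last
  unknown, and the quotient is C[T] modulo \<open>\<chi>\<close>.\<close>

lemma row_module_last_poly_dvd: "row_module (last_poly g) \<Longrightarrow> \<chi> dvd g"
proof -
  assume g: "row_module (last_poly g)"
  let ?r = "g mod \<chi>"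
  have r: "coeff ?r a = 0" if "N \<le> a" for a
  proof (cases "?r = 0")
    case False
    then have "degree ?r < N" using degree_mod_less[OF chi_nonzero, of g] by (simp add: degree_chi)
    then show ?thesis using that by (intro coeff_eq_0) simp
  qed simp
  have "last_poly ?r = last_poly g - last_poly (g div \<chi> * \<chi>)"
      by (simp add: minus_div_mult_eq_mod flip: last_poly_diff)
  then have "row_module (last_poly ?r)" using g row_module_mult_chi by (simp add: row_module_diff)
  moreover have "last_poly ?r = (\<Sum>a<N. cst (coeff ?r a) * last_mono a)"
      by (rule last_poly_lessThan) (rule r)
  ultimately have "\<forall>a<N. coeff ?r a = 0" by (intro row_module_last_mono) simp
  then have "?r = 0" using r by (intro poly_eqI) (metis coeff_0 not_le)
  then show ?thesis by (simp add: mod_eq_0_iff_dvd)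
qed

lemma reduces_to_unique: "reduces_to f g \<Longrightarrow> reduces_to f h \<Longrightarrow> poly \<chi> \<rho> = 0 \<Longrightarrow> poly g \<rho> = poly h \<rho>"
proof -
  assume *: "reduces_to f g" "reduces_to f h" "poly \<chi> \<rho> = 0"
  have "row_module ((f - last_poly h) - (f - last_poly g))" using *(1,2) unfolding reduces_to_def
      by (intro row_module_diff[of "f - last_poly h"])
  then have "row_module (last_poly (g - h))" by (simp add: last_poly_diff)
  then have "\<chi> dvd g - h" by (rule row_module_last_poly_dvd)
  then have "poly (g - h) \<rho> = 0" using *(3) by (elim dvdE) simp
  then show ?thesis by simp
qed

text \<open>On the quotient, multiplication by lambda_i is multiplication by this polynomial in
  lambda_1.\<close>

definition coord_poly :: "nat \<Rightarrow> complex poly"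
  where "coord_poly i = (SOME g. reduces_to (lam i * X (n - 1)) g)"

definition vec_poly :: "nat \<Rightarrow> complex poly"
  where "vec_poly j = (SOME g. reduces_to (X j) g)"

lemma filt_V_last: "filt V 0 (X (n - 1))"
  using n by (intro filt_VX) simp

lemma reduces_to_coord_poly: "i \<in> {1..k} \<Longrightarrow> reduces_to (lam i * X (n - 1)) (coord_poly i)"
  unfolding coord_poly_def by (rule someI_ex) (use reduces_to_ex[OF filt.var[OF filt_V_last, of i]] in
      \<open>auto\<close>)

lemma reduces_to_vec_poly: "j < n \<Longrightarrow> reduces_to (X j) (vec_poly j)"
  unfolding vec_poly_def by (rule someI_ex) (use reduces_to_ex[OF filt_VX, of j] in \<open>auto\<close>)

lemma row_module_lam_last_poly:
  assumes i: "i \<in> {1..k}"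
  shows "row_module (lam i * last_poly g - last_poly (coord_poly i * g))"
proof (induction g)
  case (pCons a g)
  have "coord_poly i * pCons a g = smult a (coord_poly i) + pCons 0 (coord_poly i * g)" by simp
  then have "last_poly (coord_poly i * pCons a g)
      = cst a * last_poly (coord_poly i) + lam 1 * last_poly (coord_poly i * g)"
    by (simp only: last_poly_add last_poly_smult last_poly_pCons_0)
  then have "lam i * last_poly (pCons a g) - last_poly (coord_poly i * pCons a g)
      = cst a * (lam i * X (n - 1) - last_poly (coord_poly i))
          + lam 1 * (lam i * last_poly g - last_poly (coord_poly i * g))"
    by (simp add: last_poly_pCons algebra_simps)
  also have "row_module \<dots>"
    using reduces_to_coord_poly[OF i] unfolding reduces_to_def
        by (intro row_module_add row_module_scale row_module_lam pCons.IH one_in_k)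
  finally show ?case .
qed (simp add: last_poly_0 row_module_0)

lemma reduces_to_lam: "reduces_to f g \<Longrightarrow> i \<in> {1..k} \<Longrightarrow> reduces_to (lam i * f) (coord_poly i * g)"
proof -
  assume *: "reduces_to f g" "i \<in> {1..k}"
  have "row_module (lam i * (f - last_poly g) + (lam i * last_poly g - last_poly (coord_poly i * g)))"
    using * unfolding reduces_to_def by (intro row_module_add row_module_lam row_module_lam_last_poly)
  then show ?thesis by (simp add: reduces_to_def right_diff_distrib)
qed

text \<open>A root of \<open>\<chi>\<close> is a character of C[T] modulo \<open>\<chi>\<close>; the
  point collects its values on the classes of the variables lambda_i and of the unknowns.\<close>

definition root_pt :: "complex \<Rightarrow> nat \<Rightarrow> complex"
  where "root_pt \<rho> = join_pt (\<lambda>i. poly (coord_poly i) \<rho>) (\<lambda>j. poly (vec_poly j) \<rho>)"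

lemma root_pt_lam: "i \<in> {1..k} \<Longrightarrow> root_pt \<rho> i = poly (coord_poly i) \<rho>"
  by (simp add: root_pt_def join_pt_def)

text \<open>A representative with the right value is built along the rules of \<open>filt\<close>;
  at a root of \<open>\<chi>\<close>, \<open>reduces_to_unique\<close> makes the choice of the
  representative irrelevant.\<close>

lemma reduces_to_root_pt: "filt V m f \<Longrightarrow> \<exists>g. reduces_to f g \<and> poly g \<rho> = pev f (root_pt \<rho>)"
proof (induction rule: filt.induct)
  case (zero m)
  show ?case by (intro exI[of _ 0]) (simp add: reduces_to_def last_poly_0 row_module_0)
next
  case (gen e g)
  then obtain j where "j < n" "g = X j" by (auto simp: V_def)
  then show ?case by (intro exI[of _ "vec_poly j"]) (simp add: reduces_to_vec_poly hom_eval_X[OF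
      comm_ring_hom_ident] root_pt_def join_pt_def)
next
  case (add m f f')
  then obtain g g' where *: "reduces_to f g" "poly g \<rho>
      = pev f (root_pt \<rho>)" "reduces_to f' g'" "poly g' \<rho> = pev f' (root_pt \<rho>)" by blast
  have "row_module ((f - last_poly g) + (f' - last_poly g'))" using * unfolding reduces_to_def
      by (intro row_module_add)
  then have "reduces_to (f + f') (g + g')" by (simp add: reduces_to_def last_poly_add algebra_simps)
  then show ?case using * by (intro exI[of _ "g + g'"]) (simp add: hom_eval_ident)
next
  case (scale m f b)
  then obtain g where *: "reduces_to f g" "poly g \<rho> = pev f (root_pt \<rho>)" by blast
  have "row_module (cst b * (f - last_poly g))" using * unfolding reduces_to_def by (intro row_module_scale)
  then have "reduces_to (cst b * f) (smult b g)"
      by (simp add: reduces_to_def last_poly_smult right_diff_distrib)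
  then show ?case using * by (intro exI[of _ "smult b g"]) (simp add: hom_eval_ident)
next
  case (var m f i)
  then obtain g where *: "reduces_to f g" "poly g \<rho> = pev f (root_pt \<rho>)" by blast
  then show ?case using reduces_to_lam[OF *(1) var.hyps(2)] var.hyps(2)
    by (intro exI[of _ "coord_poly i * g"]) (simp add: hom_eval_ident hom_eval_lam[OF
        comm_ring_hom_ident] root_pt_lam del: atLeastAtMost_iff)
qed auto

lemma pev_root_pt: "filt V m f \<Longrightarrow> reduces_to f g \<Longrightarrow> poly \<chi> \<rho> = 0 \<Longrightarrow> pev f (root_pt \<rho>) = poly g \<rho>"
  using reduces_to_root_pt[of m f \<rho>] reduces_to_unique[of f] by metis

lemma root_pt_zero:
  assumes "poly \<chi> \<rho> = 0"
  shows "\<And>i. i < rows \<Longrightarrow> pev (row x i) (root_pt \<rho>) = 0" "root_pt \<rho> (k + n) = 1" "root_pt \<rho> 1 = \<rho>"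
proof -
  fix i assume "i < rows"
  then have "row_module (row x i)" by (intro row_module_filt[of d] filt.gen) (auto simp: row_gens_def)
  then have "reduces_to (row x i) 0" by (simp add: reduces_to_def last_poly_0)
  then show "pev (row x i) (root_pt \<rho>) = 0" using pev_root_pt[OF filt_V_row _ assms] by simp
next
  have "reduces_to (X (n - 1)) 1" by (simp add: reduces_to_def last_poly_1 row_module_0)
  from pev_root_pt[OF filt_V_last this assms] show 1: "root_pt \<rho> (k + n) = 1"
    using n by (simp add: hom_eval_X[OF comm_ring_hom_ident])
  have "reduces_to (lam 1 * X (n - 1)) (pCons 0 1)"
    unfolding reduces_to_def last_poly_pCons_0 last_poly_1 by (simp add: row_module_0)
  from pev_root_pt[OF filt.var[OF filt_V_last one_in_k] this assms] 1 show "root_pt \<rho> 1 = \<rho>"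
    using n by (simp add: hom_eval_ident hom_eval_X[OF comm_ring_hom_ident] hom_eval_lam[OF
        comm_ring_hom_ident])
qed

context
  fixes p :: "nat \<Rightarrow> complex"
  assumes p: "\<And>i. i < rows \<Longrightarrow> pev (row x i) p = 0" and nz: "\<exists>j<n. p (k + 1 + j) \<noteq> 0"
begin

lemma pev_row_module: "row_module f \<Longrightarrow> pev f p = 0"
  unfolding row_module_def by (elim exE, erule pev_filt) (auto simp: row_gens_def p)

lemma pev_reduces_to: "reduces_to f g \<Longrightarrow> pev f p = poly g (p 1) * p (k + n)"
proof -
  assume "reduces_to f g"
  then have "pev (f - last_poly g) p = 0" unfolding reduces_to_def by (rule pev_row_module)
  then show ?thesis by (simp only: hom_eval_ident pev_last_poly right_minus_eq)
qed

text \<open>Each unknown is congruent to a polynomial in lambda_1 times the last one, so a solution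
  whose last entry is 0 would have the zero vector.\<close>

lemma last_nonzero: "p (k + n) \<noteq> 0"
proof
  assume 0: "p (k + n) = 0"
  obtain j where j: "j < n" "p (k + 1 + j) \<noteq> 0" using nz by blast
  have "pev (X j) p = 0" using pev_reduces_to[OF reduces_to_vec_poly[OF j(1)]] 0 by simp
  then show False using j by (simp add: hom_eval_X[OF comm_ring_hom_ident])
qed

lemma chi_root: "poly \<chi> (p 1) = 0"
  using pev_row_module[OF W\<chi>] last_nonzero by (simp add: pev_last_poly)

lemma coordinate: "i \<in> {1..k} \<Longrightarrow> p i = poly (coord_poly i) (p 1)"
  using pev_reduces_to[OF reduces_to_coord_poly, of i] last_nonzero n
  by (simp add: hom_eval_ident hom_eval_X[OF comm_ring_hom_ident] hom_eval_lam[OF comm_ring_hom_ident])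

end

text \<open>The other coordinates of an eigenvalue are the values of \<open>coord_poly\<close> at
  the first one, which is a root of \<open>\<chi>\<close>; conversely \<open>root_pt\<close>
  supplies an eigenvalue over each root.\<close>

lemma bij_eigen_pts: "bij_betw (\<lambda>l. l 1) (eigen_pts x) {\<rho>. poly \<chi> \<rho> = 0}"
  unfolding bij_betw_def
proof (intro conjI equalityI subsetI)
  have Z: "poly \<chi> (l 1) = 0 \<and> (\<forall>i\<in>{1..k}. l i = poly (coord_poly i) (l 1))" if lZ: "l \<in> eigen_pts x" for l
  proof -
    obtain v where v: "\<exists>j<n. v j \<noteq> 0" "\<And>i. i < rows \<Longrightarrow> pev (row x i) (join_pt l v) = 0"
      using lZ by (auto simp: eigen_pts_def)
    have nz: "\<exists>j<n. join_pt l v (k + 1 + j) \<noteq> 0" using v(1) by (simp only: join_pt_X)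
    have l1: "join_pt l v 1 = l 1" by (rule join_pt_lam[OF one_in_k])
    have "poly \<chi> (l 1) = 0" using chi_root[OF v(2) nz] unfolding l1 .
    moreover have "l i = poly (coord_poly i) (l 1)" if "i \<in> {1..k}" for i
      using coordinate[OF v(2) nz that] unfolding l1 join_pt_lam[OF that] .
    ultimately show ?thesis by blast
  qed
  show "inj_on (\<lambda>l. l 1) (eigen_pts x)"
  proof (rule inj_onI)
    fix l l' assume l: "l \<in> eigen_pts x" "l' \<in> eigen_pts x" "l 1 = l' 1"
    have "l \<in> {1..k} \<rightarrow>\<^sub>E UNIV" "l' \<in> {1..k} \<rightarrow>\<^sub>E UNIV" using l by (auto simp: eigen_pts_def cspace_def)
    moreover have "l i = l' i" if "i \<in> {1..k}" for i
      using conjunct2[OF Z[OF l(1)], rule_format, OF that] conjunct2[OF Z[OF l(2)], rule_format, OF that]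
      unfolding l(3) by (rule trans[OF _ sym])
    ultimately show "l = l'" by (intro PiE_ext)
  qed
  show "\<rho> \<in> {\<rho>. poly \<chi> \<rho> = 0}" if "\<rho> \<in> (\<lambda>l. l 1) ` eigen_pts x" for \<rho>
    using that Z by blast
  fix \<rho> assume "\<rho> \<in> {\<rho>. poly \<chi> \<rho> = 0}"
  then have \<rho>: "poly \<chi> \<rho> = 0" by simp
  let ?l = "restrict (\<lambda>i. poly (coord_poly i) \<rho>) {1..k}" and ?v = "\<lambda>j. poly (vec_poly j) \<rho>"
  have eq: "join_pt ?l ?v = root_pt \<rho>" by (rule ext) (simp add: root_pt_def join_pt_def)
  have "?v (n - 1) = 1" using root_pt_zero(2)[OF \<rho>] n by (simp add: root_pt_def join_pt_def)
  then have "\<exists>j<n. ?v j \<noteq> 0" using n by (intro exI[of _ "n - 1"]) simp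
  moreover have "\<forall>i<rows. pev (row x i) (join_pt ?l ?v) = 0" unfolding eq using root_pt_zero(1)[OF \<rho>]
      by blast
  moreover have "?l \<in> cspace {1..k}" by (simp add: cspace_def)
  ultimately have "?l \<in> eigen_pts x" unfolding eigen_pts_def by (intro CollectI conjI exI[of _ ?v])
  moreover have "?l 1 = \<rho>" using root_pt_zero(3)[OF \<rho>] one_in_k by (simp add: root_pt_def join_pt_def)
  ultimately show "\<rho> \<in> (\<lambda>l. l 1) ` eigen_pts x" by (intro image_eqI[of _ _ ?l]) simp_all
qed

end

text \<open>Substitute lambda = t p and the vector v. Elements of V_m acquire degree at most m in t,
  and those of W_m lose the coefficient at t^m because the top forms of the rows vanish at (p, v).
  The basis monomials stay below degree \<open>M\<close>, so all of V_M would lose the coefficient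
  at t^M; the product of lambda_i^M with the unknown \<open>X j\<close>, for nonzero p_i and v_j,
  contradicts this.\<close>

lemma no_solution_at_infinity:
  assumes p: "\<exists>i\<in>{1..k}. p i \<noteq> 0" and v: "\<exists>j<n. v j \<noteq> 0"
    and 0: "\<And>i. i < rows \<Longrightarrow>
      (\<Sum>(\<omega>, j)\<in>multi_indices k d \<times> {..<n}.
          if mi_size k \<omega> = d then x (\<omega>, i, j) * mi_power k p \<omega> * v j else 0) = 0"
  shows False
proof -
  define P where "P u = (if u \<in> {1..k} then [:0, p u:] else [:v (u - (k + 1)):])" for u
  have Plam: "lev (lam i) P = [:0, p i:]" if "i \<in> {1..k}" for i
    using that by (simp add: hom_eval_lam[OF comm_ring_hom_pCons] P_def)
  have PX: "lev (X j) P = [:v j:]" for j by (simp add: hom_eval_X[OF comm_ring_hom_pCons] P_def)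
  have Pm: "mon_eval P (\<omega> + xmon j) = monom (mi_power k p \<omega> * v j) (mi_size k \<omega>)"
      if "\<omega> \<in> multi_indices k d" for \<omega> j
  proof -
    have "mon_eval P \<omega> = (\<Prod>u=1..k. P u ^ Poly_Mapping.lookup \<omega> u)"
      using that by (intro mon_eval_superset) (auto simp: multi_indices_def)
    also have "\<dots> = (\<Prod>u=1..k. monom (p u ^ Poly_Mapping.lookup \<omega> u) (Poly_Mapping.lookup \<omega> u))"
      by (intro prod.cong refl) (simp add: P_def pCons_0_power)
    also have "\<dots> = monom (mi_power k p \<omega>) (mi_size k \<omega>)"
    proof -
      have "(\<Prod>u\<in>A. monom (a u) (b u)) = monom (\<Prod>u\<in>A. a u) (\<Sum>u\<in>A. b u)"
        for A :: "nat set" and a :: "nat \<Rightarrow> complex" and b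
        by (induction A rule: infinite_finite_induct) (auto simp: mult_monom)
      then show ?thesis by (simp add: mi_power_def mi_size_def)
    qed
    finally show ?thesis by (simp add: mon_eval_add xmon_def mon_eval_single P_def smult_monom mult.commute)
  qed
  have deg1: "degree [:0, p i:] \<le> 1" for i by simp
  have V: "degree (lev f P) \<le> m" if "filt V m f" for m f
    using that
  proof induction
    case (gen e g)
    then show ?case by (auto simp: V_def PX)
  next
    case (add m f g)
    then show ?case by (simp add: hom_eval_pCons degree_add_le)
  next
    case (scale m f c)
    then show ?case using degree_smult_le[of c "lev f P"] by (simp add: hom_eval_pCons)
  next
    case (var m f i)
    have "degree (lev (lam i * f) P) \<le> degree [:0, p i:] + degree (lev f P)"
      unfolding hom_eval_pCons Plam[OF var.hyps(2)] by (rule degree_mult_le)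
    also have "\<dots> \<le> Suc m" using var.IH deg1[of i] by linarith
    finally show ?case .
  qed (auto simp: hom_eval_def)
  have W: "degree (lev f P) \<le> m \<and> coeff (lev f P) m = 0" if "filt (row_gens x) m f" for m f
    using that
  proof induction
    case (gen e g)
    then obtain i where i: "i < rows" "e = d" "g = row x i" by (auto simp: row_gens_def)
    have "lev g P = (\<Sum>(\<omega>, j)\<in>multi_indices k d \<times> {..<n}. monom (x (\<omega>, i, j) * mi_power k p \<omega>
        * v j) (mi_size k \<omega>))"
      unfolding i(3) hom_eval_row[OF comm_ring_hom_pCons]
          by (intro sum.cong) (auto simp: Pm smult_monom mult.assoc)
    then have "coeff (lev g P) e = 0"
      using 0[OF i(1)] by (simp add: i(2) coeff_sum case_prod_unfold)
    then show ?case using V[OF filt_V_row, of x i] i by simp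
  next
    case (add m f g)
    then show ?case by (simp add: hom_eval_pCons degree_add_le)
  next
    case (scale m f c)
    then show ?case using degree_smult_le[of c "lev f P"] by (simp add: hom_eval_pCons)
  next
    case (Suc m f)
    then show ?case by (simp add: coeff_eq_0)
  next
    case (var m f i)
    have "degree (lev (lam i * f) P) \<le> degree [:0, p i:] + degree (lev f P)"
      unfolding hom_eval_pCons Plam[OF var.hyps(2)] by (rule degree_mult_le)
    also have "\<dots> \<le> Suc m" using var.IH deg1[of i] by linarith
    finally have "degree (lev (lam i * f) P) \<le> Suc m" .
    moreover have "coeff (lev (lam i * f) P) (Suc m) = 0"
      unfolding hom_eval_pCons Plam[OF var.hyps(2)] using var.IH by simp
    ultimately show ?case by blast
  qed (auto simp: hom_eval_def)
  have VM: "coeff (lev f P) M = 0" if "filt V M f" for f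
  proof -
    obtain c where c: "filt (row_gens x) M (f - (\<Sum>a<N. cst (c a) * last_mono a))"
        using span[OF \<open>filt V M f\<close>] by blast
    have "coeff (lev (last_mono a) P) M = 0" if "a < N" for a
      using V[OF filt_last_mono[of a a]] that NM by (intro coeff_eq_0) simp
    then have "coeff (lev (\<Sum>a<N. cst (c a) * last_mono a) P) M = 0" by (simp add: hom_eval_pCons coeff_sum)
    then show ?thesis using W[OF c] by (simp add: hom_eval_pCons)
  qed
  obtain i j where ij: "i \<in> {1..k}" "p i \<noteq> 0" "j < n" "v j \<noteq> 0" using p v by blast
  have "filt V r (lam i ^ r * X j)" for r
    by (induction r) (use ij in \<open>auto simp: mult.assoc intro: filt_VX filt.var simp del: atLeastAtMost_iff\<close>)
  from VM[OF this[of M]] have "coeff ([:0, p i:] ^ M * [:v j:]) M = 0"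
    by (simp only: hom_eval_pCons comm_ring_hom.hom_eval_power[OF comm_ring_hom_pCons] Plam[OF ij(1)] PX)
  then show False using ij by (simp add: pCons_0_power smult_monom)
qed

end

end

section \<open>Rank and kernel\<close>

text \<open>Linear dependence refers to the set of columns, so repeated columns are treated apart:
  they lower the rank, and a difference of two unit vectors lies in the kernel.\<close>

lemma mrank_less_iff:
  assumes M: "M \<in> carrier_mat nr nc"
  shows "mrank M < nc \<longleftrightarrow> (\<exists>v\<in>carrier_vec nc. v \<noteq> 0\<^sub>v nc \<and> M *\<^sub>v v = 0\<^sub>v nr)"
proof -
  interpret vec_space "TYPE(complex)" nr .
  have r: "mrank M = rank M" using M by (simp add: mrank_def)
  show ?thesis
  proof (cases "distinct (cols M)")
    case True
    have "rank M < nc \<longleftrightarrow> lin_dep (set (cols M))"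
      using lin_indpt_full_rank[OF M True] full_rank_lin_indpt[OF M _ True] rank_le_nc[OF M] by force
    also have "\<dots> \<longleftrightarrow> (\<exists>v\<in>carrier_vec nc. v \<noteq> 0\<^sub>v nc \<and> M *\<^sub>v v = 0\<^sub>v nr)"
      using lin_depI[OF M _ _ _ True] lin_depE[OF M _ True] by metis
    finally show ?thesis using r by simp
  next
    case False
    obtain i j where ij: "i \<noteq> j" "i < nc" "j < nc" "col M i = col M j"
      using False M by (auto simp: distinct_conv_nth)
    obtain S where S: "maximal S (\<lambda>T. T \<subseteq> set (cols M) \<and> lin_indpt T)"
      using maximal_exists_superset[of "set (cols M)" "\<lambda>T. T \<subseteq> set (cols M) \<and> lin_indpt T" "{}"]
      by (auto simp: lin_dep_def)
    have "rank M = card S" by (rule rank_card_indpt[OF M S])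
    also have "\<dots> \<le> card (set (cols M))" using S by (intro card_mono) (auto simp: maximal_def)
    also have "\<dots> < length (cols M)"
      using False card_distinct[of "cols M"] card_length[of "cols M"] by linarith
    finally have "rank M < nc" using M by simp
    moreover have "\<exists>v\<in>carrier_vec nc. v \<noteq> 0\<^sub>v nc \<and> M *\<^sub>v v = 0\<^sub>v nr"
    proof (intro bexI conjI)
      let ?v = "unit_vec nc i - unit_vec nc j :: complex vec"
      show "?v \<in> carrier_vec nc" by simp
      have "?v $ i \<noteq> 0\<^sub>v nc $ i" using ij by simp
      then show "?v \<noteq> 0\<^sub>v nc" by metis
      have "M *\<^sub>v ?v = M *\<^sub>v unit_vec nc i - M *\<^sub>v unit_vec nc j"
        by (rule mult_minus_distrib_mat_vec[OF M]) auto
      also have "\<dots> = 0\<^sub>v nr" 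
      proof (rule eq_vecI)
        fix r assume "r < dim_vec (0\<^sub>v nr :: complex vec)"
        then have r: "r < nr" by simp
        have "col M i $ r = col M j $ r" by (simp only: ij(4))
        then have "M $$ (r, i) = M $$ (r, j)" using r ij(2,3) M by simp
        then show "(M *\<^sub>v unit_vec nc i - M *\<^sub>v unit_vec nc j) $ r = 0\<^sub>v nr $ r"
          using r ij M by simp
      qed (use M in simp)
      finally show "M *\<^sub>v ?v = 0\<^sub>v nr" .
    qed
    ultimately show ?thesis using r by simp
  qed
qed

lemma mrank_less_iff_fun:
  "mrank (mat nr nc (\<lambda>(i, j). f i j)) < nc \<longleftrightarrow>
    (\<exists>v. (\<exists>j<nc. v j \<noteq> 0) \<and> (\<forall>i<nr. (\<Sum>j<nc. f i j * v j) = 0))"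
proof -
  let ?M = "mat nr nc (\<lambda>(i, j). f i j)"
  have mult: "(?M *\<^sub>v vec nc v) $ i = (\<Sum>j<nc. f i j * v j)" if "i < nr" for i v
    using that by (simp add: scalar_prod_def lessThan_atLeast0)
  show ?thesis unfolding mrank_less_iff[of ?M nr nc, OF mat_carrier]
  proof
    assume "\<exists>v\<in>carrier_vec nc. v \<noteq> 0\<^sub>v nc \<and> ?M *\<^sub>v v = 0\<^sub>v nr"
    then obtain v where v: "v \<in> carrier_vec nc" "v \<noteq> 0\<^sub>v nc" "?M *\<^sub>v v = 0\<^sub>v nr" by blast
    have e: "vec nc (\<lambda>j. v $ j) = v" using v(1) by auto
    have "\<exists>j<nc. v $ j \<noteq> 0"
    proof (rule ccontr)
      assume "\<not> ?thesis"
      then have "v = 0\<^sub>v nc" using v(1) by (intro eq_vecI) auto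
      then show False using v(2) by blast
    qed
    moreover have "\<forall>i<nr. (\<Sum>j<nc. f i j * v $ j) = 0"
      using mult[of _ "\<lambda>j. v $ j"] v(3) unfolding e by auto
    ultimately show "\<exists>v. (\<exists>j<nc. v j \<noteq> 0) \<and> (\<forall>i<nr. (\<Sum>j<nc. f i j * v j) = 0)" by blast
  next
    assume "\<exists>v. (\<exists>j<nc. v j \<noteq> 0) \<and> (\<forall>i<nr. (\<Sum>j<nc. f i j * v j) = 0)"
    then obtain v where v: "\<exists>j<nc. v j \<noteq> 0" "\<And>i. i < nr \<Longrightarrow> (\<Sum>j<nc. f i j * v j) = 0" by blast
    have "?M *\<^sub>v vec nc v = 0\<^sub>v nr" by (rule eq_vecI) (use mult v(2) in auto)
    moreover have "vec nc v \<noteq> 0\<^sub>v nc" using v(1) by (metis index_vec index_zero_vec(1))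
    ultimately show "\<exists>v\<in>carrier_vec nc. v \<noteq> 0\<^sub>v nc \<and> ?M *\<^sub>v v = 0\<^sub>v nr"
        by (intro bexI[of _ "vec nc v"]) auto
  qed
qed

context rect
begin

section \<open>Eigenvalues of the polynomial problem\<close>

lemma pev_row_join_pt:
  "pev (row x i) (join_pt l v) = (\<Sum>j<n. (\<Sum>\<omega>\<in>multi_indices k d. mi_power k l \<omega> * x (\<omega>, i, j)) * v j)"
proof -
  have "mon_eval (join_pt l v) (\<omega> + xmon j) = mi_power k l \<omega> * v j" if "\<omega> \<in> multi_indices k d" for \<omega> j
  proof -
    have "mon_eval (join_pt l v) \<omega> = (\<Prod>u=1..k. join_pt l v u ^ Poly_Mapping.lookup \<omega> u)"
      using that by (intro mon_eval_superset) (auto simp: multi_indices_def)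
    also have "\<dots> = mi_power k l \<omega>" unfolding mi_power_def by (intro prod.cong refl) (simp add: join_pt_def)
    finally show ?thesis using join_pt_X[of l v j] by (simp add: mon_eval_add xmon_def mon_eval_single)
  qed
  then have "pev (row x i) (join_pt l v) = (\<Sum>(\<omega>, j)\<in>multi_indices k d \<times> {..<n}. x (\<omega>, i, j)
      * (mi_power k l \<omega> * v j))"
    unfolding hom_eval_row[OF comm_ring_hom_ident] by (intro sum.cong) auto
  also have "\<dots> = (\<Sum>j<n. \<Sum>\<omega>\<in>multi_indices k d. x (\<omega>, i, j) * (mi_power k l \<omega> * v j))"
    by (simp add: sum.cartesian_product[symmetric] sum.swap[of _ "multi_indices k d"])
  also have "\<dots> = (\<Sum>j<n. (\<Sum>\<omega>\<in>multi_indices k d. mi_power k l \<omega> * x (\<omega>, i, j)) * v j)"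
    unfolding sum_distrib_right by (intro sum.cong refl) (simp add: mult_ac)
  finally show ?thesis .
qed

lemma entries_index: "\<omega> \<in> multi_indices k d \<Longrightarrow> i < rows \<Longrightarrow> j < n \<Longrightarrow> entries n k d A (\<omega>, i, j) = A \<omega> $$ (i, j)"
  by (simp add: entries_def entry_indices_def)

lemma pencil_kernel:
  "mrank (pencil n k d A l) < n \<longleftrightarrow>
    (\<exists>v. (\<exists>j<n. v j \<noteq> 0) \<and> (\<forall>i<rows. pev (row (entries n k d A) i) (join_pt l v) = 0))"
  unfolding pencil_def mrank_less_iff_fun pev_row_join_pt by (simp add: entries_index)

lemma finite_eigenvalues_eigen_pts: "finite_eigenvalues n k d A = eigen_pts (entries n k d A)"
  unfolding finite_eigenvalues_def eigen_pts_def pencil_kernel ..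

definition hom_pt :: "(nat \<Rightarrow> complex) \<Rightarrow> nat \<Rightarrow> complex"
  where "hom_pt l = (\<lambda>i\<in>{0..k}. if i = 0 then 1 else l i)"

lemma hom_pencil_scale:
  assumes "y 0 = c" "\<And>i. i \<in> {1..k} \<Longrightarrow> y i = c * l i"
  shows "hom_pencil n k d A y = mat rows n (\<lambda>(i, j). c ^ d * (\<Sum>\<omega>\<in>multi_indices k d. mi_power k l \<omega>
      * A \<omega> $$ (i, j)))"
proof -
  have "y 0 ^ (d - mi_size k \<omega>) * mi_power k y \<omega> = c ^ d * mi_power k l \<omega>" if "\<omega> \<in> multi_indices k d" for \<omega>
  proof -
    have "mi_power k y \<omega> = (\<Prod>i=1..k. c ^ Poly_Mapping.lookup \<omega> i * l i ^ Poly_Mapping.lookup \<omega> i)"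
      unfolding mi_power_def by (intro prod.cong refl) (simp add: assms(2) power_mult_distrib)
    also have "\<dots> = c ^ mi_size k \<omega> * mi_power k l \<omega>"
      by (simp add: prod.distrib mi_power_def mi_size_def power_sum)
    finally show ?thesis using that assms(1) by (simp add: multi_indices_def flip: power_add mult.assoc)
  qed
  then show ?thesis unfolding hom_pencil_def
    by (intro eq_matI) (auto simp: sum_distrib_left mult.assoc intro!: sum.cong)
qed

text \<open>Away from infinity the homogenization is the pencil at the normalised point times the
  nonzero factor c^d, which does not affect kernels.\<close>

lemma mrank_hom_pencil:
  assumes "y 0 = c" "c \<noteq> 0" "\<And>i. i \<in> {1..k} \<Longrightarrow> y i = c * l i"
  shows "mrank (hom_pencil n k d A y) < n \<longleftrightarrow> mrank (pencil n k d A l) < n"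
proof -
  have scale: "hom_pencil n k d A y =
      mat rows n (\<lambda>(i, j). c ^ d * (\<Sum>\<omega>\<in>multi_indices k d. mi_power k l \<omega> * A \<omega> $$ (i, j)))"
    using assms(1,3) by (rule hom_pencil_scale)
  have "(\<Sum>j<n. c ^ d * a j * v j) = 0 \<longleftrightarrow> (\<Sum>j<n. a j * v j) = 0" for a v :: "nat \<Rightarrow> complex"
    using assms(2) by (simp add: mult.assoc flip: sum_distrib_left)
  then show ?thesis
    unfolding scale pencil_def mrank_less_iff_fun by simp
qed

lemma hom_pt_nonzero: "hom_pt l \<in> nonzero_points k"
  by (auto simp: nonzero_points_def hom_pt_def cspace_def intro!: bexI[of _ 0])

lemma proj_eigenvalues_finite:
  assumes inf: "\<And>y. y \<in> nonzero_points k \<Longrightarrow> mrank (hom_pencil n k d A y) < n \<Longrightarrow> y 0 \<noteq> 0"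
  shows "card (proj_eigenvalues n k d A) = card (finite_eigenvalues n k d A)"
    and "\<forall>p\<in>proj_eigenvalues n k d A. \<forall>y\<in>p. y 0 \<noteq> 0"
proof -
  let ?F = "\<lambda>l. proj_rel k `` {hom_pt l}"
  have same: "y \<in> nonzero_points k" "y0 \<in> nonzero_points k" "\<exists>c. c \<noteq> 0 \<and> (\<forall>i\<in>{0..k}. y i = c * y0 i)" "p
      = proj_rel k `` {y0}"
    if "p \<in> proj_space k" "y \<in> p" "y0 \<in> p" for p y y0
  proof -
    note pyy = that
    obtain z where z: "z \<in> nonzero_points k" "p = proj_rel k `` {z}"
      using pyy(1) unfolding proj_space_def by (rule quotientE)
    have "(z, y) \<in> proj_rel k" "(z, y0) \<in> proj_rel k" using pyy z by auto
    then have yy: "(y0, y) \<in> proj_rel k"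
      using equiv_proj_rel[of k] by (meson equivE symE transE)
    then show "y \<in> nonzero_points k" "y0 \<in> nonzero_points k" "\<exists>c. c \<noteq> 0 \<and> (\<forall>i\<in>{0..k}. y i = c * y0 i)"
      by (auto simp: proj_rel_def)
    show "p = proj_rel k `` {y0}" using z \<open>(z, y0) \<in> proj_rel k\<close> equiv_class_eq[OF equiv_proj_rel] by metis
  qed
  show "\<forall>p\<in>proj_eigenvalues n k d A. \<forall>y\<in>p. y 0 \<noteq> 0"
  proof (intro ballI)
    fix p y assume p: "p \<in> proj_eigenvalues n k d A" and y: "y \<in> p"
    then obtain y0 where y0: "p \<in> proj_space k" "y0 \<in> p" "mrank (hom_pencil n k d A y0) < n"
      by (auto simp: proj_eigenvalues_def)
    have "y0 0 \<noteq> 0" using inf same(2)[OF y0(1) y y0(2)] y0(3) by blast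
    moreover obtain c where "c \<noteq> 0" "y 0 = c * y0 0" using same(3)[OF y0(1) y y0(2)] by auto
    ultimately show "y 0 \<noteq> 0" by simp
  qed
  have "bij_betw ?F (finite_eigenvalues n k d A) (proj_eigenvalues n k d A)"
    unfolding bij_betw_def
  proof (intro conjI equalityI subsetI)
    show "inj_on ?F (finite_eigenvalues n k d A)"
    proof (rule inj_onI)
      fix l l' assume l: "l \<in> finite_eigenvalues n k d A" "l' \<in> finite_eigenvalues n k d A" "?F l = ?F l'"
      have "(hom_pt l, hom_pt l') \<in> proj_rel k"
        using l(3) eq_equiv_class[OF _ equiv_proj_rel hom_pt_nonzero] by blast
      then obtain c where c: "\<forall>i\<in>{0..k}. hom_pt l' i = c * hom_pt l i" by (auto simp: proj_rel_def)
      then have "c = 1" using bspec[OF c, of 0] by (simp add: hom_pt_def)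
      then have "l i = l' i" if "i \<in> {1..k}" for i using bspec[OF c, of i] that by (simp add: hom_pt_def)
      moreover have "l \<in> {1..k} \<rightarrow>\<^sub>E UNIV" "l' \<in> {1..k} \<rightarrow>\<^sub>E UNIV"
        using l by (auto simp: finite_eigenvalues_def cspace_def)
      ultimately show "l = l'" by (intro PiE_ext)
    qed
    fix p
    show "p \<in> proj_eigenvalues n k d A" if pF: "p \<in> ?F ` finite_eigenvalues n k d A"
    proof -
      obtain l where l: "mrank (pencil n k d A l) < n" "p = ?F l" using pF
          by (auto simp: finite_eigenvalues_def)
      have "mrank (hom_pencil n k d A (hom_pt l)) < n"
        using l(1) by (subst mrank_hom_pencil[of _ 1 l]) (auto simp: hom_pt_def)
      moreover have "hom_pt l \<in> p" using hom_pt_nonzero equiv_class_self[OF equiv_proj_rel] l(2) by blast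
      moreover have "p \<in> proj_space k" using hom_pt_nonzero l(2)
          by (auto simp: proj_space_def intro: quotientI)
      ultimately show ?thesis by (auto simp: proj_eigenvalues_def)
    qed
    assume "p \<in> proj_eigenvalues n k d A"
    then obtain y where y: "p \<in> proj_space k" "y \<in> p" "mrank (hom_pencil n k d A y) < n"
      by (auto simp: proj_eigenvalues_def)
    have ynz: "y \<in> nonzero_points k" using same(1)[OF y(1,2,2)] .
    then have y0: "y 0 \<noteq> 0" using inf y(3) by blast
    define l where "l = (\<lambda>i\<in>{1..k}. y i / y 0)"
    have "mrank (pencil n k d A l) < n"
      using y(3) mrank_hom_pencil[of y "y 0" l A] y0 by (simp add: l_def)
    then have "l \<in> finite_eigenvalues n k d A" by (simp add: finite_eigenvalues_def l_def cspace_def)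
    moreover have "(y, hom_pt l) \<in> proj_rel k"
      using ynz hom_pt_nonzero[of l] y0 unfolding proj_rel_def
      by (auto simp: hom_pt_def l_def intro!: exI[of _ "inverse (y 0)"] simp: divide_inverse mult.commute)
    then have "p = ?F l" using same(4)[OF y(1,2,2)] equiv_class_eq[OF equiv_proj_rel] by metis
    ultimately show "p \<in> ?F ` finite_eigenvalues n k d A" by blast
  qed
  then show "card (proj_eigenvalues n k d A) = card (finite_eigenvalues n k d A)"
    by (rule bij_betw_same_card[symmetric])
qed

lemma hom_pencil_infinity:
  assumes NM: "N < M" and span: "\<And>f. filt V M f \<Longrightarrow>
      \<exists>c. filt (row_gens (entries n k d A)) M (f - (\<Sum>a<N. cst (c a) * last_mono a))"
    and y: "y \<in> nonzero_points k" "mrank (hom_pencil n k d A y) < n"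
  shows "y 0 \<noteq> 0"
proof
  assume y0: "y 0 = 0"
  have p: "\<exists>i\<in>{1..k}. y i \<noteq> 0"
  proof -
    obtain i where i: "i \<in> {0..k}" "y i \<noteq> 0" using y(1) by (auto simp: nonzero_points_def)
    moreover have "i \<noteq> 0" using i(2) y0 by (cases "i = 0") auto
    ultimately show ?thesis by (intro bexI[of _ i]) auto
  qed
  obtain v where v: "\<exists>j<n. v j \<noteq> 0" "\<And>i. i < rows \<Longrightarrow> (\<Sum>j<n. (\<Sum>\<omega>\<in>multi_indices k d.
      y 0 ^ (d - mi_size k \<omega>) * mi_power k y \<omega> * A \<omega> $$ (i, j)) * v j) = 0"
    using y(2) unfolding hom_pencil_def mrank_less_iff_fun by blast
  show False
  proof (rule no_solution_at_infinity[OF NM span p v(1)])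
    fix i assume i: "i < rows"
    let ?x = "entries n k d A"
    have "(\<Sum>(\<omega>, j)\<in>multi_indices k d \<times> {..<n}. if mi_size k \<omega>
        = d then ?x (\<omega>, i, j) * mi_power k y \<omega> * v j else 0)
        = (\<Sum>j<n. \<Sum>\<omega>\<in>multi_indices k d. if mi_size k \<omega> = d then ?x (\<omega>, i, j) * mi_power k y \<omega> * v j else 0)"
      by (simp add: sum.cartesian_product[symmetric] sum.swap[of _ "multi_indices k d"])
    \<comment> \<open>As \<open>y 0\<close> is 0, the homogenizing power is 1 for multi-indices of
      size \<open>d\<close> and 0 for all smaller ones.\<close>
    also have "\<dots> = (\<Sum>j<n. \<Sum>\<omega>\<in>multi_indices k d. y 0 ^ (d
        - mi_size k \<omega>) * mi_power k y \<omega> * A \<omega> $$ (i, j) * v j)"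
      using i by (intro sum.cong) (auto simp: entries_index y0 power_0_left multi_indices_def)
    finally show "(\<Sum>(\<omega>, j)\<in>multi_indices k d \<times> {..<n}. if mi_size k \<omega>
        = d then ?x (\<omega>, i, j) * mi_power k y \<omega> * v j else 0) = 0"
      using v(2)[OF i] by (simp add: sum_distrib_right)
  qed
qed

end

section \<open>Simple roots and the discriminant\<close>

lemma sum_order_complex:
  assumes "(p :: complex poly) \<noteq> 0"
  shows "(\<Sum>z | poly p z = 0. order z p) = degree p"
  using size_proots_complex[of p] assms by (simp add: size_multiset_overloaded_eq)

text \<open>Multiplicities add up to the degree, so there are as many roots as the degree exactly
  when every multiplicity is 1.\<close>

lemma rsquarefree_iff_card_roots:
  assumes p: "(p :: complex poly) \<noteq> 0"
  shows "rsquarefree p \<longleftrightarrow> degree p \<le> card {z. poly p z = 0}"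
proof
  have fin: "finite {z. poly p z = 0}" using p by (rule poly_roots_finite)
  have pos: "1 \<le> order z p" if "poly p z = 0" for z using that p order_root[of p z] by simp
  {
    assume r: "rsquarefree p"
    have "degree p = (\<Sum>z | poly p z = 0. order z p)" using p by (simp add: sum_order_complex)
    also have "\<dots> = (\<Sum>z | poly p z = 0. 1)"
      by (intro sum.cong refl) (use r pos in \<open>force simp: rsquarefree_def\<close>)
    finally show "degree p \<le> card {z. poly p z = 0}" by simp
  }
  {
    assume *: "degree p \<le> card {z. poly p z = 0}"
    have "order z p = 1" if z: "poly p z = 0" for z
    proof (rule ccontr)
      assume "order z p \<noteq> 1"
      then have "1 < order z p" using pos[OF z] by simp
      then have "(\<Sum>z | poly p z = 0. 1) < (\<Sum>z | poly p z = 0. order z p)"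
        using z pos by (intro sum_strict_mono_ex1 fin) auto
      then show False using * p by (simp add: sum_order_complex)
    qed
    moreover have "order z p = 0" if "poly p z \<noteq> 0" for z using that order_root[of p z] by simp
    ultimately show "rsquarefree p" using p by (auto simp: rsquarefree_def)
  }
qed

lemma resultant_pderiv:
  assumes p: "(p :: complex poly) \<noteq> 0"
  shows "resultant p (pderiv p) \<noteq> 0 \<longleftrightarrow> rsquarefree p"
proof -
  have "degree (gcd p (pderiv p)) \<noteq> 0 \<longleftrightarrow> (\<exists>a. poly (gcd p (pderiv p)) a = 0)"
  proof
    assume "degree (gcd p (pderiv p)) \<noteq> 0"
    then show "\<exists>a. poly (gcd p (pderiv p)) a = 0" by (intro alg_closed_imp_poly_has_root) simp
  next
    assume "\<exists>a. poly (gcd p (pderiv p)) a = 0"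
    then show "degree (gcd p (pderiv p)) \<noteq> 0"
      using p by (auto elim!: degree_eq_zeroE)
  qed
  also have "(\<exists>a. poly (gcd p (pderiv p)) a = 0) \<longleftrightarrow> (\<exists>a. poly p a = 0 \<and> poly (pderiv p) a = 0)"
    by (simp add: poly_eq_0_iff_dvd)
  finally show ?thesis by (auto simp: resultant_0_gcd rsquarefree_roots)
qed

context rect
begin

section \<open>The generic set\<close>

text \<open>\<open>d * rows\<close> is what the codimension count asks for; \<open>N + 1\<close>
  makes room for lambda_1^N and keeps the basis monomials strictly below the top degree.\<close>

definition top_degree :: nat where "top_degree = d * rows + N + 1"

lemma N_less_top_degree: "N < top_degree"
  by (simp add: top_degree_def)

lemma N_pos: "0 < N"
  using n d by (simp add: N_def)

text \<open>The polynomial chi times the determinant, from reducing lambda_1^N times the last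
  unknown. Clearing the denominator makes the coefficients polynomial in the family.\<close>

definition elim_poly :: "(multi_index \<times> nat \<times> nat \<Rightarrow> complex) \<Rightarrow> (nat \<Rightarrow> (nat \<Rightarrow>\<^sub>0 nat) \<times> nat) \<Rightarrow> complex poly"
  where "elim_poly x G = monom (det (colmat x top_degree G)) N
      - (\<Sum>a<N. monom (cramer_coeff x top_degree G (last_mono N) a) a)"

text \<open>The Sylvester matrix has the fixed sizes \<open>N\<close> and \<open>N - 1\<close>
  whatever the actual degrees are, so this is a polynomial function on the whole coefficient space;
  it is the resultant wherever the leading coefficient is nonzero.\<close>

definition disc :: "(multi_index \<times> nat \<times> nat \<Rightarrow> complex) \<Rightarrow> (nat \<Rightarrow> (nat \<Rightarrow>\<^sub>0 nat) \<times> nat) \<Rightarrow> complex"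
  where "disc x G = det (sylvester_mat_sub N (N - 1) (elim_poly x G) (pderiv (elim_poly x G)))"

lemma coeff_elim_poly: "coeff (elim_poly x G) a =
    (if a = N then det (colmat x top_degree G) else
        if a < N then - cramer_coeff x top_degree G (last_mono N) a else 0)"
  by (simp add: elim_poly_def coeff_sum)

lemma polyfun_lookup_rowmult:
  assumes "g \<in> rowmult_idx m"
  shows "polyfun (entry_indices n k d) (\<lambda>x. Poly_Mapping.lookup (rowmult x g) u)"
proof -
  obtain \<beta> i where g: "g = (\<beta>, i)" "i < rows" using assms by (auto simp: rowmult_idx_def)
  show ?thesis unfolding g(1) lookup_rowmult case_prod_unfold
    by (intro polyfun_sum polyfun_if polyfun_const polyfun_var) (use g(2) in \<open>auto simp: entry_indices_def\<close>)
qed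

lemma polyfun_lookup_column:
  assumes "admissible m G" "q < card (mons m)"
  shows "polyfun (entry_indices n k d) (\<lambda>x. Poly_Mapping.lookup (column x G q) u)"
proof (cases "q < N")
  case True
  then show ?thesis by (simp add: column_def polyfun_const)
next
  case False
  then show ?thesis using assms polyfun_lookup_rowmult[of "G q" m u]
      by (simp add: column_def admissible_def)
qed

lemma polyfun_det_colmat: "admissible m G \<Longrightarrow> polyfun (entry_indices n k d) (\<lambda>x. det (colmat x m G))"
  unfolding colmat_def by (intro polyfun_det polyfun_lookup_column)

lemma polyfun_cramer_coeff:
  "admissible m G \<Longrightarrow> q < card (mons m) \<Longrightarrow> polyfun (entry_indices n k d) (\<lambda>x. cramer_coeff x m G f q)"
  unfolding cramer_coeff_def colmat_def
  by (intro polyfun_sum polyfun_mult polyfun_const polyfun_adj_mat polyfun_lookup_column) auto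

lemma polyfun_coeff_elim_poly:
  assumes G: "admissible top_degree G"
  shows "polyfun (entry_indices n k d) (\<lambda>x. coeff (elim_poly x G) a)"
proof -
  consider "a = N" | "a < N" | "a > N" by linarith
  then show ?thesis
  proof cases
    case 2
    then have "a < card (mons top_degree)" using G by (simp add: admissible_def)
    then show ?thesis using 2 by (simp add: coeff_elim_poly polyfun_uminus polyfun_cramer_coeff[OF G])
  qed (simp_all add: coeff_elim_poly polyfun_const polyfun_det_colmat[OF G])
qed

lemma polyfun_disc:
  assumes G: "admissible top_degree G"
  shows "polyfun (entry_indices n k d) (\<lambda>x. disc x G)"
  unfolding disc_def sylvester_mat_sub_def coeff_pderiv
  by (intro polyfun_det polyfun_if polyfun_const polyfun_mult polyfun_coeff_elim_poly[OF G])

context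
  fixes x :: "multi_index \<times> nat \<times> nat \<Rightarrow> complex" and G
  assumes G: "admissible top_degree G" and D: "det (colmat x top_degree G) \<noteq> 0"
begin

lemma degree_elim_poly: "degree (elim_poly x G) = N"
proof (rule antisym)
  show "degree (elim_poly x G) \<le> N" by (rule degree_le) (simp add: coeff_elim_poly)
  show "N \<le> degree (elim_poly x G)" by (rule le_degree) (simp add: coeff_elim_poly D)
qed

lemma elim_poly_nonzero: "elim_poly x G \<noteq> 0"
  using degree_elim_poly N_pos by auto

lemma disc_nonzero_iff: "disc x G \<noteq> 0 \<longleftrightarrow> N \<le> card {z. poly (elim_poly x G) z = 0}"
proof -
  have "disc x G = resultant (elim_poly x G) (pderiv (elim_poly x G))"
    by (simp add: disc_def resultant_def sylvester_mat_def degree_pderiv degree_elim_poly)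
  then show ?thesis
    using resultant_pderiv[OF elim_poly_nonzero] rsquarefree_iff_card_roots[OF elim_poly_nonzero]
        by (simp add: degree_elim_poly)
qed

lemma span_top_degree: "filt V top_degree f \<Longrightarrow> \<exists>c. filt (row_gens x) top_degree (f
    - (\<Sum>a<N. cst (c a) * last_mono a))"
  by (rule exI) (rule span_of_det[OF G D])

lemma bij_eigen_pts_elim_poly: "bij_betw (\<lambda>l. l 1) (eigen_pts x) {z. poly (elim_poly x G) z = 0}"
proof -
  define c where "c a = cramer_coeff x top_degree G (last_mono N) a / det (colmat x top_degree G)" for a
  define \<chi> where "\<chi> = monom 1 N - (\<Sum>a<N. monom (c a) a)"
  have co: "coeff \<chi> a = (if a = N then 1 else if a < N then - c a else 0)" for a
    by (simp add: \<chi>_def coeff_sum)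
  have cp: "elim_poly x G = smult (det (colmat x top_degree G)) \<chi>"
    by (rule poly_eqI) (simp add: coeff_elim_poly co c_def D)
  have "last_poly \<chi> = (\<Sum>a<Suc N. cst (coeff \<chi> a) * last_mono a)" by (rule last_poly_lessThan) (simp add: co)
  also have "\<dots> = last_mono N - (\<Sum>a<N. cst (c a) * last_mono a)"
    by (simp add: co single_uminus sum_negf)
  also have "filt (row_gens x) top_degree \<dots>"
    unfolding c_def by (intro span_of_det[OF G D] filt_last_mono) (simp add: less_imp_le N_less_top_degree)
  finally have "row_module x (last_poly \<chi>)" by (intro row_module_filt[OF N_less_top_degree span_top_degree])
  then have "bij_betw (\<lambda>l. l 1) (eigen_pts x) {z. poly \<chi> z = 0}"
    by (intro bij_eigen_pts[OF N_less_top_degree span_top_degree \<chi>_def])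
  then show ?thesis by (simp add: cp D)
qed

end

text \<open>The two encodings of a special solution can differ only at variable 0, which no row
  contains.\<close>

lemma special_pt_join_pt: "S \<in> special_sols \<Longrightarrow> pev (row x i) (join_pt (pt S) (kernel_coeff S))
    = pev (row x i) (special_pt S)"
  unfolding hom_eval_row[OF comm_ring_hom_ident]
proof (intro sum.cong refl, clarify)
  fix \<omega> j assume "\<omega> \<in> multi_indices k d" "j < n"
  have "join_pt (pt S) (kernel_coeff S) v = special_pt S v" if "v \<in> Poly_Mapping.keys (\<omega> + xmon j)" for v
  proof -
    have "v \<in> {1..k} \<or> v = k + 1 + j"
      using that keys_add[of \<omega> "xmon j"] \<open>\<omega> \<in> _\<close> by (auto simp: multi_indices_def xmon_def split: if_splits)
    then show ?thesis by (auto simp: join_pt_def special_pt_def)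
  qed
  then show "x (\<omega>, i, j) * mon_eval (join_pt (pt S) (kernel_coeff S)) (\<omega> + xmon j)
      = x (\<omega>, i, j) * mon_eval (special_pt S) (\<omega> + xmon j)"
    by (simp add: mon_eval_def)
qed

text \<open>Finiteness is assumed because \<open>card\<close> is 0 on infinite sets; it will come
  from the bijection with the roots of \<open>elim_poly\<close>.\<close>

lemma card_eigen_pts_special_coeffs:
  assumes fin: "finite (eigen_pts special_coeffs)"
  shows "N \<le> card (eigen_pts special_coeffs)"
proof -
  let ?f = "\<lambda>S. restrict (pt S) {1..k}"
  have "?f S \<in> eigen_pts special_coeffs" if S: "S \<in> special_sols" for S
  proof -
    have "pev (row special_coeffs i) (join_pt (?f S) (kernel_coeff S)) = 0" if i: "i < rows" for i
    proof -
      have "join_pt (?f S) (kernel_coeff S) = join_pt (pt S) (kernel_coeff S)"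
          by (rule ext) (simp add: join_pt_def)
      then have "pev (row special_coeffs i) (join_pt (?f S) (kernel_coeff S))
          = pev (aprod i * vrow i) (special_pt S)"
        using special_pt_join_pt[OF S, of special_coeffs i] row_special_coeffs[OF i] by simp
      then show ?thesis using pev_aprod[OF S, of i] pev_vrow[OF S i] by (auto simp: hom_eval_ident)
    qed
    moreover have "\<exists>j<n. kernel_coeff S j \<noteq> 0" using kernel_coeff_top[OF S] n
        by (intro exI[of _ "n - 1"]) simp
    ultimately show ?thesis unfolding eigen_pts_def
        by (intro CollectI conjI exI[of _ "kernel_coeff S"]) (auto simp: cspace_def)
  qed
  moreover have "inj_on ?f special_sols"
  proof (rule inj_onI)
    fix S T assume "S \<in> special_sols" "T \<in> special_sols" "?f S = ?f T"
    moreover from this have "pt S 1 = pt T 1" using one_in_k by (metis restrict_apply')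
    ultimately show "S = T" using inj_pt_1 by (auto dest: inj_onD)
  qed
  ultimately have "card special_sols \<le> card (eigen_pts special_coeffs)" using fin
      by (intro card_inj_on_le[of ?f]) auto
  then show ?thesis using card_special_sols by simp
qed

theorem generic_count:
  "\<exists>\<Omega>. generic_tuples n k d \<Omega> \<and>
    (\<forall>A\<in>\<Omega>.
      card (proj_eigenvalues n k d A) = N \<and>
      (\<forall>p\<in>proj_eigenvalues n k d A. \<forall>x\<in>p. x 0 \<noteq> 0) \<and>
      card (finite_eigenvalues n k d A) = N)"
proof -
  have "\<exists>c. filt (row_gens special_coeffs) top_degree (f - (\<Sum>a<N. cst (c a) * last_mono a))"
      if "filt V top_degree f" for f
    using special_span[of top_degree f] that unfolding special_gens_special_coeffs
        by (simp add: top_degree_def)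
  then obtain G where G: "admissible top_degree G" and D0: "det (colmat special_coeffs top_degree G) \<noteq> 0"
    using select_columns[of top_degree special_coeffs] by (auto simp: top_degree_def)
  \<comment> \<open>The first factor guarantees the basis of the quotient and with it the
    elimination polynomial, the second that the roots of this polynomial are distinct.\<close>
  define F where "F x = det (colmat x top_degree G) * disc x G" for x
  have F: "polyfun (entry_indices n k d) F"
    unfolding F_def by (intro polyfun_mult polyfun_det_colmat polyfun_disc G)
  have bij: "bij_betw (\<lambda>l. l 1) (eigen_pts special_coeffs) {z. poly (elim_poly special_coeffs G) z = 0}"
      by (rule bij_eigen_pts_elim_poly[OF G D0])
  then have "finite (eigen_pts special_coeffs)"
    using bij_betw_finite poly_roots_finite[OF elim_poly_nonzero[OF G D0]] by blast
  \<comment> \<open>The special solutions have distinct first coordinates, so they exhaust the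
    degree \<open>N\<close> and the discriminant does not vanish at the special family.\<close>
  then have "N \<le> card {z. poly (elim_poly special_coeffs G) z = 0}"
    using card_eigen_pts_special_coeffs bij_betw_same_card[OF bij] by simp
  then have "F special_coeffs \<noteq> 0" using D0 by (simp add: F_def disc_nonzero_iff[OF G D0])
  moreover have "special_coeffs \<in> cspace (entry_indices n k d)" by (simp add: special_coeffs_def cspace_def)
  ultimately have gen: "generic (entry_indices n k d) {x \<in> cspace (entry_indices n k d). F x \<noteq> 0}"
    by (intro generic_polyfun[OF F])
  define \<Omega> where "\<Omega> = {A \<in> matrix_tuples n k d. F (entries n k d A) \<noteq> 0}"
  have "entries n k d ` \<Omega> = {x \<in> cspace (entry_indices n k d). F x \<noteq> 0}"
    using bij_betw_entries[of n k d] unfolding \<Omega>_def bij_betw_def by auto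
  then have "generic_tuples n k d \<Omega>" using gen by (auto simp: generic_tuples_def \<Omega>_def)
  moreover have "card (proj_eigenvalues n k d A) = N \<and>
      (\<forall>p\<in>proj_eigenvalues n k d A. \<forall>x\<in>p. x 0 \<noteq> 0) \<and> card (finite_eigenvalues n k d A) = N"
    if A: "A \<in> \<Omega>" for A
  proof -
    let ?x = "entries n k d A"
    have D: "det (colmat ?x top_degree G) \<noteq> 0" and disc: "disc ?x G \<noteq> 0" using A by (auto simp: \<Omega>_def F_def)
    have inf: "y 0 \<noteq> 0" if "y \<in> nonzero_points k" "mrank (hom_pencil n k d A y) < n" for y
      using N_less_top_degree span_top_degree[OF G D] that by (rule hom_pencil_infinity)
    have "N \<le> card {z. poly (elim_poly ?x G) z = 0}" using disc_nonzero_iff[OF G D] disc by simp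
    moreover have "card {z. poly (elim_poly ?x G) z = 0} \<le> N"
      using card_poly_roots_bound[OF elim_poly_nonzero[OF G D]] by (simp add: degree_elim_poly[OF G D])
    ultimately have card: "card (finite_eigenvalues n k d A) = N"
      using bij_betw_same_card[OF bij_eigen_pts_elim_poly[OF G D]]
          by (simp add: finite_eigenvalues_eigen_pts)
    have "card (proj_eigenvalues n k d A) = card (finite_eigenvalues n k d A)"
      using inf by (rule proj_eigenvalues_finite)
    moreover have "\<forall>p\<in>proj_eigenvalues n k d A. \<forall>y\<in>p. y 0 \<noteq> 0"
      using inf by (rule proj_eigenvalues_finite)
    ultimately show ?thesis using card by simp
  qed
  ultimately show ?thesis by blast
qed

end

theorem theorem3:
  fixes n k d :: nat
  assumes "n \<ge> 1" and "k \<ge> 2" and "d \<ge> 2"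
  shows "\<exists>\<Omega>. generic_tuples n k d \<Omega> \<and>
    (\<forall>A\<in>\<Omega>.
      card (proj_eigenvalues n k d A) = d ^ k * ((n + k - 1) choose k) \<and>
      (\<forall>p\<in>proj_eigenvalues n k d A. \<forall>x\<in>p. x 0 \<noteq> 0) \<and>
      card (finite_eigenvalues n k d A) = d ^ k * ((n + k - 1) choose k))"
proof -
  interpret rect n k d by unfold_locales (use assms in auto)
  show ?thesis using generic_count unfolding N_def .
qed

end
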